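(* Let $\mathrm m\ge2$ and let $L$ be an operator on a manifold $\mathsf M$ with $\mathcal T^{(\mathrm m)}_L=0$. Then in a neighbourhood of each point $\mathsf p\in\mathsf M$ there exists a local coordinate system $$u_1=(u_1^1,\dots,u_1^{m_1}),\ u_2=(u_2^1,\dots,u_2^{m_2}),\ \dots,\ u_s=(u_s^1,\dots,u_s^{m_s})$$ in which $L=\operatorname{diag}(L_1,\dots,L_s)$ with $m_i\times m_i$ blocks $L_i$, $i=1,\dots,s$, such that (1) at the point $\mathsf p$, each block $L_i(\mathsf p)$ has either a single real eigenvalue or a single pair of complex conjugate eigenvalues (and no other eigenvalues); (2) $\mathcal T^{(\mathrm m)}_{L_i}=0$ with respect to $u_i$, and $\operatorname{ad}_{L_i}^{\mathrm m-1}\frac{\partial L_i}{\partial u_j^\alpha}=0$ for all $j\neq i$ and $\alpha=1,\dots,m_j$.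
   Context: An operator (field) is a smooth $(1,1)$-tensor field, viewed as a field of endomorphisms of the tangent spaces. The generalised Nijenhuis torsion of level $\mathrm m$ of an operator $L$ is defined recursively by $$\mathcal T^{(1)}_L(\xi,\eta)=L^2[\xi,\eta]+[L\xi,L\eta]-L[L\xi,\eta]-L[\xi,L\eta],$$ $$\mathcal T^{(\mathrm m)}_L(\xi,\eta)=L^2\mathcal T^{(\mathrm m-1)}_L(\xi,\eta)+\mathcal T^{(\mathrm m-1)}_L(L\xi,L\eta)-L\mathcal T^{(\mathrm m-1)}_L(L\xi,\eta)-L\mathcal T^{(\mathrm m-1)}_L(\xi,L\eta),\quad \mathrm m\ge2.$$ For matrices, $\operatorname{ad}_L M=LM-ML$. Each block $L_i$ may depend on all coordinates; "with respect to $u_i$" means that $L_i$ is viewed as an operator field in the coordinates $u_i^1,\dots,u_i^{m_i}$ with all other coordinates fixed. *)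

theory Defs
  imports "HOL-Analysis.Analysis"
begin

section \<open>Smooth maps\<close>

text \<open>On an open set, \<open>Ck_on k\<close> says that all iterated directional derivatives up to order
  \<open>k\<close> exist and are continuous. It is only used on open sets.\<close>

primrec Ck_on :: "nat \<Rightarrow> 'a::real_normed_vector set \<Rightarrow> ('a \<Rightarrow> 'b::real_normed_vector) \<Rightarrow> bool" where
  "Ck_on 0 S f \<longleftrightarrow> continuous_on S f"
| "Ck_on (Suc k) S f \<longleftrightarrow>
     (\<forall>x\<in>S. f differentiable (at x)) \<and> (\<forall>v. Ck_on k S (\<lambda>x. frechet_derivative f (at x) v))"

definition smooth_on :: "'a::real_normed_vector set \<Rightarrow> ('a \<Rightarrow> 'b::real_normed_vector) \<Rightarrow> bool" where
  "smooth_on S f \<longleftrightarrow> (\<forall>k. Ck_on k S f)"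


section \<open>Smooth manifolds\<close>

text \<open>A chart is a pair of its domain and its coordinate map; the values of the coordinate map
  outside the domain are irrelevant.\<close>

type_synonym ('a, 'n) chart = "'a set \<times> ('a \<Rightarrow> real ^ 'n)"

definition is_chart :: "'a topology \<Rightarrow> ('a, 'n::finite) chart \<Rightarrow> bool" where
  "is_chart X = (\<lambda>(U, \<phi>). openin X U \<and> open (\<phi> ` U) \<and>
     homeomorphic_map (subtopology X U) (top_of_set (\<phi> ` U)) \<phi>)"

definition transition :: "('a, 'n::finite) chart \<Rightarrow> ('a, 'n) chart \<Rightarrow> real ^ 'n \<Rightarrow> real ^ 'n" where
  "transition c d = snd d \<circ> inv_into (fst c) (snd c)"

definition compatible :: "('a, 'n::finite) chart \<Rightarrow> ('a, 'n) chart \<Rightarrow> bool" where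
  "compatible c d \<longleftrightarrow>
     smooth_on (snd c ` (fst c \<inter> fst d)) (transition c d) \<and>
     smooth_on (snd d ` (fst c \<inter> fst d)) (transition d c)"

text \<open>The atlas is required to be maximal, so that the local coordinate systems on the manifold
  are exactly its members.\<close>

definition smooth_manifold :: "'a topology \<Rightarrow> ('a, 'n::finite) chart set \<Rightarrow> bool" where
  "smooth_manifold X \<A> \<longleftrightarrow>
     Hausdorff_space X \<and> second_countable X \<and>
     (\<forall>c\<in>\<A>. is_chart X c) \<and>
     (\<Union>c\<in>\<A>. fst c) = topspace X \<and>
     (\<forall>c\<in>\<A>. \<forall>d\<in>\<A>. compatible c d) \<and>
     (\<forall>c. is_chart X c \<and> (\<forall>d\<in>\<A>. compatible c d) \<longrightarrow> c \<in> \<A>)"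


section \<open>Operator fields\<close>

text \<open>A (1,1)-tensor field is given by its components: \<open>L c x\<close> is the matrix, in the coordinate
  frame of the chart \<open>c\<close>, of the endomorphism of the tangent space at the point of the domain of
  \<open>c\<close> with coordinates \<open>x\<close>. Rows carry the upper index, columns the lower one. If \<open>J\<close> is the
  Jacobian matrix of the change of coordinates from \<open>c\<close> to \<open>d\<close>, then
  \<open>L\<^sub>d J = J L\<^sub>c\<close>.\<close>

definition operator_field ::
    "('a, 'n::finite) chart set \<Rightarrow> (('a, 'n) chart \<Rightarrow> real ^ 'n \<Rightarrow> real ^ 'n ^ 'n) \<Rightarrow> bool" where
  "operator_field \<A> L \<longleftrightarrow>
     (\<forall>c\<in>\<A>. smooth_on (snd c ` fst c) (L c)) \<and>
     (\<forall>c\<in>\<A>. \<forall>d\<in>\<A>. \<forall>p \<in> fst c \<inter> fst d.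
        let J = jacobian (transition c d) (at (snd c p))
        in L d (snd d p) ** J = J ** L c (snd c p))"


section \<open>Generalised Nijenhuis torsion\<close>

definition lie_bracket ::
    "(real ^ 'n \<Rightarrow> real ^ 'n) \<Rightarrow> (real ^ 'n \<Rightarrow> real ^ 'n) \<Rightarrow> real ^ 'n::finite \<Rightarrow> real ^ 'n" where
  "lie_bracket \<xi> \<eta> x =
     frechet_derivative \<eta> (at x) (\<xi> x) - frechet_derivative \<xi> (at x) (\<eta> x)"

definition app_op ::
    "(real ^ 'n \<Rightarrow> real ^ 'n ^ 'n) \<Rightarrow> (real ^ 'n \<Rightarrow> real ^ 'n) \<Rightarrow> real ^ 'n::finite \<Rightarrow> real ^ 'n" where
  "app_op A \<xi> = (\<lambda>x. A x *v \<xi> x)"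

text \<open>The recursion is started at level 0 with the Lie bracket; its first step is then the
  classical Nijenhuis torsion, see \<open>torsion_1\<close>.\<close>

primrec torsion ::
    "nat \<Rightarrow> (real ^ 'n \<Rightarrow> real ^ 'n ^ 'n) \<Rightarrow> (real ^ 'n \<Rightarrow> real ^ 'n) \<Rightarrow> (real ^ 'n \<Rightarrow> real ^ 'n) \<Rightarrow>
      real ^ 'n::finite \<Rightarrow> real ^ 'n" where
  "torsion 0 A \<xi> \<eta> = lie_bracket \<xi> \<eta>"
| "torsion (Suc m) A \<xi> \<eta> = (\<lambda>x.
     app_op A (app_op A (torsion m A \<xi> \<eta>)) x
     + torsion m A (app_op A \<xi>) (app_op A \<eta>) x
     - app_op A (torsion m A (app_op A \<xi>) \<eta>) x
     - app_op A (torsion m A \<xi> (app_op A \<eta>)) x)"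

lemma torsion_1:
  "torsion 1 A \<xi> \<eta> x =
     A x *v (A x *v lie_bracket \<xi> \<eta> x) + lie_bracket (app_op A \<xi>) (app_op A \<eta>) x
     - A x *v lie_bracket (app_op A \<xi>) \<eta> x - A x *v lie_bracket \<xi> (app_op A \<eta>) x"
  by (simp add: app_op_def)

text \<open>\<open>torsion_free_wrt B m V A\<close>: the torsion of level \<open>m\<close> of the operator \<open>A\<close> on the
  coordinate domain \<open>V\<close> vanishes with respect to the coordinates with index in \<open>B\<close>. The vector
  fields range over all locally defined ones of the form
  \<open>\<Sum>b\<in>B. \<xi>\<^sup>b \<partial>/\<partial>x\<^sup>b\<close>. On such fields the Lie bracket only involves the
  derivatives in the directions of \<open>B\<close>, so the remaining coordinates play the role of fixed
  parameters. For \<open>B\<close> different from \<open>UNIV\<close> this is meant for operators \<open>A\<close> that preserve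
  the span of these directions.\<close>

definition torsion_free_wrt ::
    "'n set \<Rightarrow> nat \<Rightarrow> (real ^ 'n) set \<Rightarrow> (real ^ 'n::finite \<Rightarrow> real ^ 'n ^ 'n) \<Rightarrow> bool" where
  "torsion_free_wrt B m V A \<longleftrightarrow>
     (\<forall>W \<xi> \<eta>. open W \<and> W \<subseteq> V \<and> smooth_on W \<xi> \<and> smooth_on W \<eta> \<and>
        (\<forall>x\<in>W. \<forall>a. a \<notin> B \<longrightarrow> \<xi> x $ a = 0 \<and> \<eta> x $ a = 0)
        \<longrightarrow> (\<forall>x\<in>W. torsion m A \<xi> \<eta> x = 0))"

text \<open>The torsion is a tensor, so on the manifold its vanishing is expressed in charts.\<close>

definition torsion_free ::
    "('a, 'n::finite) chart set \<Rightarrow> nat \<Rightarrow> (('a, 'n) chart \<Rightarrow> real ^ 'n \<Rightarrow> real ^ 'n ^ 'n) \<Rightarrow> bool" where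
  "torsion_free \<A> m L \<longleftrightarrow> (\<forall>c\<in>\<A>. torsion_free_wrt UNIV m (snd c ` fst c) (L c))"


section \<open>Diagonal blocks\<close>

text \<open>A splitting of the coordinates into groups is a partition of the index type \<open>'n\<close>, and the
  block belonging to an index set \<open>B\<close> is a matrix with rows and columns in \<open>B\<close>. It is encoded
  as an \<open>'n\<close> by \<open>'n\<close> matrix that is zero outside of \<open>B \<times> B\<close>; this is compatible with
  products, commutators and derivatives, but it adds spurious zero eigenvalues, so that
  eigenvectors have to be restricted to those supported in \<open>B\<close>.\<close>

definition block :: "'n set \<Rightarrow> real ^ 'n ^ 'n \<Rightarrow> real ^ 'n ^ 'n::finite" where
  "block B A = (\<chi> a b. if a \<in> B \<and> b \<in> B then A $ a $ b else 0)"

definition block_diagonal :: "'n set set \<Rightarrow> real ^ 'n ^ 'n::finite \<Rightarrow> bool" where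
  "block_diagonal P A \<longleftrightarrow> (\<forall>a b. A $ a $ b \<noteq> 0 \<longrightarrow> (\<exists>B\<in>P. a \<in> B \<and> b \<in> B))"

definition block_eigenvalues :: "'n set \<Rightarrow> real ^ 'n ^ 'n::finite \<Rightarrow> complex set" where
  "block_eigenvalues B A =
     {\<mu>. \<exists>v :: complex ^ 'n. v \<noteq> 0 \<and> (\<forall>a. a \<notin> B \<longrightarrow> v $ a = 0) \<and>
        (\<chi> a b. complex_of_real (block B A $ a $ b)) *v v = \<mu> *s v}"

definition ad :: "real ^ 'n ^ 'n \<Rightarrow> real ^ 'n ^ 'n \<Rightarrow> real ^ 'n ^ 'n::finite" where
  "ad A M = A ** M - M ** A"

definition partial_deriv ::
    "'n \<Rightarrow> (real ^ 'n \<Rightarrow> 'b) \<Rightarrow> real ^ 'n::finite \<Rightarrow> 'b::real_normed_vector" where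
  "partial_deriv a f x = frechet_derivative f (at x) (axis a 1)"

end

theory Submission
  imports Defs
    "HOL-Computational_Algebra.Fundamental_Theorem_Algebra"
    "HOL-Computational_Algebra.Polynomial_Factorial"
    "HOL-Computational_Algebra.Field_as_Ring"
begin

text \<open>Write \<open>L\<^sub>1\<close> and \<open>L\<^sub>2\<close> for the action of \<open>L\<close> on the two arguments of a bilinear map. Then
  \<open>\<T>\<^sup>(\<^sup>m\<^sup>) = (L - L\<^sub>1)\<^sup>m (L - L\<^sub>2)\<^sup>m [\<cdot>,\<cdot>]\<close>. Near \<open>p\<close> the tangent space splits into the spectral subspaces of
  \<open>L\<close>; let \<open>R\<close> be one of the spectral projections. On the kernel of \<open>R\<close> the map \<open>R [\<cdot>,\<cdot>]\<close> is a tensor, and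
  since \<open>L\<close> has no common eigenvalues on the kernel and the image of \<open>R\<close>, both \<open>L - L\<^sub>1\<close> and \<open>L - L\<^sub>2\<close>
  are injective on such tensors (Sylvester). Hence \<open>\<T>\<^sup>(\<^sup>m\<^sup>) = 0\<close> makes the kernel of \<open>R\<close> involutive, and
  Frobenius' theorem gives functions whose differentials annihilate it; together, for all \<open>R\<close>, they are
  the coordinates. In these coordinates, for \<open>\<xi>\<close> outside the block and \<open>\<eta>\<close> inside it, the
  block component of \<open>[\<xi>,\<eta>]\<close> is \<open>\<partial>\<^sub>\<xi> \<eta>\<close>, which \<open>(L - L\<^sub>2)\<^sup>m\<close> turns into
  \<open>- (ad L)\<^sup>m\<^sup>-\<^sup>1 (\<partial>\<^sub>\<xi> L) \<eta>\<close>, so the same injectivity yields the second condition.\<close>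

section \<open>Calculus of smooth maps\<close>

text \<open>Near the point, eigenvalues belonging to one block may split or collide, so they cannot
  be used to define the projections there. At the point itself the projections come from a real
  primary decomposition and are polynomials in the matrix; hence whatever commutes with the matrix
  commutes with them. This one algebraic property makes the linearised block diagonalisation problem
  injective, so that the inverse function theorem yields smooth projections nearby, and it gives
  disjointness of spectra in Sylvester form, which is an open condition. The analytic cost lies in
  Frobenius' theorem. It needs flows depending smoothly on initial values and parameters; they are
  fixed points in a Banach space of curves, and their derivatives are identified through the
  variational equation. Condition (1) survives the changes of coordinates because a linear change
  first adapts the frame at the point, and the nonlinear change that follows has the identity as its
  derivative there.\<close>

lemma Ck_on_cong:
  assumes "open S" "\<And>x. x \<in> S \<Longrightarrow> f x = g x"
  shows "Ck_on k S f \<longleftrightarrow> Ck_on k S g"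
proof -
  have "Ck_on k S g" if "Ck_on k S f" "\<And>x. x \<in> S \<Longrightarrow> f x = g x" for f g
    using that
  proof (induction k arbitrary: f g)
    case 0
    then show ?case by (auto cong: continuous_on_cong)
  next
    case (Suc k)
    have d: "f differentiable (at x)" if "x \<in> S" for x
      using Suc.prems(1) that by auto
    have eq: "frechet_derivative f (at x) = frechet_derivative g (at x)" if "x \<in> S" for x
      using frechet_derivative_transform_within_open[OF d assms(1)] Suc.prems(2) that by auto
    have "g differentiable (at x)" if "x \<in> S" for x
      using has_derivative_transform_within_open[OF _ assms(1) that] d[OF that] Suc.prems(2)
      unfolding differentiable_def by metis
    moreover have "Ck_on k S (\<lambda>x. frechet_derivative g (at x) v)" for v
      using Suc.IH[of "\<lambda>x. frechet_derivative f (at x) v"] Suc.prems(1) eq by simp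
    ultimately show ?case by simp
  qed
  then show ?thesis using assms(2) by metis
qed

lemma Ck_on_SucI:
  assumes "open S" "\<And>x. x \<in> S \<Longrightarrow> (f has_derivative f' x) (at x)"
    and "\<And>v. Ck_on k S (\<lambda>x. f' x v)"
  shows "Ck_on (Suc k) S f"
proof -
  have "frechet_derivative f (at x) = f' x" if "x \<in> S" for x
    using frechet_derivative_at[OF assms(2)[OF that]] by simp
  then have "Ck_on k S (\<lambda>x. frechet_derivative f (at x) v)" for v
    using assms(3)[of v] Ck_on_cong[OF assms(1), of "\<lambda>x. frechet_derivative f (at x) v"] by auto
  then show ?thesis using assms(2) by (auto simp: differentiable_def)
qed

lemma Ck_on_has_derivative:
  assumes "Ck_on (Suc k) S f" "x \<in> S"
  shows "(f has_derivative frechet_derivative f (at x)) (at x)"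
  using assms frechet_derivative_works by auto

lemma Ck_on_Suc_imp: "Ck_on (Suc k) S f \<Longrightarrow> Ck_on k S f"
proof (induction k arbitrary: f)
  case 0
  then show ?case
    by (auto intro!: continuous_at_imp_continuous_on differentiable_imp_continuous_within)
next
  case (Suc k)
  then show ?case by (metis Ck_on.simps(2))
qed

lemma Ck_on_subset: "Ck_on k S f \<Longrightarrow> T \<subseteq> S \<Longrightarrow> Ck_on k T f"
  by (induction k arbitrary: f) (auto intro: continuous_on_subset)

lemma Ck_on_const: "open S \<Longrightarrow> Ck_on k S (\<lambda>x. c)"
proof (induction k arbitrary: c)
  case (Suc k)
  show ?case
    by (rule Ck_on_SucI[where f' = "\<lambda>_ _. 0"]) (auto intro!: Suc)
qed auto

lemma Ck_on_linear: "open S \<Longrightarrow> bounded_linear f \<Longrightarrow> Ck_on k S f"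
proof (cases k)
  case 0
  assume "bounded_linear f"
  then show ?thesis
    using 0 by (auto intro!: linear_continuous_on)
next
  case (Suc j)
  assume "bounded_linear f" "open S"
  then show ?thesis unfolding Suc
    by (intro Ck_on_SucI[where f' = "\<lambda>_. f"] bounded_linear_imp_has_derivative Ck_on_const)
qed

lemma Ck_on_add:
  assumes "open S"
  shows "Ck_on k S f \<Longrightarrow> Ck_on k S g \<Longrightarrow> Ck_on k S (\<lambda>x. f x + g x)"
proof (induction k arbitrary: f g)
  case (Suc k)
  show ?case
    by (rule Ck_on_SucI[OF assms has_derivative_add[OF Ck_on_has_derivative Ck_on_has_derivative]])
       (use Suc in \<open>auto intro!: Suc.IH\<close>)
qed (auto intro!: continuous_intros)

lemma Ck_on_sum:
  assumes "open S" "\<And>i. i \<in> I \<Longrightarrow> Ck_on k S (f i)"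
  shows "Ck_on k S (\<lambda>x. \<Sum>i\<in>I. f i x)"
  using assms(2)
  by (induction I rule: infinite_finite_induct) (auto intro!: Ck_on_const Ck_on_add assms(1))

lemma Ck_on_bounded_linear:
  assumes "open S" "bounded_linear T"
  shows "Ck_on k S f \<Longrightarrow> Ck_on k S (\<lambda>x. T (f x))"
proof (induction k arbitrary: f)
  case 0
  then show ?case
    using linear_continuous_on[OF assms(2), of "f ` S"] by (auto intro: continuous_on_compose2)
next
  case (Suc k)
  show ?case
    by (rule Ck_on_SucI[OF assms(1) bounded_linear.has_derivative[OF assms(2) Ck_on_has_derivative]])
       (use Suc in \<open>auto intro!: Suc.IH\<close>)
qed

lemma Ck_on_bilinear:
  assumes "open S" "bounded_bilinear B"
  shows "Ck_on k S f \<Longrightarrow> Ck_on k S g \<Longrightarrow> Ck_on k S (\<lambda>x. B (f x) (g x))"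
proof (induction k arbitrary: f g)
  case 0
  then show ?case by (auto intro: bounded_bilinear.continuous_on[OF assms(2)])
next
  case (Suc k)
  have "Ck_on k S f" "Ck_on k S g"
    using Suc.prems by (simp_all only: Ck_on_Suc_imp)
  then show ?case
    by (intro Ck_on_SucI[OF assms(1) bounded_bilinear.FDERIV[OF assms(2) Ck_on_has_derivative Ck_on_has_derivative]])
       (use Suc.prems in \<open>auto intro!: Suc.IH Ck_on_add assms(1)\<close>)
qed

lemma Ck_on_compose:
  fixes f :: "'a::real_normed_vector \<Rightarrow> 'b::euclidean_space"
  assumes "open S"
  shows "Ck_on k S f \<Longrightarrow> Ck_on k T g \<Longrightarrow> f ` S \<subseteq> T \<Longrightarrow> Ck_on k S (\<lambda>x. g (f x))"
proof (induction k arbitrary: f g)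
  case 0
  then show ?case by (auto intro: continuous_on_compose2)
next
  case (Suc k)
  have df: "(f has_derivative frechet_derivative f (at x)) (at x)" if "x \<in> S" for x
    using Ck_on_has_derivative[OF Suc.prems(1) that] .
  have dg: "(g has_derivative frechet_derivative g (at (f x))) (at (f x))" if "x \<in> S" for x
    using Ck_on_has_derivative[OF Suc.prems(2)] Suc.prems(3) that by blast
  \<comment> \<open>The direction of the outer derivative varies with \<open>x\<close>, while
    \<open>Ck_on\<close> speaks of fixed directions only. Expansion in a basis separates the two
    dependences.\<close>
  have "frechet_derivative g (at (f x)) (frechet_derivative f (at x) v) =
      (\<Sum>b\<in>Basis. (frechet_derivative f (at x) v \<bullet> b) *\<^sub>R frechet_derivative g (at (f x)) b)"
    if "x \<in> S" for x v
    by (subst euclidean_representation[of "frechet_derivative f (at x) v", symmetric])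
       (simp only: linear_sum[OF has_derivative_linear[OF dg[OF that]]]
          linear_cmul[OF has_derivative_linear[OF dg[OF that]]])
  moreover have "Ck_on k S (\<lambda>x. \<Sum>b\<in>Basis. (frechet_derivative f (at x) v \<bullet> b) *\<^sub>R
      frechet_derivative g (at (f x)) b)" for v
  proof (intro Ck_on_sum Ck_on_bilinear[OF _ bounded_bilinear_scaleR] assms)
    fix b :: 'b
    show "Ck_on k S (\<lambda>x. frechet_derivative f (at x) v \<bullet> b)"
      using Suc.prems(1) by (intro Ck_on_bounded_linear[OF assms bounded_linear_inner_left]) auto
    show "Ck_on k S (\<lambda>x. frechet_derivative g (at (f x)) b)"
      using Suc.prems Ck_on_Suc_imp[OF Suc.prems(1)]
      by (intro Suc.IH[where g = "\<lambda>y. frechet_derivative g (at y) b"]) auto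
  qed
  ultimately have "Ck_on k S (\<lambda>x. frechet_derivative g (at (f x)) (frechet_derivative f (at x) v))" for v
    using Ck_on_cong[OF assms, of _ _ k] by (metis (no_types, lifting))
  then show ?case
    by (intro Ck_on_SucI[OF assms, where f' = "\<lambda>x v. frechet_derivative g (at (f x)) (frechet_derivative f (at x) v)"]
        has_derivative_compose[OF df dg]) auto
qed

section \<open>Inversion of operators and the inverse function theorem\<close>

lemma has_derivative_bilinear_zero:
  assumes B: "bounded_bilinear B" and f: "(f \<longlongrightarrow> f x) (at x)"
    and g: "(g has_derivative g') (at x)" and "g x = 0"
  shows "((\<lambda>y. B (f y) (g y)) has_derivative (\<lambda>h. B (f x) (g' h))) (at x)"
proof -
  interpret B: bounded_bilinear B by fact
  have g': "bounded_linear g'" using g by (rule has_derivative_bounded_linear)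
  obtain C where C: "\<And>h. norm (g' h) \<le> norm h * C" "C > 0"
    using bounded_linear.pos_bounded[OF g'] by (metis mult.commute)
  obtain K where K: "\<And>a b. norm (B a b) \<le> norm a * norm b * K" "K > 0"
    using B.pos_bounded by blast
  have lim: "((\<lambda>y. (g y - g' (y - x)) /\<^sub>R norm (y - x)) \<longlongrightarrow> 0) (at x)"
    using g \<open>g x = 0\<close> unfolding has_derivative_at_within by simp
  have 1: "((\<lambda>y. B (f y) ((g y - g' (y - x)) /\<^sub>R norm (y - x))) \<longlongrightarrow> 0) (at x)"
    using B.tendsto[OF f lim] by (simp add: B.zero_right)
  have 2: "((\<lambda>y. B (f y - f x) (g' (y - x) /\<^sub>R norm (y - x))) \<longlongrightarrow> 0) (at x)"
  proof (rule Lim_null_comparison)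
    show "((\<lambda>y. norm (f y - f x) * C * K) \<longlongrightarrow> 0) (at x)"
      using tendsto_norm_zero[OF LIM_zero[OF f]] by (intro tendsto_mult_left_zero)
    have "norm (B (f y - f x) (g' (y - x) /\<^sub>R norm (y - x))) \<le> norm (f y - f x) * C * K" for y
    proof -
      have "norm (g' (y - x) /\<^sub>R norm (y - x)) \<le> C"
        using C(1)[of "y - x"] C(2) by (cases "y = x") (auto simp: field_simps divide_simps)
      then have "norm (f y - f x) * norm (g' (y - x) /\<^sub>R norm (y - x)) * K \<le> norm (f y - f x) * C * K"
        using K(2) by (intro mult_right_mono mult_left_mono) auto
      then show ?thesis using K(1) order_trans by blast
    qed
    then show "\<forall>\<^sub>F y in at x. norm (B (f y - f x) (g' (y - x) /\<^sub>R norm (y - x))) \<le> norm (f y - f x) * C * K"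
      by simp
  qed
  \<comment> \<open>Since \<open>g\<close> vanishes at \<open>x\<close>, continuity of
    \<open>f\<close> is enough: the first summand carries the remainder of \<open>g\<close>, the
    second pairs \<open>f y - f x\<close> with a quotient bounded by \<open>C\<close>.\<close>
  have "(B (f y) (g y) - B (f x) (g' (y - x))) /\<^sub>R norm (y - x) =
      B (f y) ((g y - g' (y - x)) /\<^sub>R norm (y - x)) + B (f y - f x) (g' (y - x) /\<^sub>R norm (y - x))" for y
    by (simp add: B.diff_left B.diff_right B.scaleR_right algebra_simps)
  then have "((\<lambda>y. (B (f y) (g y) - B (f x) (g x) - B (f x) (g' (y - x))) /\<^sub>R norm (y - x)) \<longlongrightarrow> 0) (at x)"
    using tendsto_add[OF 1 2] \<open>g x = 0\<close> by (simp add: B.zero_right)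
  then show ?thesis
    unfolding has_derivative_at_within using bounded_linear_compose[OF B.bounded_linear_right g'] by auto
qed

text \<open>This resolvent-type identity yields both the continuity and the derivative of
  inversion.\<close>

lemma blinfun_inverse_diff:
  fixes T R :: "'a \<Rightarrow> 'e::real_normed_vector \<Rightarrow>\<^sub>L 'e"
  assumes "R x o\<^sub>L T x = id_blinfun" "T y o\<^sub>L R y = id_blinfun"
  shows "R y - R x = - (R x o\<^sub>L ((T y - T x) o\<^sub>L R y))"
proof -
  have "R x o\<^sub>L ((T y - T x) o\<^sub>L R y) = (R x o\<^sub>L (T y o\<^sub>L R y)) - ((R x o\<^sub>L T x) o\<^sub>L R y)"
    by (rule blinfun_eqI) (simp add: blinfun.diff_left blinfun.diff_right)
  moreover have "id_blinfun o\<^sub>L A = A" "A o\<^sub>L id_blinfun = A" for A :: "'e \<Rightarrow>\<^sub>L 'e"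
    by (rule blinfun_eqI, simp)+
  ultimately show ?thesis using assms by simp
qed

text \<open>The derivative of the inverse is minus the derivative of \<open>T\<close> multiplied by
  \<open>R\<close> on both sides. It involves nothing but \<open>R\<close> and the derivative of
  \<open>T\<close>, so every order of smoothness passes from \<open>T\<close> to \<open>R\<close> by
  induction.\<close>

lemma Ck_on_blinfun_inverse:
  fixes T R :: "'a::real_normed_vector \<Rightarrow> 'e::real_normed_vector \<Rightarrow>\<^sub>L 'e"
  assumes "open S"
    and inv: "\<And>x. x \<in> S \<Longrightarrow> R x o\<^sub>L T x = id_blinfun" "\<And>x. x \<in> S \<Longrightarrow> T x o\<^sub>L R x = id_blinfun"
  shows "Ck_on k S T \<Longrightarrow> Ck_on k S R"
proof -
  have lim: "(R \<longlongrightarrow> R x) (at x)" if x: "x \<in> S" and T: "(T \<longlongrightarrow> T x) (at x)" for x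
  proof -
    define c where "c = norm (R x) + 1"
    have c: "c > 0" "norm (R x) < c" by (auto simp: c_def add_pos_nonneg add_nonneg_pos)
    have T0: "((\<lambda>y. norm (T y - T x)) \<longlongrightarrow> 0) (at x)"
      using T by (intro tendsto_norm_zero LIM_zero)
    have "\<forall>\<^sub>F y in at x. y \<in> S"
      using \<open>open S\<close> x by (rule eventually_at_in_open')
    \<comment> \<open>The threshold makes the error at most half the norm of \<open>R y\<close>;
      absorbing it bounds that norm by \<open>2 * c\<close> near \<open>x\<close>, before continuity
      of \<open>R\<close> is known.\<close>
    moreover have "\<forall>\<^sub>F y in at x. norm (T y - T x) < 1 / (2 * c)"
      using order_tendstoD(2)[OF T0] c by simp
    ultimately have "\<forall>\<^sub>F y in at x. norm (R y - R x) \<le> (c * (2 * c)) * norm (T y - T x)"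
    proof eventually_elim
      case (elim y)
      have le: "norm (R y - R x) \<le> norm (R x) * (norm (T y - T x) * norm (R y))"
        unfolding blinfun_inverse_diff[where R = R and T = T, OF inv(1)[OF x] inv(2)[OF elim(1)]] norm_minus_cancel
        by (rule order_trans[OF norm_blinfun_compose mult_left_mono[OF norm_blinfun_compose]]) auto
      also have "\<dots> \<le> c * (norm (T y - T x) * norm (R y))"
        using c by (intro mult_right_mono) auto
      finally have 1: "norm (R y - R x) \<le> c * (norm (T y - T x) * norm (R y))" .
      also have "\<dots> \<le> c * (1 / (2 * c) * norm (R y))"
        using elim(2) c by (intro mult_left_mono mult_right_mono) auto
      finally have "norm (R y - R x) \<le> norm (R y) / 2" using c by simp
      moreover have "norm (R y) \<le> norm (R x) + norm (R y - R x)"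
        using norm_triangle_ineq[of "R x" "R y - R x"] by simp
      ultimately have "norm (R y) \<le> 2 * c" using c by linarith
      then have "c * (norm (T y - T x) * norm (R y)) \<le> c * (norm (T y - T x) * (2 * c))"
        using c by (intro mult_left_mono) auto
      with 1 show ?case by (simp add: mult_ac)
    qed
    then have "((\<lambda>y. R y - R x) \<longlongrightarrow> 0) (at x)"
      using tendsto_mult_right_zero[OF T0, of "c * (2 * c)"] by (rule Lim_null_comparison)
    then show ?thesis by (rule LIM_zero_cancel)
  qed
  show "Ck_on k S T \<Longrightarrow> Ck_on k S R"
  proof (induction k)
    case 0
    then show ?case
      using lim \<open>open S\<close> by (auto simp: continuous_on_eq_continuous_at isCont_def)
  next
    case (Suc k)
    have R: "Ck_on k S R" using Suc Ck_on_Suc_imp by blast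
    have "(R has_derivative (\<lambda>h. - (R x o\<^sub>L (Blinfun (frechet_derivative T (at x)) h o\<^sub>L R x)))) (at x)"
      if x: "x \<in> S" for x
    proof -
      note T = Ck_on_has_derivative[OF Suc.prems x]
      have limR: "(R \<longlongrightarrow> R x) (at x)"
        using lim[OF x] has_derivative_continuous[OF T] by (simp add: isCont_def)
      \<comment> \<open>Only continuity of \<open>R\<close> at \<open>x\<close> is available so far;
        it suffices because the other factor \<open>T y - T x\<close> vanishes there.\<close>
      have "((\<lambda>y. T y - T x) has_derivative frechet_derivative T (at x)) (at x)"
        using T by (auto intro!: derivative_eq_intros)
      from has_derivative_bilinear_zero[OF bounded_bilinear.flip[OF bounded_bilinear_blinfun_compose] limR this]
      have "((\<lambda>y. (T y - T x) o\<^sub>L R y) has_derivative (\<lambda>h. frechet_derivative T (at x) h o\<^sub>L R x)) (at x)"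
        by simp
      then have "((\<lambda>y. R x o\<^sub>L ((T y - T x) o\<^sub>L R y)) has_derivative
          (\<lambda>h. R x o\<^sub>L (frechet_derivative T (at x) h o\<^sub>L R x))) (at x)"
        by (rule bounded_linear.has_derivative[OF bounded_bilinear.bounded_linear_right[OF bounded_bilinear_blinfun_compose]])
      from has_derivative_diff[OF has_derivative_const[of "R x"] this]
      have "((\<lambda>y. R x - (R x o\<^sub>L ((T y - T x) o\<^sub>L R y))) has_derivative
          (\<lambda>h. - (R x o\<^sub>L (frechet_derivative T (at x) h o\<^sub>L R x)))) (at x)"
        by simp
      then have "(R has_derivative (\<lambda>h. - (R x o\<^sub>L (frechet_derivative T (at x) h o\<^sub>L R x)))) (at x)"
      proof (rule has_derivative_transform_within_open[OF _ \<open>open S\<close> x])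
        fix y assume "y \<in> S"
        then show "R x - (R x o\<^sub>L ((T y - T x) o\<^sub>L R y)) = R y"
          using blinfun_inverse_diff[where R = R and T = T, OF inv(1)[OF x] inv(2)] by (simp add: algebra_simps)
      qed
      then show ?thesis
        using has_derivative_bounded_linear[OF T] by (simp add: bounded_linear_Blinfun_apply)
    qed
    then show ?case
    proof (rule Ck_on_SucI[OF \<open>open S\<close>])
      fix v
      have "Ck_on k S (\<lambda>x. - (R x o\<^sub>L (frechet_derivative T (at x) v o\<^sub>L R x)))"
        using Suc.prems
        by (intro Ck_on_bounded_linear[OF \<open>open S\<close> bounded_linear_minus[OF bounded_linear_ident]]
            Ck_on_bilinear[OF \<open>open S\<close> bounded_bilinear_blinfun_compose] R) auto
      then show "Ck_on k S (\<lambda>x. - (R x o\<^sub>L (Blinfun (frechet_derivative T (at x)) v o\<^sub>L R x)))"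
        by (rule Ck_on_cong[OF \<open>open S\<close>, THEN iffD1, rotated])
           (simp add: bounded_linear_Blinfun_apply has_derivative_bounded_linear[OF Ck_on_has_derivative[OF Suc.prems]])
    qed
  qed
qed

definition blinfun_of_basis :: "'a::euclidean_space \<Rightarrow> 'b::real_normed_vector \<Rightarrow> 'a \<Rightarrow>\<^sub>L 'b" where
  "blinfun_of_basis b c = Blinfun (\<lambda>v. (v \<bullet> b) *\<^sub>R c)"

lemma blinfun_of_basis_apply [simp]: "blinfun_of_basis b c v = (v \<bullet> b) *\<^sub>R c"
  unfolding blinfun_of_basis_def
  by (subst bounded_linear_Blinfun_apply) (auto intro!: bounded_linear_intros)

lemma bounded_linear_blinfun_of_basis:
  fixes b :: "'a::euclidean_space"
  shows "bounded_linear (blinfun_of_basis b :: 'b::real_normed_vector \<Rightarrow> 'a \<Rightarrow>\<^sub>L 'b)"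
proof (rule bounded_linear_intro[where K = "norm b"])
  show "norm (blinfun_of_basis b x) \<le> norm x * norm b" for x :: 'b
  proof (rule norm_blinfun_bound)
    show "norm (blinfun_of_basis b x v) \<le> norm x * norm b * norm v" for v
      using mult_left_mono[OF Cauchy_Schwarz_ineq2 norm_ge_zero, of x v b] by (simp add: mult_ac)
  qed auto
qed (auto intro!: blinfun_eqI simp: algebra_simps blinfun.add_left blinfun.scaleR_left)

definition derivative_blinfun ::
    "('a::real_normed_vector \<Rightarrow> 'b::real_normed_vector) \<Rightarrow> 'a \<Rightarrow> 'a \<Rightarrow>\<^sub>L 'b" where
  "derivative_blinfun f x = Blinfun (frechet_derivative f (at x))"

lemma derivative_blinfun_apply:
  "f differentiable (at x) \<Longrightarrow> derivative_blinfun f x v = frechet_derivative f (at x) v"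
  unfolding derivative_blinfun_def
  by (metis bounded_linear_Blinfun_apply has_derivative_bounded_linear frechet_derivative_works)

text \<open>In finite dimension the derivative is a finite sum of rank-one operators built from
  directional derivatives, so smoothness direction by direction gives smoothness in the operator
  norm.\<close>

lemma Ck_on_derivative_blinfun:
  fixes f :: "'a::euclidean_space \<Rightarrow> 'b::real_normed_vector"
  assumes "open S" "Ck_on (Suc k) S f"
  shows "Ck_on k S (derivative_blinfun f)"
proof -
  have "derivative_blinfun f x = (\<Sum>b\<in>Basis. blinfun_of_basis b (frechet_derivative f (at x) b))"
    if "x \<in> S" for x
  proof (rule blinfun_eqI)
    fix v
    note d = has_derivative_linear[OF Ck_on_has_derivative[OF assms(2) that]]
    have "frechet_derivative f (at x) v = (\<Sum>b\<in>Basis. (v \<bullet> b) *\<^sub>R frechet_derivative f (at x) b)"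
      using arg_cong[OF euclidean_representation[of v], of "frechet_derivative f (at x)"]
      by (simp only: linear_sum[OF d] linear_cmul[OF d])
    then show "derivative_blinfun f x v =
        (\<Sum>b\<in>Basis. blinfun_of_basis b (frechet_derivative f (at x) b)) v"
      using assms(2) that by (simp add: derivative_blinfun_apply blinfun.sum_left)
  qed
  moreover have "Ck_on k S (\<lambda>x. \<Sum>b\<in>Basis. blinfun_of_basis b (frechet_derivative f (at x) b))"
    using assms(2)
    by (intro Ck_on_sum Ck_on_bounded_linear[OF _ bounded_linear_blinfun_of_basis] assms(1)) auto
  ultimately show ?thesis
    by (subst Ck_on_cong[OF assms(1)])
qed

lemma smooth_onD: "smooth_on S f \<Longrightarrow> Ck_on k S f"
  by (simp add: smooth_on_def)

lemma smooth_on_has_derivative: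
  "smooth_on S f \<Longrightarrow> x \<in> S \<Longrightarrow> (f has_derivative frechet_derivative f (at x)) (at x)"
  unfolding smooth_on_def using Ck_on_has_derivative by blast

lemma smooth_on_differentiable: "smooth_on S f \<Longrightarrow> x \<in> S \<Longrightarrow> f differentiable (at x)"
  using smooth_on_has_derivative differentiable_def by blast

lemma smooth_on_has_derivative_blinfun:
  assumes "smooth_on S f" "x \<in> S"
  shows "(f has_derivative blinfun_apply (derivative_blinfun f x)) (at x)"
proof -
  have "blinfun_apply (derivative_blinfun f x) = frechet_derivative f (at x)"
    using derivative_blinfun_apply[OF smooth_on_differentiable[OF assms]] by auto
  then show ?thesis using smooth_on_has_derivative[OF assms] by simp
qed

lemma smooth_on_imp_continuous_on: "smooth_on S f \<Longrightarrow> continuous_on S f"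
  using smooth_onD[of S f 0] by simp

lemma smooth_on_cong: "open S \<Longrightarrow> (\<And>x. x \<in> S \<Longrightarrow> f x = g x) \<Longrightarrow> smooth_on S f \<longleftrightarrow> smooth_on S g"
  unfolding smooth_on_def using Ck_on_cong by blast

lemma smooth_on_subset: "smooth_on S f \<Longrightarrow> T \<subseteq> S \<Longrightarrow> smooth_on T f"
  unfolding smooth_on_def using Ck_on_subset by blast

lemma smooth_on_frechet_derivative: "smooth_on S f \<Longrightarrow> smooth_on S (\<lambda>x. frechet_derivative f (at x) v)"
  unfolding smooth_on_def by (metis Ck_on.simps(2))

lemma smooth_on_derivative_blinfun:
  fixes f :: "'a::euclidean_space \<Rightarrow> 'b::real_normed_vector"
  shows "open S \<Longrightarrow> smooth_on S f \<Longrightarrow> smooth_on S (derivative_blinfun f)"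
  unfolding smooth_on_def using Ck_on_derivative_blinfun by blast

lemma smooth_on_const: "open S \<Longrightarrow> smooth_on S (\<lambda>x. c)"
  by (simp add: smooth_on_def Ck_on_const)

lemma smooth_on_linear: "open S \<Longrightarrow> bounded_linear f \<Longrightarrow> smooth_on S f"
  by (simp add: smooth_on_def Ck_on_linear)

lemma smooth_on_add:
  "open S \<Longrightarrow> smooth_on S f \<Longrightarrow> smooth_on S g \<Longrightarrow> smooth_on S (\<lambda>x. f x + g x)"
  by (simp add: smooth_on_def Ck_on_add)

lemma smooth_on_sum:
  "open S \<Longrightarrow> (\<And>i. i \<in> I \<Longrightarrow> smooth_on S (f i)) \<Longrightarrow> smooth_on S (\<lambda>x. \<Sum>i\<in>I. f i x)"
  by (simp add: smooth_on_def Ck_on_sum)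

lemma smooth_on_bounded_linear:
  "open S \<Longrightarrow> bounded_linear T \<Longrightarrow> smooth_on S f \<Longrightarrow> smooth_on S (\<lambda>x. T (f x))"
  by (simp add: smooth_on_def Ck_on_bounded_linear)

lemma smooth_on_diff:
  assumes "open S" "smooth_on S f" "smooth_on S g"
  shows "smooth_on S (\<lambda>x. f x - g x)"
  using smooth_on_add[OF assms(1,2) smooth_on_bounded_linear[OF assms(1) bounded_linear_minus[OF bounded_linear_ident] assms(3)]]
  by simp

lemma smooth_on_bilinear:
  "open S \<Longrightarrow> bounded_bilinear B \<Longrightarrow> smooth_on S f \<Longrightarrow> smooth_on S g \<Longrightarrow> smooth_on S (\<lambda>x. B (f x) (g x))"
  by (simp add: smooth_on_def Ck_on_bilinear)

lemma smooth_on_compose: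
  fixes f :: "'a::real_normed_vector \<Rightarrow> 'b::euclidean_space"
  shows "open S \<Longrightarrow> smooth_on S f \<Longrightarrow> smooth_on T g \<Longrightarrow> f ` S \<subseteq> T \<Longrightarrow> smooth_on S (\<lambda>x. g (f x))"
  unfolding smooth_on_def using Ck_on_compose by blast

text \<open>The classical theorem supplies a differentiable local inverse \<open>g\<close>. Its
  derivative is the operator inverse of the derivative of \<open>f\<close> at \<open>g y\<close>, an
  expression as smooth as \<open>g\<close> itself, so the order of smoothness climbs by one at each
  step.\<close>

theorem smooth_inverse_function_theorem:
  fixes f :: "'a::euclidean_space \<Rightarrow> 'a"
  assumes "open U" "x0 \<in> U" "smooth_on U f" "inj (frechet_derivative f (at x0))"
  obtains U' V g where "open U'" "U' \<subseteq> U" "x0 \<in> U'" "open V" "homeomorphism U' V f g" "smooth_on V g"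
proof -
  note df = smooth_on_has_derivative[OF assms(3)]
  have app: "blinfun_apply (derivative_blinfun f x) = frechet_derivative f (at x)" if "x \<in> U" for x
    using derivative_blinfun_apply[OF smooth_on_differentiable[OF assms(3) that]] by auto
  have lin: "linear (frechet_derivative f (at x0))"
    using df[OF assms(2)] by (rule has_derivative_linear)
  obtain h where h: "linear h" "h \<circ> frechet_derivative f (at x0) = id"
    using linear_injective_left_inverse[OF lin assms(4)] by blast
  have inv: "Blinfun h o\<^sub>L derivative_blinfun f x0 = id_blinfun"
    using h(2) by (intro blinfun_eqI)
      (simp add: app assms(2) bounded_linear_Blinfun_apply linear_conv_bounded_linear[THEN iffD1, OF h(1)] fun_eq_iff)
  have cont: "continuous_on U (derivative_blinfun f)"
    using smooth_on_imp_continuous_on[OF smooth_on_derivative_blinfun[OF assms(1,3)]] .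
  have d: "(f has_derivative blinfun_apply (derivative_blinfun f x)) (at x)" if "x \<in> U" for x
    using df[OF that] app[OF that] by simp
  obtain U' V g g' where *: "open U'" "U' \<subseteq> U" "x0 \<in> U'" "open V" "f x0 \<in> V" "homeomorphism U' V f g"
    and dg: "\<And>y. y \<in> V \<Longrightarrow> (g has_derivative (g' y)) (at y)"
    and g': "\<And>y. y \<in> V \<Longrightarrow> g' y = inv (blinfun_apply (derivative_blinfun f (g y)))"
    and bij: "\<And>y. y \<in> V \<Longrightarrow> bij (blinfun_apply (derivative_blinfun f (g y)))"
    by (rule inverse_function_theorem[OF assms(1) d cont assms(2) inv], assumption, rule that)
  have gV: "g ` V \<subseteq> U"
    using homeomorphism_image2[OF *(6)] *(2) by simp
  have R: "blinfun_apply (Blinfun (g' y)) = g' y" if "y \<in> V" for y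
    by (rule bounded_linear_Blinfun_apply[OF has_derivative_bounded_linear[OF dg[OF that]]])
  have "Ck_on k V g" for k
  proof (induction k)
    case 0
    then show ?case using homeomorphism_cont2[OF *(6)] by simp
  next
    case (Suc k)
    have "Ck_on k V (\<lambda>y. derivative_blinfun f (g y))"
      by (rule Ck_on_compose[OF *(4) Suc smooth_onD[OF smooth_on_derivative_blinfun[OF assms(1,3)]] gV])
    then have C: "Ck_on k V (\<lambda>y. Blinfun (g' y))"
    proof (rule Ck_on_blinfun_inverse[OF *(4), rotated 2])
      fix y assume y: "y \<in> V"
      show "Blinfun (g' y) o\<^sub>L derivative_blinfun f (g y) = id_blinfun"
        using bij[OF y] by (intro blinfun_eqI) (simp add: R[OF y, unfolded g'[OF y]] g'[OF y] bij_def)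
      show "derivative_blinfun f (g y) o\<^sub>L Blinfun (g' y) = id_blinfun"
        using bij[OF y] by (intro blinfun_eqI) (simp add: R[OF y, unfolded g'[OF y]] g'[OF y] bij_def surj_f_inv_f)
    qed
    have "(g has_derivative blinfun_apply (Blinfun (g' y))) (at y)" if "y \<in> V" for y
      using dg[OF that] R[OF that] by simp
    from Ck_on_SucI[OF *(4) this Ck_on_bounded_linear[OF *(4) blinfun.bounded_linear_left C]]
    show ?case .
  qed
  then show ?thesis using that[OF *(1-4,6)] by (simp add: smooth_on_def)
qed

section \<open>Local flows and their smooth dependence on initial values\<close>

lemma bcontfun_apply_Bcontfun:
  fixes f :: "'a::topological_space \<Rightarrow> 'b::real_normed_vector"
  assumes "continuous_on UNIV f" "\<And>t. norm (f t) \<le> c"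
  shows "apply_bcontfun (Bcontfun f) = f"
  using assms by (intro Bcontfun_inverse bcontfun_normI)

definition bcontfun_lift2 :: "('a \<Rightarrow> 'b \<Rightarrow> 'c) \<Rightarrow> ('t::topological_space \<Rightarrow>\<^sub>C 'a::real_normed_vector) \<Rightarrow>
    ('t \<Rightarrow>\<^sub>C 'b::real_normed_vector) \<Rightarrow> 't \<Rightarrow>\<^sub>C 'c::real_normed_vector" where
  "bcontfun_lift2 B f g = Bcontfun (\<lambda>t. B (f t) (g t))"

lemma bcontfun_lift2_apply:
  assumes "bounded_bilinear B"
  shows "bcontfun_lift2 B f g t = B (f t) (g t)"
proof -
  obtain K where K: "\<And>a b. norm (B a b) \<le> norm a * norm b * K" "K \<ge> 0"
    using bounded_bilinear.nonneg_bounded[OF assms] by blast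
  have "norm (B (f t) (g t)) \<le> norm f * norm g * K" for t
    using K(1)[of "f t" "g t"] K(2) norm_bounded[of f t] norm_bounded[of g t]
    by (meson mult_mono mult_right_mono norm_ge_zero order_trans mult_nonneg_nonneg)
  then show ?thesis
    unfolding bcontfun_lift2_def
    by (subst bcontfun_apply_Bcontfun) (auto intro!: bounded_bilinear.continuous_on[OF assms])
qed

lemma bounded_bilinear_bcontfun_lift2:
  assumes "bounded_bilinear B"
  shows "bounded_bilinear (bcontfun_lift2 B)"
proof
  interpret B: bounded_bilinear B by fact
  note [simp] = bcontfun_lift2_apply[OF assms]
  show "bcontfun_lift2 B (a + a') b = bcontfun_lift2 B a b + bcontfun_lift2 B a' b" for a a' b
    by (rule bcontfun_eqI) (simp add: B.add_left)
  show "bcontfun_lift2 B a (b + b') = bcontfun_lift2 B a b + bcontfun_lift2 B a b'" for a b b'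
    by (rule bcontfun_eqI) (simp add: B.add_right)
  show "bcontfun_lift2 B (r *\<^sub>R a) b = r *\<^sub>R bcontfun_lift2 B a b" for r a b
    by (rule bcontfun_eqI) (simp add: B.scaleR_left)
  show "bcontfun_lift2 B a (r *\<^sub>R b) = r *\<^sub>R bcontfun_lift2 B a b" for r a b
    by (rule bcontfun_eqI) (simp add: B.scaleR_right)
  obtain K where K: "\<And>a b. norm (B a b) \<le> norm a * norm b * K" "K \<ge> 0"
    using B.nonneg_bounded by blast
  have "norm (bcontfun_lift2 B f g) \<le> norm f * norm g * K" for f g
  proof (rule norm_bound)
    show "norm (bcontfun_lift2 B f g t) \<le> norm f * norm g * K" for t
      using K(1)[of "f t" "g t"] K(2) norm_bounded[of f t] norm_bounded[of g t]
      by simp (meson mult_mono mult_right_mono norm_ge_zero order_trans mult_nonneg_nonneg)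
  qed
  then show "\<exists>K. \<forall>a b. norm (bcontfun_lift2 B a b) \<le> norm a * norm b * K" by blast
qed

text \<open>Curves live on the whole line, whereas the flow runs over the times from 0 to 1.
  Clamping the upper limit of integration keeps the integral a bounded continuous curve, of norm at
  most that of the integrand.\<close>

definition clamp01 :: "real \<Rightarrow> real" where "clamp01 t = max 0 (min 1 t)"

lemma clamp01: "clamp01 t \<in> {0..1}" "t \<in> {0..1} \<Longrightarrow> clamp01 t = t"
  by (auto simp: clamp01_def)

lemma continuous_on_clamp01 [continuous_intros]: "continuous_on S clamp01"
  unfolding clamp01_def by (intro continuous_intros)

definition bcontfun_integral :: "(real \<Rightarrow>\<^sub>C 'a::euclidean_space) \<Rightarrow> real \<Rightarrow>\<^sub>C 'a" where
  "bcontfun_integral u = Bcontfun (\<lambda>t. integral {0..clamp01 t} u)"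

lemma norm_integral_bcontfun: "norm (integral {0..clamp01 t} (apply_bcontfun u)) \<le> norm u"
  for u :: "real \<Rightarrow>\<^sub>C 'a::euclidean_space"
proof -
  have "norm (integral {0..clamp01 t} (apply_bcontfun u)) \<le> norm u * (clamp01 t - 0)"
    by (rule integral_bound) (use clamp01(1)[of t] norm_bounded in auto)
  also have "\<dots> \<le> norm u * 1"
    using clamp01(1)[of t] by (intro mult_left_mono) auto
  finally show ?thesis by simp
qed

lemma bcontfun_integral_apply:
  "bcontfun_integral u t = integral {0..clamp01 t} u"
proof -
  have "continuous_on {0..1} (\<lambda>t. integral {0..t} (apply_bcontfun u))"
    by (intro indefinite_integral_continuous_1 integrable_continuous_real) simp
  then have "continuous_on UNIV (\<lambda>t. integral {0..clamp01 t} (apply_bcontfun u))"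
    using continuous_on_compose2[OF _ continuous_on_clamp01, of "{0..1}" _ UNIV] clamp01(1) by blast
  then show ?thesis
    unfolding bcontfun_integral_def
    by (subst bcontfun_apply_Bcontfun) (auto intro!: norm_integral_bcontfun)
qed

lemma norm_bcontfun_integral: "norm (bcontfun_integral u) \<le> norm u"
  by (rule norm_bound) (simp add: bcontfun_integral_apply norm_integral_bcontfun)

lemma bounded_linear_bcontfun_integral: "bounded_linear bcontfun_integral"
proof (rule bounded_linear_intro[where K = 1])
  have int: "(apply_bcontfun u) integrable_on {0..t}" for u :: "real \<Rightarrow>\<^sub>C 'a" and t
    by (intro integrable_continuous_real) simp
  show "bcontfun_integral (u + v) = bcontfun_integral u + bcontfun_integral v" for u v :: "real \<Rightarrow>\<^sub>C 'a"
    by (rule bcontfun_eqI) (simp add: bcontfun_integral_apply integral_add int)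
  show "bcontfun_integral (r *\<^sub>R u) = r *\<^sub>R bcontfun_integral u" for r and u :: "real \<Rightarrow>\<^sub>C 'a"
    by (rule bcontfun_eqI) (simp add: bcontfun_integral_apply)
qed (simp add: norm_bcontfun_integral)

lemma bcontfun_integral_has_vector_derivative:
  fixes u :: "real \<Rightarrow>\<^sub>C 'a::euclidean_space"
  assumes "t \<in> {0..1}"
  shows "(bcontfun_integral u has_vector_derivative u t) (at t within {0..1})"
proof (rule has_vector_derivative_transform[OF assms])
  show "((\<lambda>t. integral {0..t} u) has_vector_derivative u t) (at t within {0..1})"
    by (rule integral_has_vector_derivative[OF _ assms]) simp
qed (simp add: bcontfun_integral_apply clamp01)

lemma bcontfun_integral_eq:
  fixes u :: "real \<Rightarrow>\<^sub>C 'a::euclidean_space"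
  assumes "\<And>t. t \<in> {0..1} \<Longrightarrow> (j has_vector_derivative u t) (at t within {0..1})"
  shows "bcontfun_integral u t = j (clamp01 t) - j 0"
proof -
  have "(u has_integral (j (clamp01 t) - j 0)) {0..clamp01 t}"
    using clamp01(1)[of t] by (intro fundamental_theorem_of_calculus has_vector_derivative_within_subset[OF assms]) auto
  then show ?thesis by (simp add: bcontfun_integral_apply integral_unique)
qed

section \<open>Superposition operators on curves\<close>

definition nemytskii :: "('a::real_normed_vector \<Rightarrow> 'b::real_normed_vector) \<Rightarrow> (real \<Rightarrow>\<^sub>C 'a) \<Rightarrow> real \<Rightarrow>\<^sub>C 'b" where
  "nemytskii g u = Bcontfun (\<lambda>t. g (u t))"

lemma nemytskii_apply:
  fixes g :: "'a::real_normed_vector \<Rightarrow> 'b::real_normed_vector" and u :: "real \<Rightarrow>\<^sub>C 'a"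
  assumes "compact C" "continuous_on C g" "\<And>t. u t \<in> C"
  shows "nemytskii g u t = g (u t)"
proof -
  have "bounded (g ` C)" using assms by (intro compact_imp_bounded compact_continuous_image)
  then obtain c where "\<And>x. x \<in> C \<Longrightarrow> norm (g x) \<le> c" unfolding bounded_iff by auto
  then show ?thesis
    unfolding nemytskii_def
    using assms by (subst bcontfun_apply_Bcontfun[where c = c])
      (auto intro: continuous_on_compose2[of C g UNIV "apply_bcontfun u"])
qed

text \<open>Uniform continuity of \<open>g\<close> on the compact set \<open>C\<close> upgrades
  pointwise closeness to closeness in the supremum norm.\<close>

lemma continuous_on_nemytskii:
  fixes g :: "'a::real_normed_vector \<Rightarrow> 'b::real_normed_vector" and y :: "'z::metric_space \<Rightarrow> real \<Rightarrow>\<^sub>C 'a"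
  assumes "compact C" "continuous_on C g" "continuous_on S y" "\<And>z t. z \<in> S \<Longrightarrow> y z t \<in> C"
  shows "continuous_on S (\<lambda>z. nemytskii g (y z))"
  unfolding continuous_on_iff
proof (intro ballI allI impI)
  fix z and e :: real assume z: "z \<in> S" and "e > 0"
  then obtain d where d: "d > 0" "\<And>a b. a \<in> C \<Longrightarrow> b \<in> C \<Longrightarrow> dist b a < d \<Longrightarrow> dist (g b) (g a) < e / 2"
    using compact_uniformly_continuous[OF assms(2,1)] unfolding uniformly_continuous_on_def
    by (metis half_gt_zero)
  obtain d' where d': "d' > 0" "\<And>z'. z' \<in> S \<Longrightarrow> dist z' z < d' \<Longrightarrow> dist (y z') (y z) < d"
    using assms(3) z d(1) unfolding continuous_on_iff by metis
  have "dist (nemytskii g (y z')) (nemytskii g (y z)) < e" if "z' \<in> S" "dist z' z < d'" for z'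
  proof -
    have "dist (nemytskii g (y z')) (nemytskii g (y z)) \<le> e / 2"
    proof (rule dist_bound)
      fix t
      have "dist (y z' t) (y z t) < d"
        using d'(2)[OF that] dist_bounded le_less_trans by blast
      then show "dist (nemytskii g (y z') t) (nemytskii g (y z) t) \<le> e / 2"
        using d(2) assms z that by (simp add: nemytskii_apply[of C] less_imp_le)
    qed
    then show ?thesis using \<open>e > 0\<close> by simp
  qed
  then show "\<exists>d>0. \<forall>z'\<in>S. dist z' z < d \<longrightarrow> dist (nemytskii g (y z')) (nemytskii g (y z)) < e"
    using d'(1) by blast
qed

abbreviation bcontfun_blinfun_apply where "bcontfun_blinfun_apply \<equiv> bcontfun_lift2 blinfun_apply"

lemmas bounded_bilinear_bcontfun_blinfun_apply = bounded_bilinear_bcontfun_lift2[OF bounded_bilinear_blinfun_apply]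

text \<open>A Taylor estimate in the supremum norm needs one \<open>d\<close> for all base points.
  It comes from uniform continuity of the derivative on \<open>C\<close>; convexity lets the mean
  value inequality run along segments inside \<open>C\<close>.\<close>

lemma nemytskii_linear_approx:
  fixes g :: "'a::euclidean_space \<Rightarrow> 'b::real_normed_vector"
  assumes "compact C" "convex C" "open V" "C \<subseteq> V" "smooth_on V g" "e > 0"
  obtains d where "d > 0"
    "\<And>(u :: real \<Rightarrow>\<^sub>C 'a) v. (\<And>t. apply_bcontfun u t \<in> C) \<Longrightarrow> (\<And>t. apply_bcontfun v t \<in> C) \<Longrightarrow> norm (v - u) < d \<Longrightarrow>
      norm (nemytskii g v - nemytskii g u - bcontfun_blinfun_apply (nemytskii (derivative_blinfun g) u) (v - u))
        \<le> e * norm (v - u)"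
proof -
  have cg: "continuous_on C g" and cd: "continuous_on C (derivative_blinfun g)"
    using smooth_on_imp_continuous_on smooth_on_derivative_blinfun assms continuous_on_subset by metis+
  obtain d where d: "d > 0" "\<And>a b. a \<in> C \<Longrightarrow> b \<in> C \<Longrightarrow> dist b a < d \<Longrightarrow>
      dist (derivative_blinfun g b) (derivative_blinfun g a) < e"
    using compact_uniformly_continuous[OF cd assms(1)] \<open>e > 0\<close> unfolding uniformly_continuous_on_def by metis
  have est: "norm (g b - g a - derivative_blinfun g a (b - a)) \<le> e * norm (b - a)"
    if ab: "a \<in> C" "b \<in> C" "dist b a < d" for a b
  proof -
    have seg: "closed_segment a b \<subseteq> C" using assms(2) ab by (simp add: closed_segment_subset)
    have "norm ((g b - derivative_blinfun g a b) - (g a - derivative_blinfun g a a)) \<le> e * norm (b - a)"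
    proof (rule differentiable_bound[of "closed_segment a b" _
          "\<lambda>x. blinfun_apply (derivative_blinfun g x - derivative_blinfun g a)"])
      fix x assume x: "x \<in> closed_segment a b"
      then have xV: "x \<in> V" using seg assms(4) by auto
      have "(g has_derivative blinfun_apply (derivative_blinfun g x)) (at x)"
        by (rule smooth_on_has_derivative_blinfun[OF assms(5) xV])
      then have "((\<lambda>x. g x - derivative_blinfun g a x) has_derivative
          blinfun_apply (derivative_blinfun g x - derivative_blinfun g a)) (at x)"
        by (auto intro!: derivative_eq_intros simp: blinfun.diff_left)
      then show "((\<lambda>x. g x - derivative_blinfun g a x) has_derivative
          blinfun_apply (derivative_blinfun g x - derivative_blinfun g a)) (at x within closed_segment a b)"
        by (rule has_derivative_at_withinI)
      have "dist x a < d"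
        using segment_bound1[OF x] ab(3) by (simp add: dist_norm norm_minus_commute)
      then show "onorm (blinfun_apply (derivative_blinfun g x - derivative_blinfun g a)) \<le> e"
        using d(2)[OF ab(1), of x] seg x by (auto simp: dist_norm norm_blinfun.rep_eq less_imp_le)
    qed auto
    then show ?thesis by (simp add: blinfun.diff_right algebra_simps)
  qed
  show ?thesis
  proof (rule that[OF d(1)])
    fix u v :: "real \<Rightarrow>\<^sub>C 'a"
    assume uv: "\<And>t. u t \<in> C" "\<And>t. v t \<in> C" "norm (v - u) < d"
    show "norm (nemytskii g v - nemytskii g u - bcontfun_blinfun_apply (nemytskii (derivative_blinfun g) u) (v - u))
        \<le> e * norm (v - u)"
    proof (rule norm_bound)
      fix t
      have le: "norm (v t - u t) \<le> norm (v - u)" using norm_bounded[of "v - u" t] by simp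
      have "norm (g (v t) - g (u t) - derivative_blinfun g (u t) (v t - u t)) \<le> e * norm (v t - u t)"
        using le uv by (intro est) (auto simp: dist_norm)
      also have "\<dots> \<le> e * norm (v - u)" using le \<open>e > 0\<close> by simp
      finally show "norm ((nemytskii g v - nemytskii g u -
          bcontfun_blinfun_apply (nemytskii (derivative_blinfun g) u) (v - u)) t) \<le> e * norm (v - u)"
        by (simp add: bcontfun_lift2_apply[OF bounded_bilinear_blinfun_apply]
            nemytskii_apply[OF assms(1) cg] nemytskii_apply[OF assms(1) cd] uv)
    qed
  qed
qed

lemma nemytskii_compose_has_derivative:
  fixes g :: "'a::euclidean_space \<Rightarrow> 'b::real_normed_vector"
    and y :: "'z::real_normed_vector \<Rightarrow> real \<Rightarrow>\<^sub>C 'a"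
  assumes "compact C" "convex C" "open V" "C \<subseteq> V" "smooth_on V g"
    and "open S" "z \<in> S" "(y has_derivative y') (at z)" and yC: "\<And>z t. z \<in> S \<Longrightarrow> y z t \<in> C"
  shows "((\<lambda>z. nemytskii g (y z)) has_derivative
    (\<lambda>h. bcontfun_blinfun_apply (nemytskii (derivative_blinfun g) (y z)) (y' h))) (at z)"
proof -
  let ?\<beta> = "nemytskii (derivative_blinfun g) (y z)"
  \<comment> \<open>Curves with values in \<open>C\<close> need not form an open set, so the
    superposition operator is differentiated only within the range of \<open>y\<close>. Openness of
    \<open>S\<close> then restores a full derivative of the composite.\<close>
  have "(nemytskii g has_derivative bcontfun_blinfun_apply ?\<beta>) (at (y z) within (y ` S))"
    unfolding has_derivative_within_alt
  proof (intro conjI allI impI)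
    show "bounded_linear (bcontfun_blinfun_apply ?\<beta>)"
      by (rule bounded_bilinear.bounded_linear_right[OF bounded_bilinear_bcontfun_blinfun_apply])
    fix e :: real assume "e > 0"
    from nemytskii_linear_approx[OF assms(1-5) this]
    obtain d where "d > 0"
    "\<And>(u :: real \<Rightarrow>\<^sub>C 'a) v. (\<And>t. apply_bcontfun u t \<in> C) \<Longrightarrow> (\<And>t. apply_bcontfun v t \<in> C) \<Longrightarrow> norm (v - u) < d \<Longrightarrow>
      norm (nemytskii g v - nemytskii g u - bcontfun_blinfun_apply (nemytskii (derivative_blinfun g) u) (v - u))
        \<le> e * norm (v - u)" by metis
    then show "\<exists>d>0. \<forall>v\<in>y ` S. norm (v - y z) < d \<longrightarrow>
        norm (nemytskii g v - nemytskii g (y z) - bcontfun_blinfun_apply ?\<beta> (v - y z)) \<le> e * norm (v - y z)"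
      using yC assms(7) by blast
  qed
  with has_derivative_at_withinI[OF assms(8)]
  have "((\<lambda>z. nemytskii g (y z)) has_derivative (\<lambda>h. bcontfun_blinfun_apply ?\<beta> (y' h))) (at z within S)"
    by (rule has_derivative_in_compose)
  then show ?thesis using assms(6,7) at_within_open by metis
qed

lemma Ck_on_nemytskii:
  fixes g :: "'a::euclidean_space \<Rightarrow> 'b::real_normed_vector"
    and y :: "'z::real_normed_vector \<Rightarrow> real \<Rightarrow>\<^sub>C 'a"
  assumes "compact C" "convex C" "open V" "C \<subseteq> V" "open S" and yC: "\<And>z t. z \<in> S \<Longrightarrow> y z t \<in> C"
  shows "Ck_on k S y \<Longrightarrow> smooth_on V g \<Longrightarrow> Ck_on k S (\<lambda>z. nemytskii g (y z))"
proof (induction k arbitrary: g)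
  case 0
  have "continuous_on C g"
    using smooth_on_imp_continuous_on[OF 0(2)] assms(4) by (rule continuous_on_subset)
  then show ?case
    using 0 by (auto intro!: continuous_on_nemytskii[of C] assms)
next
  case (Suc k)
  let ?s = "bcontfun_lift2 scaleR" and ?i = "bcontfun_lift2 inner"
  let ?d = "\<lambda>b x. frechet_derivative g (at x) b"
  have cd: "continuous_on C (derivative_blinfun g)" "continuous_on C (?d b)" for b
    using smooth_on_imp_continuous_on[OF smooth_on_derivative_blinfun[OF assms(3) Suc.prems(2)]]
      smooth_on_imp_continuous_on[OF smooth_on_frechet_derivative[OF Suc.prems(2)]] assms(4)
    by (auto intro: continuous_on_subset)
  show ?case
  proof (rule Ck_on_SucI[OF assms(5)])
    fix z assume "z \<in> S"
    then show "((\<lambda>z. nemytskii g (y z)) has_derivative (\<lambda>h. bcontfun_blinfun_apply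
       (nemytskii (derivative_blinfun g) (y z)) (frechet_derivative y (at z) h))) (at z)"
      by (intro nemytskii_compose_has_derivative[OF assms(1-4) Suc.prems(2) assms(5)]
          Ck_on_has_derivative[OF Suc.prems(1)] yC)
  next
    fix v
    \<comment> \<open>The operator-valued derivative has a different codomain from \<open>g\<close>,
      out of reach of the induction hypothesis. Expanding the direction in a basis leads back to
      directional derivatives with values in \<open>'b\<close>.\<close>
    have "bcontfun_blinfun_apply (nemytskii (derivative_blinfun g) (y z)) r =
        (\<Sum>b\<in>Basis. ?s (?i r (const_bcontfun b)) (nemytskii (?d b) (y z)))" if z: "z \<in> S" for z and r :: "real \<Rightarrow>\<^sub>C 'a"
    proof (rule bcontfun_eqI)
      fix t
      have yV: "y z t \<in> V" using yC[OF z] assms(4) by auto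
      note d = has_derivative_linear[OF smooth_on_has_derivative[OF Suc.prems(2) yV]]
      have sum: "(\<Sum>b\<in>B. F b) t = (\<Sum>b\<in>B. F b t)" for B :: "'c set" and F :: "'c \<Rightarrow> real \<Rightarrow>\<^sub>C 'b"
        by (induction B rule: infinite_finite_induct) auto
      have "frechet_derivative g (at (y z t)) (r t) = (\<Sum>b\<in>Basis. (r t \<bullet> b) *\<^sub>R ?d b (y z t))"
        using arg_cong[OF euclidean_representation[of "r t"], of "frechet_derivative g (at (y z t))"]
        by (simp only: linear_sum[OF d] linear_cmul[OF d])
      then show "bcontfun_blinfun_apply (nemytskii (derivative_blinfun g) (y z)) r t =
        (\<Sum>b\<in>Basis. ?s (?i r (const_bcontfun b)) (nemytskii (?d b) (y z))) t"
        by (simp add: sum bcontfun_lift2_apply[OF bounded_bilinear_blinfun_apply]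
          bcontfun_lift2_apply[OF bounded_bilinear_scaleR] bcontfun_lift2_apply[OF bounded_bilinear_inner]
          nemytskii_apply[OF assms(1) cd(1) yC[OF z]] nemytskii_apply[OF assms(1) cd(2) yC[OF z]]
          derivative_blinfun_apply[OF smooth_on_differentiable[OF Suc.prems(2) yV]])
    qed
    moreover have "Ck_on k S (\<lambda>z. \<Sum>b\<in>Basis. ?s (?i (frechet_derivative y (at z) v) (const_bcontfun b)) (nemytskii (?d b) (y z)))"
      using Suc.prems Ck_on_Suc_imp[OF Suc.prems(1)]
      by (intro Ck_on_sum Ck_on_bilinear[OF assms(5) bounded_bilinear_bcontfun_lift2[OF bounded_bilinear_scaleR]]
          Ck_on_bounded_linear[OF assms(5) bounded_bilinear.bounded_linear_left[OF bounded_bilinear_bcontfun_lift2[OF bounded_bilinear_inner]]]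
          Suc.IH smooth_on_frechet_derivative assms(5)) auto
    ultimately show "Ck_on k S (\<lambda>z. bcontfun_blinfun_apply
       (nemytskii (derivative_blinfun g) (y z)) (frechet_derivative y (at z) v))"
      by (subst Ck_on_cong[OF assms(5)])
  qed
qed

section \<open>Picard's fixed point and its derivative\<close>

lemma blinfun_neumann_inverse:
  fixes A :: "'e::{complete_space, real_normed_vector} \<Rightarrow>\<^sub>L 'e"
  assumes "norm A \<le> 1 / 2"
  obtains R where "R o\<^sub>L (id_blinfun - A) = id_blinfun" "(id_blinfun - A) o\<^sub>L R = id_blinfun"
proof -
  have A: "norm (A w) \<le> norm w / 2" for w
    using norm_blinfun[of A w] assms mult_right_mono[OF assms norm_ge_zero[of w]] by simp
  \<comment> \<open>This is the equation \<open>(1 - A) w = v\<close>, solved as the fixed point of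
    a contraction; uniqueness will make the solution linear in \<open>v\<close>.\<close>
  have "\<exists>!w. v + A w = w" for v
    using A by (intro banach_fix_type[where c = "1 / 2"])
      (auto simp: dist_norm simp flip: blinfun.diff_right)
  then obtain r where r: "\<And>v. v + A (r v) = r v" and uniq: "\<And>v w. v + A w = w \<Longrightarrow> w = r v"
    by metis
  have lin: "bounded_linear r"
  proof (rule bounded_linear_intro[where K = 2])
    show "r (u + v) = r u + r v" for u v
    proof (rule uniq[symmetric])
      have "(u + v) + A (r u + r v) = (u + A (r u)) + (v + A (r v))" by (simp add: blinfun.add_right)
      then show "(u + v) + A (r u + r v) = r u + r v" by (simp only: r)
    qed
    show "r (c *\<^sub>R v) = c *\<^sub>R r v" for c v
      using r[of v] by (intro uniq[symmetric]) (metis blinfun.scaleR_right scaleR_right_distrib)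
    show "norm (r v) \<le> norm v * 2" for v
    proof -
      have "norm (r v) \<le> norm v + norm (A (r v))"
        using norm_triangle_ineq[of v "A (r v)"] r[of v] by simp
      then show ?thesis using A[of "r v"] by simp
    qed
  qed
  show ?thesis
  proof (rule that[of "Blinfun r"])
    show "Blinfun r o\<^sub>L (id_blinfun - A) = id_blinfun"
      by (rule blinfun_eqI)
        (simp add: bounded_linear_Blinfun_apply[OF lin] blinfun.diff_left uniq[symmetric])
    show "(id_blinfun - A) o\<^sub>L Blinfun r = id_blinfun"
      using r by (intro blinfun_eqI)
        (simp add: bounded_linear_Blinfun_apply[OF lin] blinfun.diff_left algebra_simps)
  qed
qed

text \<open>The Lipschitz bound converts an error small relative to \<open>y s - y z\<close> into
  one small relative to \<open>s - z\<close>. In the application \<open>T\<close> is the linearised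
  fixed point equation and \<open>c\<close> embeds vectors as constant curves.\<close>

lemma has_derivative_implicit:
  fixes y c :: "'z::real_normed_vector \<Rightarrow> 'e::real_normed_vector"
  assumes R: "R o\<^sub>L T = id_blinfun" and c: "bounded_linear c"
    and lip: "\<And>s. s \<in> S \<Longrightarrow> norm (y s - y z) \<le> C * norm (s - z)" and "C > 0" and S: "open S" "z \<in> S"
    and approx: "\<And>e. e > 0 \<Longrightarrow> \<exists>d>0. \<forall>s\<in>S. norm (y s - y z) < d \<longrightarrow>
      norm (T (y s - y z) - c (s - z)) \<le> e * norm (y s - y z)"
  shows "(y has_derivative (\<lambda>h. R (c h))) (at z)"
  unfolding has_derivative_at_alt
proof (intro conjI allI impI)
  show "bounded_linear (\<lambda>h. R (c h))"
    by (intro bounded_linear_compose[OF _ c] blinfun.bounded_linear_right)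
  fix e :: real assume "e > 0"
  \<comment> \<open>The scale divides out the norm of \<open>R\<close> and the Lipschitz constant;
    the added 1 keeps the denominator positive when \<open>R\<close> vanishes.\<close>
  define e' where "e' = e / ((norm R + 1) * C)"
  have e': "e' > 0" using \<open>e > 0\<close> \<open>C > 0\<close> by (auto simp: e'_def intro!: divide_pos_pos mult_pos_pos add_nonneg_pos)
  obtain d where d: "d > 0" "\<And>s. s \<in> S \<Longrightarrow> norm (y s - y z) < d \<Longrightarrow>
      norm (T (y s - y z) - c (s - z)) \<le> e' * norm (y s - y z)"
    using approx[OF e'] by blast
  obtain d' where d': "d' > 0" "ball z d' \<subseteq> S" using S open_contains_ball by blast
  have "norm (y s - y z - R (c (s - z))) \<le> e * norm (s - z)" if s: "norm (s - z) < min d' (d / C)" for s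
  proof -
    have sS: "s \<in> S" using s d'(2) by (auto simp: subset_iff dist_norm norm_minus_commute)
    have "norm (y s - y z) < d"
      using lip[OF sS] s \<open>C > 0\<close> by (auto simp: field_simps)
    from d(2)[OF sS this] have 1: "norm (T (y s - y z) - c (s - z)) \<le> e' * (C * norm (s - z))"
      using lip[OF sS] e' by (meson less_imp_le mult_left_mono order_trans)
    have "R (T (y s - y z)) = y s - y z"
      using R by (metis blinfun_apply_blinfun_compose blinfun_apply_id_blinfun)
    then have "norm (y s - y z - R (c (s - z))) = norm (R (T (y s - y z) - c (s - z)))"
      by (simp add: blinfun.diff_right)
    also have "\<dots> \<le> norm R * (e' * (C * norm (s - z)))"
      by (rule order_trans[OF norm_blinfun mult_left_mono[OF 1]]) simp
    also have "\<dots> \<le> (norm R + 1) * (e' * (C * norm (s - z)))"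
      using e' \<open>C > 0\<close> by (intro mult_right_mono) auto
    also have "\<dots> = e * norm (s - z)"
      using \<open>C > 0\<close> norm_ge_zero[of R] by (simp add: e'_def field_simps add_nonneg_eq_0_iff)
    finally show ?thesis .
  qed
  then show "\<exists>d>0. \<forall>s. norm (s - z) < d \<longrightarrow> norm (y s - y z - R (c (s - z))) \<le> e * norm (s - z)"
    using d(1) d'(1) \<open>C > 0\<close> by (intro exI[of _ "min d' (d / C)"]) auto
qed

lemma bounded_linear_const_bcontfun: "bounded_linear const_bcontfun"
  by (rule bounded_linear_intro[where K = 1]) (auto intro!: bcontfun_eqI norm_bound)

text \<open>The flow up to time 1 is the fixed point of the Picard operator on bounded continuous curves.
  The bounds make it a contraction, so that its linearisation \<open>T s\<close> is invertible as well; the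
  solution \<open>y\<close> then is as smooth a function of the initial value as its derivative, which is
  \<open>T s\<close> inverted on constant curves.\<close>

theorem flow_contracting:
  fixes X :: "'a::euclidean_space \<Rightarrow> 'a"
  assumes V: "open V" "cball s0 \<rho> \<subseteq> V" and X: "smooth_on V X" and "\<rho> > 0"
    and bX: "\<And>x. x \<in> cball s0 \<rho> \<Longrightarrow> norm (X x) \<le> \<rho> / 2"
    and bD: "\<And>x. x \<in> cball s0 \<rho> \<Longrightarrow> norm (derivative_blinfun X x) \<le> 1 / 2"
  obtains y :: "'a \<Rightarrow> real \<Rightarrow> 'a" where
    "\<And>s. s \<in> ball s0 (\<rho> / 2) \<Longrightarrow> y s 0 = s"
    "\<And>s t. s \<in> ball s0 (\<rho> / 2) \<Longrightarrow> t \<in> {0..1} \<Longrightarrow> y s t \<in> V"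
    "\<And>s t. s \<in> ball s0 (\<rho> / 2) \<Longrightarrow> t \<in> {0..1} \<Longrightarrow>
      (y s has_vector_derivative X (y s t)) (at t within {0..1})"
    "smooth_on (ball s0 (\<rho> / 2)) (\<lambda>s. y s 1)"
    "\<And>s k j. s \<in> ball s0 (\<rho> / 2) \<Longrightarrow> j 0 = k \<Longrightarrow>
      (\<And>t. t \<in> {0..1} \<Longrightarrow> (j has_vector_derivative derivative_blinfun X (y s t) (j t)) (at t within {0..1})) \<Longrightarrow>
      frechet_derivative (\<lambda>s. y s 1) (at s) k = j 1"
proof -
  define C where "C = cball s0 \<rho>"
  define S where "S = ball s0 (\<rho> / 2)"
  have C: "compact C" "convex C" "C \<subseteq> V" using V(2) by (auto simp: C_def)
  have S: "open S" by (simp add: S_def)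
  have cX: "continuous_on C X" and cD: "continuous_on C (derivative_blinfun X)"
    using smooth_on_imp_continuous_on X smooth_on_derivative_blinfun V(1) continuous_on_subset C(3) by metis+
  note N = nemytskii_apply[OF C(1) cX] and ND = nemytskii_apply[OF C(1) cD]
  have lip: "norm (X b - X a) \<le> 1 / 2 * norm (b - a)" if "a \<in> C" "b \<in> C" for a b
  proof (rule differentiable_bound[OF C(2), of X "\<lambda>x. blinfun_apply (derivative_blinfun X x)"])
    show "(X has_derivative blinfun_apply (derivative_blinfun X x)) (at x within C)" if "x \<in> C" for x
      using smooth_on_has_derivative_blinfun[OF X] that C(3) by (auto intro: has_derivative_at_withinI)
    show "onorm (blinfun_apply (derivative_blinfun X x)) \<le> 1 / 2" if "x \<in> C" for x
      using bD that by (simp add: C_def norm_blinfun.rep_eq)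
  qed (use that in auto)
  define E where "E = PiC UNIV (\<lambda>_::real. C)"
  have E: "u \<in> E \<longleftrightarrow> (\<forall>t. apply_bcontfun u t \<in> C)" for u
    by (auto simp: E_def mem_PiC_iff)
  have "complete E"
    using closed_PiC[of UNIV "\<lambda>_::real. C"] C(1) by (simp add: E_def compact_imp_closed complete_eq_closed)
  define H where "H s u = const_bcontfun s + bcontfun_integral (nemytskii X u)" for s u
  \<comment> \<open>Half of the radius is left to the initial value and half to the displacement in
    unit time, at speed at most \<open>\<rho> / 2\<close>.\<close>
  have HE: "H s u \<in> E" if "s \<in> S" "u \<in> E" for s u
    unfolding E
  proof
    fix t
    have "norm (nemytskii X u) \<le> \<rho> / 2"
      using that(2) bX by (intro norm_bound) (simp add: E N C_def)
    then have "norm (bcontfun_integral (nemytskii X u) t) \<le> \<rho> / 2"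
      using norm_bounded[of "bcontfun_integral (nemytskii X u)" t] norm_bcontfun_integral[of "nemytskii X u"] by simp
    moreover have "norm (s0 - s) \<le> \<rho> / 2" using that(1) by (simp add: S_def dist_norm)
    ultimately have "norm ((s0 - s) - bcontfun_integral (nemytskii X u) t) \<le> \<rho>"
      by norm
    then show "H s u t \<in> C" by (simp add: H_def C_def dist_norm algebra_simps)
  qed
  have NX: "norm (nemytskii X u - nemytskii X v) \<le> 1 / 2 * norm (u - v)" if "u \<in> E" "v \<in> E" for u v
  proof (rule norm_bound)
    fix t
    have "norm (X (u t) - X (v t)) \<le> 1 / 2 * norm (u t - v t)" using that by (intro lip) (auto simp: E)
    also have "\<dots> \<le> 1 / 2 * norm (u - v)" using norm_bounded[of "u - v" t] by simp
    finally show "norm ((nemytskii X u - nemytskii X v) t) \<le> 1 / 2 * norm (u - v)"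
      using that by (simp add: N E)
  qed
  have KX: "norm (bcontfun_integral (nemytskii X u) - bcontfun_integral (nemytskii X v)) \<le> 1 / 2 * norm (u - v)"
    if "u \<in> E" "v \<in> E" for u v
    using order_trans[OF norm_bcontfun_integral NX[OF that]]
    by (simp add: linear_diff[OF bounded_linear.linear[OF bounded_linear_bcontfun_integral]])
  have "const_bcontfun s0 \<in> E" using \<open>\<rho> > 0\<close> by (simp add: E C_def)
  then have "\<exists>!u. u \<in> E \<and> H s u = u" if "s \<in> S" for s
    using HE[OF that] KX
    by (intro Banach_fix[OF \<open>complete E\<close> _ _ _ _ , of "1 / 2"]) (auto simp: H_def dist_norm)
  then obtain y where yE: "\<And>s. s \<in> S \<Longrightarrow> y s \<in> E" and yH: "\<And>s. s \<in> S \<Longrightarrow> H s (y s) = y s"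
    by metis
  have yC: "\<And>s t. s \<in> S \<Longrightarrow> apply_bcontfun (y s) t \<in> C" using yE E by blast
  \<comment> \<open>Half of the distance returns through the contraction and is absorbed; hence the
    Lipschitz constant 2.\<close>
  have ylip: "norm (y s - y z) \<le> 2 * norm (s - z)" if "s \<in> S" "z \<in> S" for s z
  proof -
    have "norm (y s - y z) = norm (H s (y s) - H z (y z))" using yH that by simp
    also have "\<dots> = norm (const_bcontfun (s - z) + (bcontfun_integral (nemytskii X (y s)) - bcontfun_integral (nemytskii X (y z))))"
      by (simp add: H_def linear_diff[OF bounded_linear.linear[OF bounded_linear_const_bcontfun]] algebra_simps)
    also have "\<dots> \<le> norm (const_bcontfun (s - z) :: real \<Rightarrow>\<^sub>C 'a) + 1 / 2 * norm (y s - y z)"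
      using KX[OF yE yE] that by (intro norm_triangle_mono) auto
    also have "norm (const_bcontfun (s - z) :: real \<Rightarrow>\<^sub>C 'a) \<le> norm (s - z)"
      by (rule norm_bound) simp
    finally show ?thesis by simp
  qed
  \<comment> \<open>\<open>\<beta> s\<close> is the derivative of \<open>X\<close> along the
    solution, so \<open>P (\<beta> s)\<close> is the linearisation of the integral part of the
    Picard operator.\<close>
  define \<beta> where "\<beta> s = nemytskii (derivative_blinfun X) (y s)" for s
  define P where "P b = Blinfun (\<lambda>r. bcontfun_integral (bcontfun_blinfun_apply b r))" for b :: "real \<Rightarrow>\<^sub>C ('a \<Rightarrow>\<^sub>L 'a)"
  have P: "P b r = bcontfun_integral (bcontfun_blinfun_apply b r)" for b r
    unfolding P_def
    by (subst bounded_linear_Blinfun_apply)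
       (auto intro!: bounded_linear_compose[OF bounded_linear_bcontfun_integral]
         bounded_bilinear.bounded_linear_right[OF bounded_bilinear_bcontfun_blinfun_apply])
  have nP: "norm (P b) \<le> norm b" for b
  proof (rule norm_blinfun_bound)
    fix r
    have "norm (bcontfun_blinfun_apply b r) \<le> norm b * norm r"
    proof (rule norm_bound)
      show "norm (bcontfun_blinfun_apply b r t) \<le> norm b * norm r" for t
        using mult_mono[OF norm_bounded[of b t] norm_bounded[of r t]]
        by (simp add: bcontfun_lift2_apply[OF bounded_bilinear_blinfun_apply] order_trans[OF norm_blinfun])
    qed
    then show "norm (P b r) \<le> norm b * norm r"
      unfolding P by (rule order_trans[OF norm_bcontfun_integral])
  qed simp
  have linP: "bounded_linear P"
  proof (rule bounded_linear_intro[where K = 1])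
    note b = bounded_bilinear_bcontfun_blinfun_apply and K = bounded_linear.linear[OF bounded_linear_bcontfun_integral]
    show "P (a + b) = P a + P b" for a b
      by (rule blinfun_eqI) (simp add: P blinfun.add_left bounded_bilinear.add_left[OF b] linear_add[OF K])
    show "P (r *\<^sub>R a) = r *\<^sub>R P a" for r a
      by (rule blinfun_eqI) (simp add: P blinfun.scaleR_left bounded_bilinear.scaleR_left[OF b] linear_cmul[OF K])
  qed (simp add: nP)
  define T where "T s = id_blinfun - P (\<beta> s)" for s
  have "norm (P (\<beta> s)) \<le> 1 / 2" if "s \<in> S" for s
  proof (rule order_trans[OF nP norm_bound])
    show "norm (\<beta> s t) \<le> 1 / 2" for t
      using yC[OF that] bD by (simp add: \<beta>_def ND C_def)
  qed
  then have "\<exists>R. R o\<^sub>L T s = id_blinfun \<and> T s o\<^sub>L R = id_blinfun" if "s \<in> S" for s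
    using that blinfun_neumann_inverse unfolding T_def by metis
  then obtain R where R: "\<And>s. s \<in> S \<Longrightarrow> R s o\<^sub>L T s = id_blinfun" "\<And>s. s \<in> S \<Longrightarrow> T s o\<^sub>L R s = id_blinfun"
    by metis
  have dy: "(y has_derivative (\<lambda>h. R z (const_bcontfun h))) (at z)" if z: "z \<in> S" for z
  proof (rule has_derivative_implicit[OF R(1)[OF z] bounded_linear_const_bcontfun _ _ S z])
    show "norm (y s - y z) \<le> 2 * norm (s - z)" if "s \<in> S" for s by (rule ylip[OF that z])
    fix e :: real assume "e > 0"
    from nemytskii_linear_approx[OF C(1,2) V(1) C(3) X this]
    obtain d where d: "d > 0" "\<And>(u :: real \<Rightarrow>\<^sub>C 'a) v. (\<And>t. apply_bcontfun u t \<in> C) \<Longrightarrow> (\<And>t. apply_bcontfun v t \<in> C) \<Longrightarrow> norm (v - u) < d \<Longrightarrow>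
        norm (nemytskii X v - nemytskii X u - bcontfun_blinfun_apply (nemytskii (derivative_blinfun X) u) (v - u))
        \<le> e * norm (v - u)" by metis
    have "norm (T z (y s - y z) - const_bcontfun (s - z)) \<le> e * norm (y s - y z)"
      if s: "s \<in> S" "norm (y s - y z) < d" for s
    proof -
      note K = bounded_linear.linear[OF bounded_linear_bcontfun_integral]
      \<comment> \<open>The two fixed point equations differ by the integral of the change of
        \<open>X\<close> along the curves; \<open>T z\<close> removes the linear part of that
        change.\<close>
      have "y s - y z - const_bcontfun (s - z) = bcontfun_integral (nemytskii X (y s)) - bcontfun_integral (nemytskii X (y z))"
      proof -
        have "y s - y z - const_bcontfun (s - z) = H s (y s) - H z (y z) - const_bcontfun (s - z)"
          by (simp only: yH[OF s(1)] yH[OF z])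
        then show ?thesis
          by (simp add: H_def linear_diff[OF bounded_linear.linear[OF bounded_linear_const_bcontfun]] algebra_simps)
      qed
      then have "T z (y s - y z) - const_bcontfun (s - z) = bcontfun_integral
          (nemytskii X (y s) - nemytskii X (y z) - bcontfun_blinfun_apply (\<beta> z) (y s - y z))"
        by (simp add: T_def blinfun.diff_left P linear_diff[OF K])
      then show ?thesis
        using order_trans[OF norm_bcontfun_integral d(2)[OF yC[OF z] yC[OF s(1)] s(2)]] by (simp add: \<beta>_def)
    qed
    then show "\<exists>d>0. \<forall>s\<in>S. norm (y s - y z) < d \<longrightarrow> norm (T z (y s - y z) - const_bcontfun (s - z)) \<le> e * norm (y s - y z)"
      using d(1) by blast
  qed simp
  have "Ck_on k S y" for k
  proof (induction k)
    case 0
    show ?case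
      using has_derivative_continuous[OF dy] by (auto intro!: continuous_at_imp_continuous_on)
  next
    case (Suc k)
    have "Ck_on k S T"
      using Ck_on_add[OF S Ck_on_const[OF S, of k id_blinfun]
          Ck_on_bounded_linear[OF S bounded_linear_minus[OF linP]
            Ck_on_nemytskii[OF C(1,2) V(1) C(3) S yC Suc smooth_on_derivative_blinfun[OF V(1) X]]]]
      by (simp add: T_def[abs_def] \<beta>_def)
    then have "Ck_on k S R" by (intro Ck_on_blinfun_inverse[where R = R and T = T, OF S R])
    from Ck_on_SucI[OF S dy Ck_on_bounded_linear[OF S blinfun.bounded_linear_left this]] show ?case .
  qed
  then have smooth: "smooth_on S y" by (simp add: smooth_on_def)
  have ev: "bounded_linear (\<lambda>u :: real \<Rightarrow>\<^sub>C 'a. u 1)"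
    by (rule bounded_linear_intro[where K = 1]) (auto simp: norm_bounded)
  have y0: "y s 0 = s" if "s \<in> S" for s
    using arg_cong[OF yH[OF that], of "\<lambda>u. u 0"] by (simp add: H_def bcontfun_integral_apply clamp01_def)
  show ?thesis
  proof (rule that[of "\<lambda>s. apply_bcontfun (y s)", folded S_def])
    show "y s 0 = s" if "s \<in> S" for s by (rule y0[OF that])
    show "y s t \<in> V" if "s \<in> S" for s t using yC[OF that] C(3) by blast
    show "(y s has_vector_derivative X (y s t)) (at t within {0..1})" if s: "s \<in> S" and t: "t \<in> {0..1}" for s t
    proof -
      have "((\<lambda>t. s + bcontfun_integral (nemytskii X (y s)) t) has_vector_derivative X (y s t)) (at t within {0..1})"
        using bcontfun_integral_has_vector_derivative[OF t, of "nemytskii X (y s)"] yC[OF s]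
        by (auto intro!: derivative_eq_intros simp: N)
      moreover have "(\<lambda>t. s + bcontfun_integral (nemytskii X (y s)) t) = apply_bcontfun (y s)"
        by (subst yH[OF s, symmetric]) (simp add: H_def fun_eq_iff)
      ultimately show ?thesis by simp
    qed
    show "smooth_on S (\<lambda>s. y s 1)" by (rule smooth_on_bounded_linear[OF S ev smooth])
    fix s k j assume s: "s \<in> S" and j: "j 0 = k"
      "\<And>t. t \<in> {0..1} \<Longrightarrow> (j has_vector_derivative derivative_blinfun X (y s t) (j t)) (at t within {0..1})"
    have cj: "continuous_on {0..1} j"
      by (rule continuous_on_vector_derivative[OF j(2)])
    have "continuous_on UNIV (\<lambda>t. j (clamp01 t))"
      using clamp01(1) by (intro continuous_on_compose2[OF cj continuous_on_clamp01]) auto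
    moreover have "bounded (j ` {0..1})" using cj by (intro compact_imp_bounded compact_continuous_image) auto
    then obtain c where "\<forall>x\<in>j ` {0..1}. norm x \<le> c" unfolding bounded_iff by blast
    then have "\<And>t. t \<in> {0..1} \<Longrightarrow> norm (j t) \<le> c" by blast
    ultimately have J: "apply_bcontfun (Bcontfun (\<lambda>t. j (clamp01 t))) = (\<lambda>t. j (clamp01 t))"
      using clamp01(1) by (intro bcontfun_apply_Bcontfun) auto
    define J where "J = Bcontfun (\<lambda>t. j (clamp01 t))"
    have J: "J t = j (clamp01 t)" for t using J by (simp add: J_def)
    \<comment> \<open>Integrated, the variational equation becomes this linear equation;
      \<open>R s\<close> solves it by the derivative of \<open>y\<close> at \<open>s\<close> in the
      direction \<open>k\<close>.\<close>
    have "T s J = const_bcontfun k"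
    proof (rule bcontfun_eqI)
      fix t
      have "bcontfun_integral (bcontfun_blinfun_apply (\<beta> s) J) t = j (clamp01 t) - j 0"
      proof (rule bcontfun_integral_eq)
        fix t :: real assume t: "t \<in> {0..1}"
        then show "(j has_vector_derivative bcontfun_blinfun_apply (\<beta> s) J t) (at t within {0..1})"
          using j(2)[OF t] yC[OF s]
          by (simp add: bcontfun_lift2_apply[OF bounded_bilinear_blinfun_apply] \<beta>_def ND J clamp01)
      qed
      then show "T s J t = const_bcontfun k t" by (simp add: T_def blinfun.diff_left P J j(1))
    qed
    then have "R s (const_bcontfun k) = J"
      using R(1)[OF s] by (metis blinfun_apply_blinfun_compose blinfun_apply_id_blinfun)
    moreover have "frechet_derivative (\<lambda>s. y s 1) (at s) = (\<lambda>h. R s (const_bcontfun h) 1)"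
      using frechet_derivative_at[OF bounded_linear.has_derivative[OF ev dy[OF s]]] by simp
    ultimately show "frechet_derivative (\<lambda>s. y s 1) (at s) k = j 1"
      by (simp add: J clamp01)
  qed
qed

text \<open>Time keeps unit length and the field is scaled by \<open>\<epsilon>\<close> until it
  meets the bounds of the contraction. By the last clause any solution of the variational equation
  computes a derivative of the time-one map, so such derivatives can be found by guessing.\<close>

corollary local_flow:
  fixes X :: "'a::euclidean_space \<Rightarrow> 'a"
  assumes V: "open V" "s0 \<in> V" and X: "smooth_on V X"
  obtains \<epsilon> r and y :: "'a \<Rightarrow> real \<Rightarrow> 'a" where "\<epsilon> > 0" "r > 0"
    "\<And>s. s \<in> ball s0 r \<Longrightarrow> y s 0 = s"
    "\<And>s t. s \<in> ball s0 r \<Longrightarrow> t \<in> {0..1} \<Longrightarrow> y s t \<in> V"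
    "\<And>s t. s \<in> ball s0 r \<Longrightarrow> t \<in> {0..1} \<Longrightarrow>
      (y s has_vector_derivative \<epsilon> *\<^sub>R X (y s t)) (at t within {0..1})"
    "smooth_on (ball s0 r) (\<lambda>s. y s 1)"
    "\<And>s k j. s \<in> ball s0 r \<Longrightarrow> j 0 = k \<Longrightarrow>
      (\<And>t. t \<in> {0..1} \<Longrightarrow>
        (j has_vector_derivative \<epsilon> *\<^sub>R derivative_blinfun X (y s t) (j t)) (at t within {0..1})) \<Longrightarrow>
      frechet_derivative (\<lambda>s. y s 1) (at s) k = j 1"
proof -
  obtain \<rho> where \<rho>: "\<rho> > 0" "cball s0 \<rho> \<subseteq> V" using V open_contains_cball by blast
  have "bounded (X ` cball s0 \<rho>)" "bounded (derivative_blinfun X ` cball s0 \<rho>)"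
    using smooth_on_imp_continuous_on[OF X] smooth_on_imp_continuous_on[OF smooth_on_derivative_blinfun[OF V(1) X]] \<rho>(2)
    by (auto intro!: compact_imp_bounded compact_continuous_image intro: continuous_on_subset)
  then obtain M M' where M: "\<And>x. x \<in> cball s0 \<rho> \<Longrightarrow> norm (X x) \<le> M" "M > 0"
    and M': "\<And>x. x \<in> cball s0 \<rho> \<Longrightarrow> norm (derivative_blinfun X x) \<le> M'" "M' > 0"
    unfolding bounded_pos by (metis image_eqI)
  define \<epsilon> where "\<epsilon> = min (\<rho> / (2 * M)) (1 / (2 * M'))"
  have \<epsilon>: "\<epsilon> > 0" "\<epsilon> * M \<le> \<rho> / 2" "\<epsilon> * M' \<le> 1 / 2"
    using \<rho>(1) M(2) M'(2) by (auto simp: \<epsilon>_def min_def field_simps)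
  have D: "derivative_blinfun (\<lambda>x. \<epsilon> *\<^sub>R X x) x = \<epsilon> *\<^sub>R derivative_blinfun X x" if "x \<in> V" for x
  proof -
    have d: "((\<lambda>x. \<epsilon> *\<^sub>R X x) has_derivative (\<lambda>h. \<epsilon> *\<^sub>R derivative_blinfun X x h)) (at x)"
      by (intro derivative_intros smooth_on_has_derivative_blinfun[OF X that])
    then have "(\<lambda>x. \<epsilon> *\<^sub>R X x) differentiable (at x)" by (auto simp: differentiable_def)
    then show ?thesis
      using frechet_derivative_at[OF d]
      by (intro blinfun_eqI) (simp add: derivative_blinfun_apply blinfun.scaleR_left fun_eq_iff)
  qed
  have X': "smooth_on V (\<lambda>x. \<epsilon> *\<^sub>R X x)"
    by (rule smooth_on_bounded_linear[OF V(1) bounded_linear_scaleR_right X])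
  have 1: "norm (\<epsilon> *\<^sub>R X x) \<le> \<rho> / 2" if "x \<in> cball s0 \<rho>" for x
    using order_trans[OF mult_left_mono[OF M(1)[OF that] less_imp_le[OF \<epsilon>(1)]] \<epsilon>(2)] \<epsilon>(1) by simp
  have 2: "norm (derivative_blinfun (\<lambda>x. \<epsilon> *\<^sub>R X x) x) \<le> 1 / 2" if "x \<in> cball s0 \<rho>" for x
  proof -
    have "x \<in> V" using \<rho>(2) that by auto
    then show ?thesis
      using order_trans[OF mult_left_mono[OF M'(1)[OF that] less_imp_le[OF \<epsilon>(1)]] \<epsilon>(3)] \<epsilon>(1)
      by (simp add: D)
  qed
  from flow_contracting[OF V(1) \<rho>(2) X' \<rho>(1) 1 2]
  obtain y :: "'a \<Rightarrow> real \<Rightarrow> 'a" where y: "\<And>s. s \<in> ball s0 (\<rho> / 2) \<Longrightarrow> y s 0 = s"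
    "\<And>s t. s \<in> ball s0 (\<rho> / 2) \<Longrightarrow> t \<in> {0..1} \<Longrightarrow> y s t \<in> V"
    "\<And>s t. s \<in> ball s0 (\<rho> / 2) \<Longrightarrow> t \<in> {0..1} \<Longrightarrow>
      (y s has_vector_derivative \<epsilon> *\<^sub>R X (y s t)) (at t within {0..1})"
    "smooth_on (ball s0 (\<rho> / 2)) (\<lambda>s. y s 1)"
    "\<And>s k j. s \<in> ball s0 (\<rho> / 2) \<Longrightarrow> j 0 = k \<Longrightarrow>
      (\<And>t. t \<in> {0..1} \<Longrightarrow> (j has_vector_derivative derivative_blinfun (\<lambda>x. \<epsilon> *\<^sub>R X x) (y s t) (j t)) (at t within {0..1})) \<Longrightarrow>
      frechet_derivative (\<lambda>s. y s 1) (at s) k = j 1"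
    by blast
  show ?thesis
  proof (rule that[OF \<epsilon>(1) _ y(1-4)])
    show "frechet_derivative (\<lambda>s. y s 1) (at s) k = j 1"
      if "s \<in> ball s0 (\<rho> / 2)" "j 0 = k"
        "\<And>t. t \<in> {0..1} \<Longrightarrow> (j has_vector_derivative \<epsilon> *\<^sub>R derivative_blinfun X (y s t) (j t)) (at t within {0..1})"
      for s k j
      using that D[OF y(2)[OF that(1)]] by (intro y(5)) (simp_all add: blinfun.scaleR_left)
  qed (use \<rho>(1) in auto)
qed

section \<open>Matrix-valued maps\<close>

lemma bounded_bilinear_matrix_vector_mult:
  "bounded_bilinear ((*v) :: real ^ 'm ^ 'n \<Rightarrow> real ^ 'm \<Rightarrow> real ^ 'n)"
  by (auto simp: bilinear_conv_bounded_bilinear[symmetric] bilinear_def matrix_vector_mult_def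
      vec_eq_iff sum.distrib sum_distrib_left algebra_simps intro!: linearI)

lemma bounded_bilinear_matrix_mult:
  "bounded_bilinear ((**) :: real ^ 'm ^ 'n \<Rightarrow> real ^ 'k ^ 'm \<Rightarrow> real ^ 'k ^ 'n)"
  by (auto simp: bilinear_conv_bounded_bilinear[symmetric] bilinear_def matrix_matrix_mult_def
      vec_eq_iff sum.distrib sum_distrib_left algebra_simps intro!: linearI)

lemmas matrix_add_rdistrib = bounded_bilinear.add_left[OF bounded_bilinear_matrix_mult]
  and matrix_mult_diff_left = bounded_bilinear.diff_left[OF bounded_bilinear_matrix_mult]
  and matrix_mult_diff_right = bounded_bilinear.diff_right[OF bounded_bilinear_matrix_mult]
  and matrix_mult_minus_right = bounded_bilinear.minus_right[OF bounded_bilinear_matrix_mult]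

lemma matrix_inv_left: "invertible A \<Longrightarrow> matrix_inv A ** A = mat 1"
  and matrix_inv_right: "invertible A \<Longrightarrow> A ** matrix_inv A = mat 1"
  for A :: "real ^ 'n ^ 'n"
  unfolding invertible_def matrix_inv_def by (metis (mono_tags, lifting) someI_ex)+

definition blinfun_of_mat :: "real ^ 'm ^ 'n \<Rightarrow> (real ^ 'm) \<Rightarrow>\<^sub>L (real ^ 'n)" where
  "blinfun_of_mat A = Blinfun ((*v) A)"

lemma blinfun_of_mat_apply [simp]: "blinfun_of_mat A v = A *v v"
  unfolding blinfun_of_mat_def
  by (simp add: bounded_linear_Blinfun_apply bounded_bilinear.bounded_linear_right[OF bounded_bilinear_matrix_vector_mult])

lemma matrix_blinfun_of_mat [simp]: "matrix (blinfun_apply (blinfun_of_mat A)) = A"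
proof -
  have "blinfun_apply (blinfun_of_mat A) = (*v) A" by (simp add: fun_eq_iff)
  then show ?thesis by simp
qed

lemma bounded_linear_blinfun_of_mat:
  "bounded_linear (blinfun_of_mat :: real ^ 'm ^ 'n \<Rightarrow> (real ^ 'm) \<Rightarrow>\<^sub>L (real ^ 'n))"
  unfolding linear_conv_bounded_linear[symmetric]
  by (rule linearI; rule blinfun_eqI) (simp_all add: matrix_vector_mult_add_rdistrib blinfun.add_left blinfun.scaleR_left scaleR_matrix_vector_assoc)

lemma bounded_linear_matrix_of_blinfun:
  "bounded_linear (\<lambda>F. matrix (blinfun_apply F) :: real ^ 'm ^ 'n)"
proof (rule bounded_linear_intro[where K = "real CARD('n) * real CARD('m)"])
  fix F :: "(real ^ 'm) \<Rightarrow>\<^sub>L (real ^ 'n)"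
  have "\<bar>matrix (blinfun_apply F) $ i $ j\<bar> \<le> norm F" for i j
  proof -
    have "\<bar>F (axis j 1) $ i\<bar> \<le> norm (F (axis j 1))" by (rule component_le_norm_cart)
    also have "\<dots> \<le> norm F * norm (axis j 1 :: real ^ 'm)" by (rule norm_blinfun)
    finally show ?thesis by (simp add: matrix_def)
  qed
  note entry = this
  have "norm (matrix (blinfun_apply F)) \<le> (\<Sum>i\<in>UNIV. norm (matrix (blinfun_apply F) $ i))"
    unfolding norm_vec_def[of "matrix (blinfun_apply F)"] by (rule L2_set_le_sum) simp
  also have "\<dots> \<le> (\<Sum>i\<in>(UNIV :: 'n set). real CARD('m) * norm F)"
  proof (rule sum_mono)
    fix i
    have "norm (matrix (blinfun_apply F) $ i) \<le> (\<Sum>j\<in>UNIV. \<bar>matrix (blinfun_apply F) $ i $ j\<bar>)"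
      by (rule norm_le_l1_cart)
    also have "\<dots> \<le> (\<Sum>j\<in>(UNIV :: 'm set). norm F)" by (rule sum_mono[OF entry])
    finally show "norm (matrix (blinfun_apply F) $ i) \<le> real CARD('m) * norm F" by simp
  qed
  finally show "norm (matrix (blinfun_apply F)) \<le> norm F * (real CARD('n) * real CARD('m))"
    by (simp add: mult_ac)
qed (simp_all add: matrix_def vec_eq_iff blinfun.add_left blinfun.scaleR_left)

lemma smooth_on_matrix_inv:
  fixes M :: "'a::real_normed_vector \<Rightarrow> real ^ 'n ^ 'n"
  assumes "open S" "smooth_on S M" "\<And>x. x \<in> S \<Longrightarrow> invertible (M x)"
  shows "smooth_on S (\<lambda>x. matrix_inv (M x))"
  unfolding smooth_on_def
proof
  fix k
  have "Ck_on k S (\<lambda>x. blinfun_of_mat (M x))"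
    by (rule Ck_on_bounded_linear[OF assms(1) bounded_linear_blinfun_of_mat smooth_onD[OF assms(2)]])
  moreover have "blinfun_of_mat (matrix_inv (M x)) o\<^sub>L blinfun_of_mat (M x) = id_blinfun"
    "blinfun_of_mat (M x) o\<^sub>L blinfun_of_mat (matrix_inv (M x)) = id_blinfun" if "x \<in> S" for x
    using assms(3)[OF that]
    by (auto intro!: blinfun_eqI simp: matrix_vector_mul_assoc matrix_inv_left matrix_inv_right)
  ultimately have "Ck_on k S (\<lambda>x. blinfun_of_mat (matrix_inv (M x)))"
    using Ck_on_blinfun_inverse[OF assms(1), of "\<lambda>x. blinfun_of_mat (matrix_inv (M x))" "\<lambda>x. blinfun_of_mat (M x)"]
    by simp
  from Ck_on_bounded_linear[OF assms(1) bounded_linear_matrix_of_blinfun this]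
  show "Ck_on k S (\<lambda>x. matrix_inv (M x))" by simp
qed

lemma open_invertible:
  fixes M :: "'a::topological_space \<Rightarrow> real ^ 'n ^ 'n"
  assumes "open S" "continuous_on S M"
  shows "open {x \<in> S. invertible (M x)}"
proof -
  have "continuous_on S (\<lambda>x. det (M x))"
    unfolding det_def using assms(2) by (intro continuous_intros)
  then have "open (S \<inter> (\<lambda>x. det (M x)) -` (- {0}))"
    using assms(1) by (intro continuous_open_preimage) auto
  moreover have "S \<inter> (\<lambda>x. det (M x)) -` (- {0}) = {x \<in> S. invertible (M x)}"
    by (auto simp: invertible_det_nz)
  ultimately show ?thesis by simp
qed

lemma smooth_on_matrix_mult:
  "open S \<Longrightarrow> smooth_on S A \<Longrightarrow> smooth_on S B \<Longrightarrow> smooth_on S (\<lambda>x. A x ** B x)"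
  for A :: "'a::real_normed_vector \<Rightarrow> real ^ 'm ^ 'n" and B :: "'a \<Rightarrow> real ^ 'k ^ 'm"
  by (rule smooth_on_bilinear[OF _ bounded_bilinear_matrix_mult])

lemma smooth_on_matrix_vector_mult:
  "open S \<Longrightarrow> smooth_on S A \<Longrightarrow> smooth_on S v \<Longrightarrow> smooth_on S (\<lambda>x. A x *v v x)"
  for A :: "'a::real_normed_vector \<Rightarrow> real ^ 'm ^ 'n"
  by (rule smooth_on_bilinear[OF _ bounded_bilinear_matrix_vector_mult])

section \<open>First integrals of an involutive distribution\<close>

lemma differentiable_bilinear:
  "bounded_bilinear B \<Longrightarrow> f differentiable (at x) \<Longrightarrow> g differentiable (at x) \<Longrightarrow>
    (\<lambda>y. B (f y) (g y)) differentiable (at x)"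
  unfolding differentiable_def using bounded_bilinear.FDERIV by blast

lemma derivative_blinfun_bilinear:
  assumes B: "bounded_bilinear B" and f: "f differentiable (at x)" and g: "g differentiable (at x)"
  shows "derivative_blinfun (\<lambda>y. B (f y) (g y)) x h =
    B (f x) (derivative_blinfun g x h) + B (derivative_blinfun f x h) (g x)"
proof -
  have d: "((\<lambda>y. B (f y) (g y)) has_derivative (\<lambda>h. B (f x) (frechet_derivative g (at x) h)
      + B (frechet_derivative f (at x) h) (g x))) (at x)"
    by (intro bounded_bilinear.FDERIV[OF B] frechet_derivative_works[THEN iffD1] f g)
  have "(\<lambda>y. B (f y) (g y)) differentiable (at x)" using d by (auto simp: differentiable_def)
  then show ?thesis
    using frechet_derivative_at[OF d] by (simp add: derivative_blinfun_apply f g fun_eq_iff)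
qed

lemma derivative_blinfun_eqI:
  "(f has_derivative f') (at x) \<Longrightarrow> derivative_blinfun f x h = f' h"
  using frechet_derivative_at[of f f' x]
  by (metis derivative_blinfun_apply differentiable_def)

lemma derivative_blinfun_cong:
  assumes "open S" "x \<in> S" "\<And>y. y \<in> S \<Longrightarrow> f y = g y" "f differentiable (at x)"
  shows "derivative_blinfun f x = derivative_blinfun g x"
  unfolding derivative_blinfun_def
  using frechet_derivative_transform_within_open[OF assms(4,1,2,3)] by simp

text \<open>Let \<open>Q = 1 - P\<close> and \<open>Q0 = Q x0\<close>. The vector fields \<open>A w\<close> with \<open>A = M\<^sup>-\<^sup>1 ** Q0\<close> span the kernel of \<open>P\<close>
  and project to constant fields under \<open>Q0\<close>, so involutivity makes them commute.\<close>

lemma commuting_frame: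
  fixes P :: "real ^ 'n \<Rightarrow> real ^ 'n ^ 'n"
  assumes V: "open V" "x0 \<in> V" and P: "smooth_on V P" and PP: "\<And>x. x \<in> V \<Longrightarrow> P x ** P x = P x"
    and inv: "\<And>x v w. x \<in> V \<Longrightarrow> P x *v v = 0 \<Longrightarrow> P x *v w = 0 \<Longrightarrow>
      P x *v (derivative_blinfun P x v *v w) = P x *v (derivative_blinfun P x w *v v)"
  obtains V1 A where "open V1" "x0 \<in> V1" "V1 \<subseteq> V" "smooth_on V1 A" "A x0 = mat 1 - P x0"
    "\<And>x. x \<in> V1 \<Longrightarrow> P x ** A x = 0"
    "\<And>x v. x \<in> V1 \<Longrightarrow> P x *v v = 0 \<Longrightarrow> \<exists>h. P x0 *v h = 0 \<and> A x *v h = v"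
    "\<And>x v w. x \<in> V1 \<Longrightarrow> derivative_blinfun A x (A x *v v) *v w = derivative_blinfun A x (A x *v w) *v v"
proof -
  define Q0 where "Q0 = mat 1 - P x0"
  \<comment> \<open>\<open>M x\<close> intertwines the projections,
    \<open>M x ** P x = P x0 ** M x\<close>, and is the identity at \<open>x0\<close>. Near
    \<open>x0\<close> its inverse therefore carries the kernel of \<open>P x0\<close> onto that of
    \<open>P x\<close>.\<close>
  define M where "M x = Q0 ** (mat 1 - P x) + P x0 ** P x" for x
  have sM: "smooth_on V M"
    unfolding M_def using V P
    by (intro smooth_on_add smooth_on_matrix_mult smooth_on_diff smooth_on_const) auto
  define V1 where "V1 = {x \<in> V. invertible (M x)}"
  have V1: "open V1" "V1 \<subseteq> V"
    unfolding V1_def using open_invertible[OF V(1) smooth_on_imp_continuous_on[OF sM]] by auto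
  note PP0 = PP[OF V(2)]
  have idem: "P x0 ** Q0 = 0" "Q0 ** P x0 = 0" "Q0 ** Q0 = Q0"
    by (simp_all add: Q0_def matrix_mult_diff_left matrix_mult_diff_right PP0)
  have M0: "M x0 = mat 1"
    unfolding M_def using idem(3) PP0 by (simp add: Q0_def)
  then have x0: "x0 \<in> V1" using V(2) by (auto simp: V1_def invertible_def)
  define A where "A x = matrix_inv (M x) ** Q0" for x
  have sA: "smooth_on V1 A"
    unfolding A_def using V1 smooth_on_subset[OF sM V1(2)]
    by (intro smooth_on_matrix_mult smooth_on_const smooth_on_matrix_inv) (auto simp: V1_def)
  have left: "matrix_inv (M x) ** M x = mat 1" and right: "M x ** matrix_inv (M x) = mat 1" if "x \<in> V1" for x
    using that matrix_inv_left matrix_inv_right by (auto simp: V1_def)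
  have A0: "A x0 = Q0" using left[OF x0] by (simp add: A_def M0)
  have PM: "P x0 ** M x = P x0 ** P x" for x
    unfolding M_def matrix_add_ldistrib by (simp add: matrix_mul_assoc idem PP0)
  have MP: "M x ** P x = P x0 ** P x" if "x \<in> V1" for x
    unfolding M_def matrix_add_rdistrib
    using PP[of x] that V1(2) by (auto simp: matrix_mul_assoc[symmetric] matrix_mult_diff_left)
  have PA: "P x ** A x = 0" if x: "x \<in> V1" for x
  proof -
    have "M x ** P x = P x0 ** M x" by (simp add: PM MP[OF x])
    then have "matrix_inv (M x) ** (M x ** P x) ** A x = matrix_inv (M x) ** (P x0 ** M x) ** A x" by simp
    then have "P x ** A x = matrix_inv (M x) ** P x0 ** (M x ** matrix_inv (M x)) ** Q0"
      by (simp add: matrix_mul_assoc left[OF x] A_def)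
    then show ?thesis by (simp add: right[OF x] matrix_mul_assoc[symmetric] idem)
  qed
  have MA: "M x ** A x = Q0" if "x \<in> V1" for x
    by (simp add: A_def matrix_mul_assoc right[OF that])
  have PiA: "Q0 ** A x = Q0" if x: "x \<in> V1" for x
  proof -
    have "M x ** A x = Q0 ** A x - Q0 ** (P x ** A x) + P x0 ** (P x ** A x)"
      by (simp add: M_def matrix_add_rdistrib matrix_mult_diff_left matrix_mult_diff_right matrix_mul_assoc)
    then show ?thesis by (simp add: PA[OF x] MA[OF x])
  qed
  have span: "\<exists>h. P x0 *v h = 0 \<and> A x *v h = v" if x: "x \<in> V1" and "P x *v v = 0" for x v
  proof (intro exI conjI)
    have Mv: "M x *v v = Q0 *v v"
      using that(2) by (simp add: M_def algebra_simps flip: matrix_vector_mul_assoc)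
    show "P x0 *v (Q0 *v v) = 0" by (simp add: matrix_vector_mul_assoc idem)
    have "A x *v (Q0 *v v) = matrix_inv (M x) *v (Q0 *v (Q0 *v v))"
      by (simp add: A_def flip: matrix_vector_mul_assoc)
    also have "\<dots> = matrix_inv (M x) *v (M x *v v)"
      unfolding Mv by (simp add: matrix_vector_mul_assoc idem)
    finally show "A x *v (Q0 *v v) = v" by (simp add: matrix_vector_mul_assoc left[OF x])
  qed
  have comm: "derivative_blinfun A x (A x *v v) *v w = derivative_blinfun A x (A x *v w) *v v"
    if x: "x \<in> V1" for x v w
  proof -
    let ?D = "derivative_blinfun A x" and ?E = "derivative_blinfun P x"
    have xV: "x \<in> V" using x V1(2) by auto
    have dA: "A differentiable (at x)" and dP: "P differentiable (at x)"
      using smooth_on_differentiable sA P x xV by auto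
    have dc: "(\<lambda>x. c) differentiable (at x)" for c :: "real ^ 'n ^ 'n" by simp
    have zero: "derivative_blinfun (\<lambda>x. c) x h = 0" for c :: "real ^ 'n ^ 'n" and h
      by (rule derivative_blinfun_eqI) simp
    have "derivative_blinfun (\<lambda>y. P y ** A y) x h = 0" for h
      using derivative_blinfun_cong[OF V1(1) x, of "\<lambda>y. P y ** A y" "\<lambda>_. 0"] PA zero
        differentiable_bilinear[OF bounded_bilinear_matrix_mult dP dA] by metis
    then have 1: "P x ** ?D h = - (?E h ** A x)" for h
      by (simp add: derivative_blinfun_bilinear[OF bounded_bilinear_matrix_mult dP dA] eq_neg_iff_add_eq_0)
    have "derivative_blinfun (\<lambda>y. Q0 ** A y) x h = 0" for h
      using derivative_blinfun_cong[OF V1(1) x, of "\<lambda>y. Q0 ** A y" "\<lambda>_. Q0"] PiA zero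
        differentiable_bilinear[OF bounded_bilinear_matrix_mult dc dA] by metis
    then have 2: "Q0 ** ?D h = 0" for h
      by (simp add: derivative_blinfun_bilinear[OF bounded_bilinear_matrix_mult dc dA] zero)
    have Pv: "P x *v (A x *v v) = 0" for v
      by (simp add: matrix_vector_mul_assoc PA[OF x])
    have PDD: "P x *v (?D (A x *v v) *v w) = - (P x *v (?E (A x *v v) *v (A x *v w)))" for v w
    proof -
      have "P x *v (?D (A x *v v) *v w) = (P x ** P x ** ?D (A x *v v)) *v w"
        by (simp add: PP[OF xV] matrix_vector_mul_assoc)
      also have "\<dots> = (P x ** (- (?E (A x *v v) ** A x))) *v w"
        by (simp add: 1 flip: matrix_mul_assoc)
      finally show ?thesis
        by (simp add: matrix_mult_minus_right bounded_bilinear.minus_left[OF bounded_bilinear_matrix_vector_mult]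
            matrix_vector_mul_assoc matrix_mul_assoc)
    qed
    \<comment> \<open>\<open>b\<close> is the Lie bracket of the frame fields \<open>A v\<close> and
      \<open>A w\<close>. Involutivity kills its image under \<open>P x\<close> and constancy of
      \<open>Q0 ** A\<close> its image under \<open>Q0\<close>; so the invertible \<open>M x\<close>
      kills it.\<close>
    define b where "b = ?D (A x *v v) *v w - ?D (A x *v w) *v v"
    have "P x *v b = 0"
      using inv[OF xV Pv Pv, of v w] by (simp add: b_def algebra_simps PDD)
    moreover have "Q0 *v b = 0"
      by (simp add: b_def matrix_vector_mult_diff_distrib matrix_vector_mul_assoc 2)
    ultimately have "M x *v b = 0"
      by (simp add: M_def algebra_simps flip: matrix_vector_mul_assoc)
    then have "matrix_inv (M x) *v (M x *v b) = 0" by simp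
    then show ?thesis by (simp add: matrix_vector_mul_assoc left[OF x] b_def)
  qed
  show ?thesis
    by (rule that[OF V1(1) x0 V1(2) sA A0[unfolded Q0_def] PA span comm])
qed

text \<open>The commuting frame is integrated: starting on the transversal
  \<open>x0 + P x0 *v z\<close>, one follows the frame field with constant coefficients
  \<open>Q0 *v z\<close> for unit time. Commutation makes the differential of this chart send the
  kernel of \<open>P x0\<close> into that of \<open>P\<close>, so the transversal component of the
  inverse chart is constant along the distribution.\<close>

theorem frobenius_first_integral:
  fixes P :: "real ^ 'n \<Rightarrow> real ^ 'n ^ 'n"
  assumes V: "open V" "x0 \<in> V" and P: "smooth_on V P" and PP: "\<And>x. x \<in> V \<Longrightarrow> P x ** P x = P x"
    and inv: "\<And>x v w. x \<in> V \<Longrightarrow> P x *v v = 0 \<Longrightarrow> P x *v w = 0 \<Longrightarrow>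
      P x *v (derivative_blinfun P x v *v w) = P x *v (derivative_blinfun P x w *v v)"
  obtains V' f where "open V'" "x0 \<in> V'" "V' \<subseteq> V" "smooth_on V' f"
    "\<And>x. x \<in> V' \<Longrightarrow> P x0 *v f x = f x"
    "\<And>x v. x \<in> V' \<Longrightarrow> P x *v v = 0 \<Longrightarrow> frechet_derivative f (at x) v = 0"
    "frechet_derivative f (at x0) = (*v) (P x0)"
proof -
  obtain V1 A where V1: "open V1" "x0 \<in> V1" "V1 \<subseteq> V" and sA: "smooth_on V1 A" and A0: "A x0 = mat 1 - P x0"
    and PA: "\<And>x. x \<in> V1 \<Longrightarrow> P x ** A x = 0"
    and span: "\<And>x v. x \<in> V1 \<Longrightarrow> P x *v v = 0 \<Longrightarrow> \<exists>h. P x0 *v h = 0 \<and> A x *v h = v"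
    and comm: "\<And>x v w. x \<in> V1 \<Longrightarrow>
      derivative_blinfun A x (A x *v v) *v w = derivative_blinfun A x (A x *v w) *v v"
    by (rule commuting_frame[OF V P PP inv], assumption+, rule that)
  \<comment> \<open>The coefficients of the frame field ride along as a frozen second component;
    smooth dependence on them becomes a case of dependence on initial values.\<close>
  define X :: "(real ^ 'n) \<times> (real ^ 'n) \<Rightarrow> (real ^ 'n) \<times> (real ^ 'n)"
    where "X s = (A (fst s) *v snd s, 0)" for s
  let ?V = "V1 \<times> (UNIV :: (real ^ 'n) set)"
  have V: "open ?V" "(x0, 0) \<in> ?V" using V1 by (auto intro: open_Times)
  have bl: "bounded_linear (\<lambda>u :: real ^ 'n. (u, 0 :: real ^ 'n))"
    by (intro bounded_linear_Pair bounded_linear_ident bounded_linear_zero)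
  have sAf: "smooth_on ?V (\<lambda>s. A (fst s))"
    using V by (intro smooth_on_compose[OF _ smooth_on_linear[OF _ bounded_linear_fst] sA]) auto
  have sX: "smooth_on ?V X"
    unfolding X_def using V sAf
    by (intro smooth_on_bounded_linear[OF _ bl] smooth_on_matrix_vector_mult smooth_on_linear[OF _ bounded_linear_snd]) auto
  have DX: "derivative_blinfun X (x, w) (a, b) = (A x *v b + derivative_blinfun A x a *v w, 0)"
    if "x \<in> V1" for x w a b
  proof (rule derivative_blinfun_eqI[THEN trans])
    have "((\<lambda>s. A (fst s)) has_derivative (\<lambda>h. derivative_blinfun A x (fst h))) (at (x, w))"
      using has_derivative_compose[OF has_derivative_fst[OF has_derivative_ident], of A _ "(x, w)" UNIV]
        smooth_on_has_derivative_blinfun[OF sA that] by simp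
    from bounded_bilinear.FDERIV[OF bounded_bilinear_matrix_vector_mult this has_derivative_snd[OF has_derivative_ident]]
    show "(X has_derivative (\<lambda>h. (A x *v snd h + derivative_blinfun A x (fst h) *v w, 0))) (at (x, w))"
      unfolding X_def[abs_def] by (auto intro!: has_derivative_Pair)
  qed simp
  obtain \<epsilon> r and y :: "(real ^ 'n) \<times> (real ^ 'n) \<Rightarrow> real \<Rightarrow> (real ^ 'n) \<times> (real ^ 'n)"
    where \<epsilon>: "\<epsilon> > 0" and r: "r > 0"
    and y0: "\<And>s. s \<in> ball (x0, 0) r \<Longrightarrow> y s 0 = s"
    and yV: "\<And>s t. s \<in> ball (x0, 0) r \<Longrightarrow> t \<in> {0..1} \<Longrightarrow> y s t \<in> ?V"
    and y': "\<And>s t. s \<in> ball (x0, 0) r \<Longrightarrow> t \<in> {0..1} \<Longrightarrow>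
      (y s has_vector_derivative \<epsilon> *\<^sub>R X (y s t)) (at t within {0..1})"
    and sy: "smooth_on (ball (x0, 0) r) (\<lambda>s. y s 1)"
    and Dy: "\<And>s k j. s \<in> ball (x0, 0) r \<Longrightarrow> j 0 = k \<Longrightarrow>
      (\<And>t. t \<in> {0..1} \<Longrightarrow>
        (j has_vector_derivative \<epsilon> *\<^sub>R derivative_blinfun X (y s t) (j t)) (at t within {0..1})) \<Longrightarrow>
      frechet_derivative (\<lambda>s. y s 1) (at s) k = j 1"
  proof (rule local_flow[OF V sX], goal_cases)
    case (1 \<epsilon> r y)
    show ?case by (rule 1(1)[of \<epsilon> r y]; fact 1)
  qed
  have y2: "snd (y s t) = snd s" if s: "s \<in> ball (x0, 0) r" and t: "t \<in> {0..1}" for s t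
  proof -
    have "((\<lambda>t. snd (y s t)) has_vector_derivative 0) (at t within {0..1})" if "t \<in> {0..1}" for t
      using has_derivative_snd[OF y'[OF s that, unfolded has_vector_derivative_def]]
      by (simp add: has_vector_derivative_def X_def)
    then obtain c where "\<And>t. t \<in> {0..1} \<Longrightarrow> snd (y s t) = c"
      using has_vector_derivative_zero_constant[of "{0..1}" "\<lambda>t. snd (y s t)"] by auto
    from this[OF t] this[of 0] show ?thesis using y0[OF s] by simp
  qed
  have y1: "((\<lambda>t. fst (y s t)) has_vector_derivative \<epsilon> *\<^sub>R (A (fst (y s t)) *v snd s)) (at t within {0..1})"
    if s: "s \<in> ball (x0, 0) r" and t: "t \<in> {0..1}" for s t
    using has_derivative_fst[OF y'[OF s t, unfolded has_vector_derivative_def]] y2[OF s t]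
    by (simp add: has_vector_derivative_def X_def)
  \<comment> \<open>The guess: changing the coefficients by \<open>h\<close> displaces the point at
    time \<open>t\<close> by \<open>t\<close> times \<open>\<epsilon>\<close> times
    \<open>A h\<close>. That this solves the variational equation rests on
    \<open>comm\<close>.\<close>
  have Dh: "frechet_derivative (\<lambda>s. y s 1) (at s) (0, h) = (\<epsilon> *\<^sub>R (A (fst (y s 1)) *v h), h)"
    if s: "s \<in> ball (x0, 0) r" for s h
  proof (rule Dy[OF s, where j = "\<lambda>t. (t *\<^sub>R \<epsilon> *\<^sub>R (A (fst (y s t)) *v h), h)", THEN trans])
    fix t :: real assume t: "t \<in> {0..1}"
    let ?x = "fst (y s t)" and ?w = "snd s"
    have x: "?x \<in> V1" using yV[OF s t] by (cases "y s t") auto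
    have "y s t = (?x, ?w)" using y2[OF s t] by (metis prod.collapse)
    then have DXy: "derivative_blinfun X (y s t) (a, h) = (A ?x *v h + derivative_blinfun A ?x a *v ?w, 0)" for a
      using DX[OF x, of ?w a h] by metis
    have "((\<lambda>t. A (fst (y s t))) has_vector_derivative derivative_blinfun A ?x (\<epsilon> *\<^sub>R (A ?x *v ?w))) (at t within {0..1})"
      using has_derivative_compose[OF y1[OF s t, unfolded has_vector_derivative_def]
          smooth_on_has_derivative_blinfun[OF sA x]]
      by (simp add: has_vector_derivative_def blinfun.scaleR_right)
    from bounded_linear.has_vector_derivative[OF bounded_bilinear.bounded_linear_left[OF bounded_bilinear_matrix_vector_mult, of h] this]
    have "((\<lambda>t. A (fst (y s t)) *v h) has_vector_derivative \<epsilon> *\<^sub>R (derivative_blinfun A ?x (A ?x *v h) *v ?w)) (at t within {0..1})"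
      by (simp only: blinfun.scaleR_right scaleR_matrix_vector_assoc[symmetric] comm[OF x, of ?w h])
    from has_vector_derivative_scaleR[OF DERIV_ident has_vector_derivative_scaleR[OF DERIV_const[of \<epsilon>] this]]
    have "((\<lambda>t. t *\<^sub>R \<epsilon> *\<^sub>R (A (fst (y s t)) *v h)) has_vector_derivative
        \<epsilon> *\<^sub>R (A ?x *v h + derivative_blinfun A ?x (t *\<^sub>R \<epsilon> *\<^sub>R (A ?x *v h)) *v ?w)) (at t within {0..1})"
      by (simp add: blinfun.scaleR_right scaleR_right_distrib add.commute mult_ac flip: scaleR_matrix_vector_assoc)
    from has_derivative_Pair[OF this[unfolded has_vector_derivative_def] has_derivative_const[of h]]
    show "((\<lambda>t. (t *\<^sub>R \<epsilon> *\<^sub>R (A (fst (y s t)) *v h), h)) has_vector_derivative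
        \<epsilon> *\<^sub>R derivative_blinfun X (y s t) (t *\<^sub>R \<epsilon> *\<^sub>R (A ?x *v h), h)) (at t within {0..1})"
      by (simp add: has_vector_derivative_def DXy)
  qed simp_all
  have y00: "fst (y (x0, 0) t) = x0" if t: "t \<in> {0..1}" for t
  proof -
    have s: "(x0, 0) \<in> ball (x0, 0 :: real ^ 'n) r" using r by simp
    obtain c where "\<And>t. t \<in> {0..1} \<Longrightarrow> fst (y (x0, 0) t) = c"
      using has_vector_derivative_zero_constant[of "{0..1}" "\<lambda>t. fst (y (x0, 0) t)"] y1[OF s] by auto
    from this[OF t] this[of 0] show ?thesis using y0[OF s] by simp
  qed
  \<comment> \<open>With coefficients 0 the field vanishes at every point, so the flow is stationary
    and passes a displacement of the starting point on unchanged.\<close>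
  have Dk: "frechet_derivative (\<lambda>s. y s 1) (at (x0, 0)) (k, 0) = (k, 0)" for k
  proof (rule Dy[where j = "\<lambda>t. (k, 0)", THEN trans])
    fix t :: real assume t: "t \<in> {0..1}"
    have s: "(x0, 0) \<in> ball (x0, 0 :: real ^ 'n) r" using r by simp
    have "y (x0, 0) t = (x0, 0)" using y00[OF t] y2[OF s t] by (metis prod.collapse snd_conv)
    then show "((\<lambda>t. (k, 0 :: real ^ 'n)) has_vector_derivative
        \<epsilon> *\<^sub>R derivative_blinfun X (y (x0, 0) t) (k, 0)) (at t within {0..1})"
      using V1(2) by (simp add: DX zero_prod_def[symmetric])
  qed (use r in simp_all)
  define Q0 where "Q0 = mat 1 - P x0"
  note PP0 = PP[OF \<open>x0 \<in> V\<close>]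
  have idem: "P x0 ** Q0 = 0" "Q0 ** P x0 = 0" "Q0 ** Q0 = Q0"
    by (simp_all add: Q0_def matrix_mult_diff_left matrix_mult_diff_right PP0)
  define \<sigma> where "\<sigma> z = (x0 + P x0 *v z, Q0 *v z)" for z
  have d\<sigma>: "(\<sigma> has_derivative (\<lambda>h. (P x0 *v h, Q0 *v h))) (at z)" for z
    unfolding \<sigma>_def[abs_def] by (auto intro!: derivative_eq_intros
      bounded_linear_imp_has_derivative bounded_bilinear.bounded_linear_right[OF bounded_bilinear_matrix_vector_mult])
  define U0 where "U0 = \<sigma> -` ball (x0, 0) r"
  have c\<sigma>: "continuous_on UNIV \<sigma>"
    using has_derivative_continuous[OF d\<sigma>] by (auto intro!: continuous_at_imp_continuous_on)
  have U0: "open U0" "0 \<in> U0"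
    unfolding U0_def using c\<sigma> r by (auto intro: open_vimage simp: \<sigma>_def)
  have s\<sigma>: "smooth_on U0 \<sigma>"
  proof -
    have "bounded_linear (\<lambda>z. (P x0 *v z, Q0 *v z))"
      by (rule has_derivative_bounded_linear[OF d\<sigma>])
    from smooth_on_add[OF U0(1) smooth_on_const[OF U0(1), of "(x0, 0)"] smooth_on_linear[OF U0(1) this]]
    show ?thesis by (simp add: \<sigma>_def[abs_def])
  qed
  define \<Psi> where "\<Psi> z = fst (y (\<sigma> z) 1)" for z
  have "smooth_on U0 (\<lambda>z. y (\<sigma> z) 1)"
    by (rule smooth_on_compose[OF U0(1) s\<sigma> sy]) (auto simp: U0_def)
  then have s\<Psi>: "smooth_on U0 \<Psi>"
    unfolding \<Psi>_def[abs_def] by (rule smooth_on_bounded_linear[OF U0(1) bounded_linear_fst])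
  have D\<Psi>: "frechet_derivative \<Psi> (at z) h = fst (frechet_derivative (\<lambda>s. y s 1) (at (\<sigma> z)) (P x0 *v h, Q0 *v h))"
    if z: "z \<in> U0" for z h
  proof -
    have "((\<lambda>s. y s 1) has_derivative frechet_derivative (\<lambda>s. y s 1) (at (\<sigma> z))) (at (\<sigma> z))"
      using z by (intro smooth_on_has_derivative[OF sy]) (simp add: U0_def)
    from frechet_derivative_at[OF has_derivative_fst[OF has_derivative_compose[OF d\<sigma> this]]]
    show ?thesis by (simp add: \<Psi>_def[abs_def] fun_eq_iff)
  qed
  have D\<Psi>h: "frechet_derivative \<Psi> (at z) h = \<epsilon> *\<^sub>R (A (\<Psi> z) *v h)" if z: "z \<in> U0" and h: "P x0 *v h = 0" for z h
  proof -
    have "Q0 *v h = h" using h by (simp add: Q0_def algebra_simps)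
    then show ?thesis using z h by (simp add: D\<Psi> U0_def Dh \<Psi>_def)
  qed
  have \<Psi>0: "\<Psi> 0 = x0" by (simp add: \<Psi>_def \<sigma>_def y00)
  have lin0: "linear (frechet_derivative \<Psi> (at 0))"
    by (rule has_derivative_linear[OF smooth_on_has_derivative[OF s\<Psi> U0(2)]])
  have D\<Psi>0: "frechet_derivative \<Psi> (at 0) (P x0 *v h) = P x0 *v h"
    "frechet_derivative \<Psi> (at 0) (Q0 *v h) = \<epsilon> *\<^sub>R (Q0 *v h)" for h
  proof -
    show "frechet_derivative \<Psi> (at 0) (P x0 *v h) = P x0 *v h"
      using Dk by (simp add: D\<Psi>[OF U0(2)] matrix_vector_mul_assoc PP0 idem \<sigma>_def)
    show "frechet_derivative \<Psi> (at 0) (Q0 *v h) = \<epsilon> *\<^sub>R (Q0 *v h)"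
      by (subst D\<Psi>h[OF U0(2)]) (simp_all add: matrix_vector_mul_assoc idem \<Psi>0 A0 flip: Q0_def)
  qed
  have split: "h = P x0 *v h + Q0 *v h" for h by (simp add: Q0_def algebra_simps)
  have "h = 0" if "frechet_derivative \<Psi> (at 0) h = 0" for h
  proof -
    have "P x0 *v h + \<epsilon> *\<^sub>R (Q0 *v h) = 0"
      using that split[of h] linear_add[OF lin0, of "P x0 *v h" "Q0 *v h"] by (simp add: D\<Psi>0)
    then have "P x0 *v (P x0 *v h + \<epsilon> *\<^sub>R (Q0 *v h)) = 0" "Q0 *v (P x0 *v h + \<epsilon> *\<^sub>R (Q0 *v h)) = 0"
      by simp_all
    then have "P x0 *v h = 0" "Q0 *v h = 0"
      using \<epsilon> by (simp_all add: matrix_vector_right_distrib matrix_vector_mult_scaleR matrix_vector_mul_assoc PP0 idem)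
    then show ?thesis using split[of h] by simp
  qed
  then have inj: "inj (frechet_derivative \<Psi> (at 0))"
    using linear_injective_0[OF lin0] by blast
  obtain U' V' g where U': "open U'" "U' \<subseteq> U0" "0 \<in> U'" and V': "open V'"
    and hom: "homeomorphism U' V' \<Psi> g" and sg: "smooth_on V' g"
    by (rule smooth_inverse_function_theorem[OF U0 s\<Psi> inj], rule that)
  have V'1: "V' \<subseteq> V1"
  proof
    fix x assume "x \<in> V'"
    then obtain z where "z \<in> U'" "x = \<Psi> z" using homeomorphism_image1[OF hom] by auto
    then show "x \<in> V1" using yV[of "\<sigma> z" 1] U'(2) by (auto simp: \<Psi>_def U0_def mem_Times_iff)
  qed
  have x0V: "x0 \<in> V'" using homeomorphism_image1[OF hom] U'(3) \<Psi>0 by (metis image_eqI)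
  have Dg: "frechet_derivative g (at x) (frechet_derivative \<Psi> (at (g x)) h) = h" if x: "x \<in> V'" for x h
  proof -
    have gx: "g x \<in> U'" "\<Psi> (g x) = x" using hom x by (auto simp: homeomorphism_def)
    have 1: "(\<Psi> has_derivative frechet_derivative \<Psi> (at (g x))) (at (g x))"
      using gx(1) U'(2) by (intro smooth_on_has_derivative[OF s\<Psi>]) auto
    have 2: "(g has_derivative frechet_derivative g (at x)) (at (\<Psi> (g x)))"
      using smooth_on_has_derivative[OF sg x] gx(2) by simp
    have "((\<lambda>z. g (\<Psi> z)) has_derivative (\<lambda>h. h)) (at (g x))"
      by (rule has_derivative_transform_within_open[OF has_derivative_ident U'(1) gx(1)])
         (use hom in \<open>auto simp: homeomorphism_def\<close>)
    from has_derivative_unique[OF has_derivative_compose[OF 1 2] this] show ?thesis by (simp add: fun_eq_iff)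
  qed
  define f where "f x = P x0 *v g x" for x
  have blP: "bounded_linear ((*v) (P x0))"
    by (rule bounded_bilinear.bounded_linear_right[OF bounded_bilinear_matrix_vector_mult])
  have Df: "frechet_derivative f (at x) v = P x0 *v frechet_derivative g (at x) v" if x: "x \<in> V'" for x v
    using frechet_derivative_at[OF bounded_linear.has_derivative[OF blP smooth_on_has_derivative[OF sg x]]]
    by (simp add: f_def[abs_def] fun_eq_iff)
  have g0: "g x0 = 0" using hom U'(3) \<Psi>0 by (auto simp: homeomorphism_def)
  have lg: "linear (frechet_derivative g (at x))" if "x \<in> V'" for x
    by (rule has_derivative_linear[OF smooth_on_has_derivative[OF sg that]])
  show ?thesis
  proof (rule that[OF V' x0V])
    show "V' \<subseteq> V" using V'1 V1(3) by auto
    show "smooth_on V' f" unfolding f_def[abs_def] by (rule smooth_on_bounded_linear[OF V' blP sg])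
    show "P x0 *v f x = f x" for x by (simp add: f_def matrix_vector_mul_assoc PP0)
    show "frechet_derivative f (at x) v = 0" if x: "x \<in> V'" and v: "P x *v v = 0" for x v
    proof -
      obtain h where h: "P x0 *v h = 0" "A x *v h = v" using span[of x v] V'1 x v by auto
      have gx: "g x \<in> U0" "\<Psi> (g x) = x" using hom x U'(2) by (auto simp: homeomorphism_def)
      have "\<epsilon> *\<^sub>R frechet_derivative g (at x) v = h"
        using Dg[OF x, of h] D\<Psi>h[OF gx(1) h(1)] gx(2) h(2) linear_cmul[OF lg[OF x]] by simp
      then have "\<epsilon> *\<^sub>R (P x0 *v frechet_derivative g (at x) v) = 0" using h(1) by (metis matrix_vector_mult_scaleR)
      then show ?thesis using \<epsilon> by (simp add: Df[OF x])
    qed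
    \<comment> \<open>The chart is scaled by \<open>\<epsilon>\<close> only along the kernel of
      \<open>P x0\<close>, a component that \<open>f\<close> discards; hence no factor
      \<open>\<epsilon>\<close> survives.\<close>
    show "frechet_derivative f (at x0) = (*v) (P x0)"
    proof
      fix v
      have "frechet_derivative g (at x0) (P x0 *v v) = P x0 *v v"
        using Dg[OF x0V, of "P x0 *v v"] by (simp add: g0 D\<Psi>0)
      moreover have "\<epsilon> *\<^sub>R frechet_derivative g (at x0) (Q0 *v v) = Q0 *v v"
        using Dg[OF x0V, of "Q0 *v v"] linear_cmul[OF lg[OF x0V]] by (simp add: g0 D\<Psi>0)
      then have "\<epsilon> *\<^sub>R (P x0 *v frechet_derivative g (at x0) (Q0 *v v)) = P x0 *v (Q0 *v v)"
        by (metis matrix_vector_mult_scaleR)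
      then have "P x0 *v frechet_derivative g (at x0) (Q0 *v v) = 0"
        using \<epsilon> by (simp add: matrix_vector_mul_assoc idem)
      ultimately have "P x0 *v frechet_derivative g (at x0) (P x0 *v v + Q0 *v v) = P x0 *v v"
        by (simp add: linear_add[OF lg[OF x0V]] matrix_vector_right_distrib matrix_vector_mul_assoc PP0)
      then show "frechet_derivative f (at x0) v = P x0 *v v"
        using split[of v] by (simp add: Df[OF x0V])
    qed
  qed
qed

section \<open>Torsion as an operator on tensors\<close>

text \<open>With \<open>L_left\<close> and \<open>L_right\<close> the torsion of level \<open>m\<close> is \<open>(L_left \<circ> L_right)\<^sup>m\<close> applied to the Lie bracket.\<close>

definition L_left :: "real ^ 'n ^ 'n \<Rightarrow> (real ^ 'n \<Rightarrow> real ^ 'n \<Rightarrow> real ^ 'n) \<Rightarrow> real ^ 'n \<Rightarrow> real ^ 'n \<Rightarrow> real ^ 'n::finite"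
  where "L_left A t = (\<lambda>v w. A *v t v w - t (A *v v) w)"

definition L_right :: "real ^ 'n ^ 'n \<Rightarrow> (real ^ 'n \<Rightarrow> real ^ 'n \<Rightarrow> real ^ 'n) \<Rightarrow> real ^ 'n \<Rightarrow> real ^ 'n \<Rightarrow> real ^ 'n::finite"
  where "L_right A t = (\<lambda>v w. A *v t v w - t v (A *v w))"

lemma L_left_right_commute: "L_left A (L_right A t) = L_right A (L_left A t)"
  by (intro ext) (simp add: L_left_def L_right_def algebra_simps)

lemma L_left_right_power: "((L_left A \<circ> L_right A) ^^ k) t = (L_left A ^^ k) ((L_right A ^^ k) t)"
proof (induction k arbitrary: t)
  case (Suc k)
  have c: "(L_left A ^^ k) (L_right A s) = L_right A ((L_left A ^^ k) s)" for s
    by (induction k) (simp_all add: L_left_right_commute)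
  have "((L_left A \<circ> L_right A) ^^ Suc k) t = L_left A (L_right A (((L_left A \<circ> L_right A) ^^ k) t))"
    by (simp only: funpow.simps o_apply)
  also have "\<dots> = L_left A (L_right A ((L_left A ^^ k) ((L_right A ^^ k) t)))"
    by (simp only: Suc)
  also have "\<dots> = (L_left A ^^ Suc k) ((L_right A ^^ Suc k) t)" by (simp add: c)
  finally show ?case .
qed simp

text \<open>Vanishing torsion is tested only on fields in the images of two projections. A tensor
  that factors through them keeps doing so under the operators, which extends the vanishing to all
  vectors.\<close>

lemma L_left_invariant:
  assumes "\<And>v. A *v (Q *v v) = Q *v (A *v v)" "\<And>v w. t v w = t (Q *v v) (R *v w)"
  shows "L_left A t v w = L_left A t (Q *v v) (R *v w)"
  unfolding L_left_def by (metis assms)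

lemma L_right_invariant:
  assumes "\<And>w. A *v (R *v w) = R *v (A *v w)" "\<And>v w. t v w = t (Q *v v) (R *v w)"
  shows "L_right A t v w = L_right A t (Q *v v) (R *v w)"
  unfolding L_right_def by (metis assms)

text \<open>The spectra of \<open>A\<close> on the image and on the kernel of the projection \<open>P\<close> have nothing in
  common, in the form in which the Sylvester equation yields it.\<close>

definition separates :: "real ^ 'n ^ 'n \<Rightarrow> real ^ 'n ^ 'n \<Rightarrow> bool" where
  "separates A P \<longleftrightarrow> (\<forall>Y. P ** Y = Y \<longrightarrow> Y ** P = 0 \<longrightarrow> A ** Y = Y ** A \<longrightarrow> Y = 0)"

text \<open>For fixed second argument these are the linear maps from the kernel of the projection
  \<open>P\<close> to its image, the space on which \<open>L_left A\<close> acts as a Sylvester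
  operator.\<close>

definition off_left :: "real ^ 'n ^ 'n \<Rightarrow> (real ^ 'n \<Rightarrow> real ^ 'n \<Rightarrow> real ^ 'n) \<Rightarrow> bool" where
  "off_left P t \<longleftrightarrow> (\<forall>w. linear (\<lambda>v. t v w)) \<and> (\<forall>v w. P *v t v w = t v w) \<and> (\<forall>v w. t (P *v v) w = 0)"

lemma off_left_L_left:
  assumes "A ** P = P ** A" "off_left P t"
  shows "off_left P (L_left A t)"
  unfolding off_left_def
proof (intro conjI allI)
  have c: "A *v (P *v v) = P *v (A *v v)" for v
    using assms(1) by (simp add: matrix_vector_mul_assoc)
  have t: "linear (\<lambda>v. t v w)" "P *v t v w = t v w" "t (P *v v) w = 0" for v w
    using assms(2) by (auto simp: off_left_def)
  show "linear (\<lambda>v. L_left A t v w)" for w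
    unfolding L_left_def
    by (intro linear_compose_sub linear_compose[OF t(1) matrix_vector_mul_linear, unfolded o_def]
        linear_compose[OF matrix_vector_mul_linear t(1), unfolded o_def])
  show "P *v L_left A t v w = L_left A t v w" for v w
    by (simp add: L_left_def algebra_simps t(2) flip: c)
  show "L_left A t (P *v v) w = 0" for v w
    by (simp add: L_left_def c t(3))
qed

lemma off_left_L_right:
  assumes "A ** P = P ** A" "off_left P t"
  shows "off_left P (L_right A t)"
  unfolding off_left_def
proof (intro conjI allI)
  have c: "A *v (P *v v) = P *v (A *v v)" for v
    using assms(1) by (simp add: matrix_vector_mul_assoc)
  have t: "linear (\<lambda>v. t v w)" "P *v t v w = t v w" "t (P *v v) w = 0" for v w
    using assms(2) by (auto simp: off_left_def)
  show "linear (\<lambda>v. L_right A t v w)" for w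
    unfolding L_right_def
    by (intro linear_compose_sub linear_compose[OF t(1) matrix_vector_mul_linear, unfolded o_def] t(1))
  show "P *v L_right A t v w = L_right A t v w" for v w
    by (simp add: L_right_def algebra_simps t(2) flip: c)
  show "L_right A t (P *v v) w = 0" for v w
    by (simp add: L_right_def t(3))
qed

text \<open>With the second argument frozen, the hypothesis says that the matrix of \<open>t\<close>
  commutes with \<open>A\<close>, so \<open>separates\<close> applies to it.\<close>

lemma L_left_eq_0:
  assumes "separates A P" "off_left P t" "L_left A t = (\<lambda>_ _. 0)"
  shows "t = (\<lambda>_ _. 0)"
proof (intro ext)
  fix v w
  have t: "linear (\<lambda>v. t v w)" "\<And>v. P *v t v w = t v w" "\<And>v. t (P *v v) w = 0"
    using assms(2) by (auto simp: off_left_def)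
  define Y where "Y = matrix (\<lambda>v. t v w)"
  have Y: "Y *v v = t v w" for v
    unfolding Y_def using fun_cong[OF matrix_vector_mul(2)[OF t(1)]] by simp
  have "A *v t v w = t (A *v v) w" for v
    using fun_cong[OF fun_cong[OF assms(3)], of v w] by (simp add: L_left_def)
  then have "P ** Y = Y" "Y ** P = 0" "A ** Y = Y ** A"
    unfolding matrix_eq by (simp_all add: Y t flip: matrix_vector_mul_assoc)
  then have "Y = 0" using assms(1) by (auto simp: separates_def)
  then show "t v w = 0" using Y[of v] by simp
qed

lemma L_left_power_eq_0:
  assumes "separates A P" "A ** P = P ** A" "off_left P t" "(L_left A ^^ k) t = (\<lambda>_ _. 0)"
  shows "t = (\<lambda>_ _. 0)"
  using assms(3,4)
proof (induction k arbitrary: t)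
  case (Suc k)
  have "L_left A t = (\<lambda>_ _. 0)"
  proof (rule Suc.IH)
    show "off_left P (L_left A t)" by (rule off_left_L_left[OF assms(2) Suc.prems(1)])
    show "(L_left A ^^ k) (L_left A t) = (\<lambda>_ _. 0)"
      using Suc.prems(2) by (simp only: funpow_Suc_right o_apply)
  qed
  then show ?case by (rule L_left_eq_0[OF assms(1) Suc.prems(1)])
qed simp

text \<open>Exchanging the arguments exchanges the two operators, so injectivity shown for
  \<open>L_left\<close> also serves \<open>L_right\<close>.\<close>

lemma L_right_power_flip: "(L_left A ^^ k) (\<lambda>w v. t v w) = (\<lambda>w v. (L_right A ^^ k) t v w)"
  by (induction k arbitrary: t) (auto simp: L_left_def L_right_def)

lemma L_left_right_power_eq_0:
  assumes "separates A P" "A ** P = P ** A" "off_left P t" "off_left P (\<lambda>w v. t v w)"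
    and "((L_left A \<circ> L_right A) ^^ k) t = (\<lambda>_ _. 0)"
  shows "t = (\<lambda>_ _. 0)"
proof -
  have "off_left P ((L_right A ^^ k) t)" for k
    by (induction k) (simp_all add: assms(3) off_left_L_right[OF assms(2)])
  then have "(L_right A ^^ k) t = (\<lambda>_ _. 0)"
    using L_left_power_eq_0[OF assms(1,2)] assms(5) unfolding L_left_right_power by blast
  then have "(\<lambda>w v. t v w) = (\<lambda>_ _. 0)"
    by (intro L_left_power_eq_0[OF assms(1,2,4), of k]) (simp add: L_right_power_flip)
  then show ?thesis by (simp add: fun_eq_iff)
qed

text \<open>The Lie bracket is not a tensor, but a component of the torsion may become one from some
  level \<open>j\<close> on; from there the recursion is algebra in a single tangent space.
  Involutivity uses \<open>j = 0\<close>, the mixed case of one field outside the block and one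
  inside uses \<open>j = 1\<close>.\<close>

lemma torsion_tensor:
  assumes N: "\<And>x. x \<in> V \<Longrightarrow> A x ** N x = N x ** A x"
    and F: "\<And>\<xi>. F \<xi> \<Longrightarrow> F (app_op A \<xi>)" and G: "\<And>\<eta>. G \<eta> \<Longrightarrow> G (app_op A \<eta>)"
    and base: "\<And>\<xi> \<eta> x. F \<xi> \<Longrightarrow> G \<eta> \<Longrightarrow> x \<in> V \<Longrightarrow> N x *v torsion j A \<xi> \<eta> x = t x (\<xi> x) (\<eta> x)"
    and "F \<xi>" "G \<eta>" "x \<in> V"
  shows "N x *v torsion (k + j) A \<xi> \<eta> x = ((L_left (A x) \<circ> L_right (A x)) ^^ k) (t x) (\<xi> x) (\<eta> x)"
  using assms(5-7)
proof (induction k arbitrary: \<xi> \<eta>)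
  case 0
  then show ?case using base by simp
next
  case (Suc k)
  have c: "N x *v (A x *v v) = A x *v (N x *v v)" for v
    using N[OF Suc.prems(3)] by (simp add: matrix_vector_mul_assoc)
  define s where "s = ((L_left (A x) \<circ> L_right (A x)) ^^ k) (t x)"
  have IH: "N x *v torsion (k + j) A \<xi> \<eta> x = s (\<xi> x) (\<eta> x)" if "F \<xi>" "G \<eta>" for \<xi> \<eta>
    unfolding s_def by (rule Suc.IH[OF that Suc.prems(3)])
  note FG = Suc.prems(1,2) F[OF Suc.prems(1)] G[OF Suc.prems(2)]
  have T: "torsion (Suc k + j) A \<xi> \<eta> x = A x *v (A x *v torsion (k + j) A \<xi> \<eta> x)
      + torsion (k + j) A (app_op A \<xi>) (app_op A \<eta>) x
      - A x *v torsion (k + j) A (app_op A \<xi>) \<eta> x - A x *v torsion (k + j) A \<xi> (app_op A \<eta>) x"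
    by (simp add: app_op_def)
  have "N x *v torsion (Suc k + j) A \<xi> \<eta> x = A x *v (A x *v s (\<xi> x) (\<eta> x)) + s (A x *v \<xi> x) (A x *v \<eta> x)
      - A x *v s (A x *v \<xi> x) (\<eta> x) - A x *v s (\<xi> x) (A x *v \<eta> x)"
    unfolding T by (simp only: matrix_vector_right_distrib matrix_vector_mult_diff_distrib c
        IH[OF FG(1,2)] IH[OF FG(1,4)] IH[OF FG(3,2)] IH[OF FG(3,4)]) (simp only: app_op_def)
  also have "\<dots> = L_left (A x) (L_right (A x) s) (\<xi> x) (\<eta> x)"
    by (simp add: L_left_def L_right_def algebra_simps)
  also have "L_left (A x) (L_right (A x) s) = ((L_left (A x) \<circ> L_right (A x)) ^^ Suc k) (t x)"
    by (simp only: s_def funpow.simps o_apply)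
  finally show ?case .
qed

section \<open>Consequences of vanishing torsion\<close>

lemma lie_bracket_derivative_blinfun:
  assumes "smooth_on V \<xi>" "smooth_on V \<eta>" "x \<in> V"
  shows "lie_bracket \<xi> \<eta> x = derivative_blinfun \<eta> x (\<xi> x) - derivative_blinfun \<xi> x (\<eta> x)"
  using assms by (simp add: lie_bracket_def derivative_blinfun_apply smooth_on_differentiable)

lemma derivative_blinfun_matrix_vector_mult:
  fixes A :: "'a::real_normed_vector \<Rightarrow> real ^ 'm ^ 'n"
  assumes "smooth_on V A" "smooth_on V \<xi>" "x \<in> V"
  shows "derivative_blinfun (\<lambda>y. A y *v \<xi> y) x h = A x *v derivative_blinfun \<xi> x h + derivative_blinfun A x h *v \<xi> x"
  by (rule derivative_blinfun_bilinear[OF bounded_bilinear_matrix_vector_mult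
        smooth_on_differentiable[OF assms(1,3)] smooth_on_differentiable[OF assms(2,3)]])

text \<open>Differentiating \<open>P \<xi> = 0\<close> moves the derivative from the field to the
  projection, so the \<open>P\<close> component of a bracket depends only on the values of the
  fields. The conclusion is involutivity of the kernel, written through the derivative of
  \<open>P\<close>.\<close>

lemma torsion_free_imp_involutive:
  fixes P A :: "real ^ 'n \<Rightarrow> real ^ 'n ^ 'n"
  assumes V: "open V" and A: "smooth_on V A" and P: "smooth_on V P"
    and PP: "\<And>x. x \<in> V \<Longrightarrow> P x ** P x = P x" and AP: "\<And>x. x \<in> V \<Longrightarrow> A x ** P x = P x ** A x"
    and sep: "\<And>x. x \<in> V \<Longrightarrow> separates (A x) (P x)" and tf: "torsion_free_wrt UNIV m V A"
    and x: "x \<in> V" and v: "P x *v v = 0" and w: "P x *v w = 0"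
  shows "P x *v (derivative_blinfun P x v *v w) = P x *v (derivative_blinfun P x w *v v)"
proof -
  define Q where "Q x = mat 1 - P x" for x
  have sQ: "smooth_on V Q"
    unfolding Q_def by (intro smooth_on_diff smooth_on_const V P)
  have PQ: "P x *v (Q x *v v) = 0" and QP: "Q x *v (P x *v v) = 0" if "x \<in> V" for x v
  proof -
    have "P x *v (P x *v v) = P x *v v" using PP[OF that] by (simp add: matrix_vector_mul_assoc)
    then show "P x *v (Q x *v v) = 0" "Q x *v (P x *v v) = 0"
      by (simp_all add: Q_def matrix_vector_mult_diff_rdistrib matrix_vector_mult_diff_distrib)
  qed
  \<comment> \<open>Composing both slots with \<open>Q x\<close> extends the bracket tensor from the
    kernel of \<open>P x\<close> to all vectors and makes it \<open>off_left\<close> in either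
    argument.\<close>
  define t where "t x v w = P x *v (derivative_blinfun P x (Q x *v w) *v (Q x *v v)
    - derivative_blinfun P x (Q x *v v) *v (Q x *v w))" for x v w
  define F where "F \<xi> \<longleftrightarrow> smooth_on V \<xi> \<and> (\<forall>x\<in>V. P x *v \<xi> x = 0)" for \<xi>
  have FQ: "Q x *v \<xi> x = \<xi> x" if "F \<xi>" "x \<in> V" for \<xi> x
    using that by (simp add: F_def Q_def algebra_simps)
  have FA: "F (app_op A \<xi>)" if "F \<xi>" for \<xi>
    unfolding F_def
  proof (intro conjI ballI)
    show "smooth_on V (app_op A \<xi>)"
      using that unfolding app_op_def F_def by (intro smooth_on_matrix_vector_mult V A) auto
    show "P x *v app_op A \<xi> x = 0" if "x \<in> V" for x
    proof -
      have "P x *v app_op A \<xi> x = A x *v (P x *v \<xi> x)"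
        using AP[OF that] by (simp add: app_op_def matrix_vector_mul_assoc)
      then show ?thesis using \<open>F \<xi>\<close> that by (simp add: F_def)
    qed
  qed
  have D: "P x *v derivative_blinfun \<xi> x h = - (derivative_blinfun P x h *v \<xi> x)" if "F \<xi>" "x \<in> V" for \<xi> x h
  proof -
    have \<xi>: "smooth_on V \<xi>" "\<And>x. x \<in> V \<Longrightarrow> P x *v \<xi> x = 0" using that(1) by (auto simp: F_def)
    have "derivative_blinfun (\<lambda>y. P y *v \<xi> y) x h = derivative_blinfun (\<lambda>_. 0 :: real ^ 'n) x h"
      using smooth_on_matrix_vector_mult[OF V P \<xi>(1)] \<xi>(2)
      by (subst derivative_blinfun_cong[OF V that(2)]) (auto intro: smooth_on_differentiable that)
    also have "\<dots> = 0" by (rule derivative_blinfun_eqI) simp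
    finally show ?thesis
      by (simp add: derivative_blinfun_matrix_vector_mult[OF P \<xi>(1) that(2)] eq_neg_iff_add_eq_0)
  qed
  have base: "P x *v torsion 0 A \<xi> \<eta> x = t x (\<xi> x) (\<eta> x)" if "F \<xi>" "F \<eta>" "x \<in> V" for \<xi> \<eta> x
  proof -
    have "P x *v torsion 0 A \<xi> \<eta> x = P x *v (P x *v lie_bracket \<xi> \<eta> x)"
      using PP[OF that(3)] by (simp add: matrix_vector_mul_assoc)
    also have "P x *v lie_bracket \<xi> \<eta> x = derivative_blinfun P x (\<eta> x) *v \<xi> x - derivative_blinfun P x (\<xi> x) *v \<eta> x"
    proof -
      have "smooth_on V \<xi>" "smooth_on V \<eta>" using that by (auto simp: F_def)
      then show ?thesis
        by (simp add: lie_bracket_derivative_blinfun[OF _ _ that(3)] matrix_vector_mult_diff_distrib D that)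
    qed
    finally show ?thesis using that by (simp add: t_def FQ)
  qed
  have cQ: "A x *v (Q x *v v) = Q x *v (A x *v v)" for v
  proof -
    have "A x *v (P x *v v) = P x *v (A x *v v)" using AP[OF x] by (simp add: matrix_vector_mul_assoc)
    then show ?thesis by (simp add: Q_def matrix_vector_mult_diff_rdistrib matrix_vector_mult_diff_distrib)
  qed
  have zero: "((L_left (A x) \<circ> L_right (A x)) ^^ m) (t x) (Q x *v v) (Q x *v w) = 0" for v w
  proof -
    \<comment> \<open>Projected constant fields serve as test fields; their values at
      \<open>x\<close> exhaust the kernel of \<open>P x\<close>.\<close>
    have F: "F (\<lambda>y. Q y *v u)" for u
      unfolding F_def using PQ by (auto intro!: smooth_on_matrix_vector_mult V sQ smooth_on_const)
    then have "torsion m A (\<lambda>y. Q y *v v) (\<lambda>y. Q y *v w) x = 0"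
      using tf V x unfolding torsion_free_wrt_def F_def by blast
    moreover have "P x *v torsion (m + 0) A (\<lambda>y. Q y *v v) (\<lambda>y. Q y *v w) x =
        ((L_left (A x) \<circ> L_right (A x)) ^^ m) (t x) (Q x *v v) (Q x *v w)"
      by (rule torsion_tensor[of V A P F F 0 t, OF AP FA FA base F F x])
    ultimately show ?thesis by (metis add_0_right matrix_vector_mult_0_right)
  qed
  have QQ: "Q x *v (Q x *v v) = Q x *v v" for v
    using PQ[OF x, of v] by (simp add: Q_def[of x] algebra_simps)
  have inv: "((L_left (A x) \<circ> L_right (A x)) ^^ k) (t x) v w =
      ((L_left (A x) \<circ> L_right (A x)) ^^ k) (t x) (Q x *v v) (Q x *v w)" for k v w
  proof (induction k arbitrary: v w)
    case 0
    then show ?case by (simp add: t_def QQ)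
  next
    case (Suc k)
    have "((L_left (A x) \<circ> L_right (A x)) ^^ Suc k) (t x) =
        L_left (A x) (L_right (A x) (((L_left (A x) \<circ> L_right (A x)) ^^ k) (t x)))"
      by (simp only: funpow.simps o_apply)
    then show ?case
      using L_left_invariant[where Q = "Q x" and R = "Q x" and t = "L_right (A x) (((L_left (A x) \<circ> L_right (A x)) ^^ k) (t x))",
          OF cQ L_right_invariant[where Q = "Q x" and R = "Q x" and t = "((L_left (A x) \<circ> L_right (A x)) ^^ k) (t x)", OF cQ Suc], of v w]
      by (simp only:)
  qed
  have lin: "linear (\<lambda>v. derivative_blinfun P x (Q x *v w) *v (Q x *v v))"
      "linear (\<lambda>v. derivative_blinfun P x (Q x *v v) *v (Q x *v w))" for w
    by (auto intro!: linearI simp: algebra_simps blinfun.add_right blinfun.scaleR_right scaleR_matrix_vector_assoc[symmetric])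
  have PPv: "P x *v (P x *v u) = P x *v u" for u
    using PP[OF x] by (simp add: matrix_vector_mul_assoc)
  have tlin: "linear (\<lambda>v. t x v w)" "linear (\<lambda>v. t x w v)" for w
    using linear_compose[OF linear_compose_sub[OF lin(1)[of w] lin(2)[of w]] matrix_vector_mul_linear[of "P x"]]
      linear_compose[OF linear_compose_sub[OF lin(2)[of w] lin(1)[of w]] matrix_vector_mul_linear[of "P x"]]
    by (simp_all add: t_def o_def)
  have "t x = (\<lambda>_ _. 0)"
  proof (rule L_left_right_power_eq_0[OF sep[OF x] AP[OF x]])
    show "((L_left (A x) \<circ> L_right (A x)) ^^ m) (t x) = (\<lambda>_ _. 0)"
      by (intro ext) (subst inv, rule zero)
    show "off_left (P x) (t x)"
      using tlin by (simp add: off_left_def) (simp add: t_def PPv QP[OF x] blinfun.zero_right)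
    show "off_left (P x) (\<lambda>w v. t x v w)"
      using tlin by (simp add: off_left_def) (simp add: t_def PPv QP[OF x] blinfun.zero_right)
  qed
  then have "t x w v = 0" by simp
  moreover have "Q x *v v = v" "Q x *v w = w" using v w by (simp_all add: Q_def algebra_simps)
  ultimately show ?thesis by (simp add: t_def matrix_vector_mult_diff_distrib)
qed

text \<open>In adapted coordinates the projection \<open>E\<close> is constant, so derivatives of
  fields in its kernel stay in the kernel and drop out of the block component of a bracket. The
  derivative of \<open>\<eta>\<close> along \<open>\<xi>\<close> remains; it is not tensorial, but
  level 1 is.\<close>

lemma torsion_free_imp_ad_eq_0:
  fixes A :: "real ^ 'n \<Rightarrow> real ^ 'n ^ 'n" and E :: "real ^ 'n ^ 'n"
  assumes V: "open V" and A: "smooth_on V A" and EE: "E ** E = E"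
    and AE: "\<And>x. x \<in> V \<Longrightarrow> A x ** E = E ** A x" and sep: "\<And>x. x \<in> V \<Longrightarrow> separates (A x) E"
    and tf: "torsion_free_wrt UNIV m V A" and m: "m \<ge> 1" and x: "x \<in> V" and h: "E *v h = 0"
  shows "E ** (ad (A x) ^^ (m - 1)) (derivative_blinfun A x h) ** E = 0"
proof -
  define Q where "Q = mat 1 - E"
  have EEv: "E *v (E *v v) = E *v v" for v using EE by (simp add: matrix_vector_mul_assoc)
  have EQ: "E *v (Q *v v) = 0" and QE: "Q *v (E *v v) = 0" and QQ: "Q *v (Q *v v) = Q *v v" for v
    by (simp_all add: Q_def matrix_vector_mult_diff_rdistrib matrix_vector_mult_diff_distrib EEv)
  have cE: "A x *v (E *v v) = E *v (A x *v v)" if "x \<in> V" for x v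
    using AE[OF that] by (simp add: matrix_vector_mul_assoc)
  have cQ: "A x *v (Q *v v) = Q *v (A x *v v)" if "x \<in> V" for x v
    by (simp add: Q_def matrix_vector_mult_diff_rdistrib matrix_vector_mult_diff_distrib cE[OF that])
  have const: "derivative_blinfun (\<lambda>_. M) x h = 0" for M :: "real ^ 'n ^ 'n" and x h
    by (rule derivative_blinfun_eqI) simp
  have smE: "smooth_on V (\<lambda>_. E)" by (rule smooth_on_const[OF V])
  have DE: "derivative_blinfun A x h ** E = E ** derivative_blinfun A x h" if "x \<in> V" for x h
  proof -
    note d = smooth_on_differentiable[OF A that] smooth_on_differentiable[OF smE that]
    have "derivative_blinfun (\<lambda>y. A y ** E) x = derivative_blinfun (\<lambda>y. E ** A y) x"
      by (rule derivative_blinfun_cong[OF V that]) (auto simp: AE intro: differentiable_bilinear[OF bounded_bilinear_matrix_mult d])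
    from arg_cong[OF this, of "\<lambda>F. blinfun_apply F h"] show ?thesis
      by (simp add: derivative_blinfun_bilinear[OF bounded_bilinear_matrix_mult d]
          derivative_blinfun_bilinear[OF bounded_bilinear_matrix_mult d(2,1)] const)
  qed
  define F where "F \<xi> \<longleftrightarrow> smooth_on V \<xi> \<and> (\<forall>x\<in>V. E *v \<xi> x = 0)" for \<xi>
  define G where "G \<eta> \<longleftrightarrow> smooth_on V \<eta> \<and> (\<forall>x\<in>V. E *v \<eta> x = \<eta> x)" for \<eta>
  have sA: "smooth_on V (app_op A \<xi>)" if "smooth_on V \<xi>" for \<xi>
    unfolding app_op_def by (rule smooth_on_matrix_vector_mult[OF V A that])
  have FA: "F (app_op A \<xi>)" if "F \<xi>" for \<xi>
    using that sA unfolding F_def by (auto simp: app_op_def cE[symmetric])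
  have GA: "G (app_op A \<xi>)" if "G \<xi>" for \<xi>
    using that sA unfolding G_def by (auto simp: app_op_def cE[symmetric])
  have br: "E *v lie_bracket \<xi> \<eta> x = derivative_blinfun \<eta> x (\<xi> x)" if "F \<xi>" "G \<eta>" "x \<in> V" for \<xi> \<eta> x
  proof -
    have \<xi>: "smooth_on V \<xi>" "\<And>x. x \<in> V \<Longrightarrow> E *v \<xi> x = 0" and \<eta>: "smooth_on V \<eta>" "\<And>x. x \<in> V \<Longrightarrow> E *v \<eta> x = \<eta> x"
      using that by (auto simp: F_def G_def)
    have "derivative_blinfun (\<lambda>y. E *v \<xi> y) x h = derivative_blinfun (\<lambda>_. 0 :: real ^ 'n) x h" for h
      using smooth_on_matrix_vector_mult[OF V smE \<xi>(1)] \<xi>(2)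
      by (subst derivative_blinfun_cong[OF V that(3)]) (auto intro: smooth_on_differentiable that)
    moreover have "derivative_blinfun (\<lambda>_. 0 :: real ^ 'n) x h = 0" for h by (rule derivative_blinfun_eqI) simp
    ultimately have 1: "E *v derivative_blinfun \<xi> x h = 0" for h
      by (simp add: derivative_blinfun_matrix_vector_mult[OF smE \<xi>(1) that(3)] const)
    have "derivative_blinfun (\<lambda>y. E *v \<eta> y) x h = derivative_blinfun \<eta> x h" for h
      using smooth_on_matrix_vector_mult[OF V smE \<eta>(1)] \<eta>(2)
      by (subst derivative_blinfun_cong[OF V that(3)]) (auto intro: smooth_on_differentiable that)
    then have 2: "E *v derivative_blinfun \<eta> x h = derivative_blinfun \<eta> x h" for h
      by (simp add: derivative_blinfun_matrix_vector_mult[OF smE \<eta>(1) that(3)] const)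
    show ?thesis
      by (simp add: lie_bracket_derivative_blinfun[OF \<xi>(1) \<eta>(1) that(3)] matrix_vector_mult_diff_distrib 1 2)
  qed
  \<comment> \<open>This is what one \<open>L_right\<close> makes of the derivative of
    \<open>\<eta>\<close> along \<open>\<xi>\<close>: the terms differentiating
    \<open>\<eta>\<close> cancel, and minus the derivative of \<open>A\<close> is left.\<close>
  define Z where "Z x v w = - (E *v (derivative_blinfun A x (Q *v v) *v (E *v w)))" for x v w
  have base: "E *v torsion 1 A \<xi> \<eta> x = L_left (A x) (Z x) (\<xi> x) (\<eta> x)" if F: "F \<xi>" and G: "G \<eta>" and x: "x \<in> V" for \<xi> \<eta> x
  proof -
    have Q\<xi>: "Q *v \<xi> x = \<xi> x" using F x by (simp add: F_def Q_def algebra_simps)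
    have E\<eta>: "E *v \<eta> x = \<eta> x" and s\<eta>: "smooth_on V \<eta>" using G x by (simp_all add: G_def)
    have ED: "E *v (derivative_blinfun A x h *v \<eta> x) = derivative_blinfun A x h *v \<eta> x" for h
      using DE[OF x, of h] E\<eta> by (metis matrix_vector_mul_assoc)
    have D: "derivative_blinfun (app_op A \<eta>) x h = A x *v derivative_blinfun \<eta> x h + derivative_blinfun A x h *v \<eta> x" for h
      unfolding app_op_def by (rule derivative_blinfun_matrix_vector_mult[OF A s\<eta> x])
    have app: "app_op A \<xi> x = A x *v \<xi> x" by (simp add: app_op_def)
    have "E *v torsion 1 A \<xi> \<eta> x = A x *v (A x *v derivative_blinfun \<eta> x (\<xi> x)) + derivative_blinfun (app_op A \<eta>) x (A x *v \<xi> x)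
        - A x *v derivative_blinfun \<eta> x (A x *v \<xi> x) - A x *v derivative_blinfun (app_op A \<eta>) x (\<xi> x)"
      unfolding torsion_1
      by (simp only: matrix_vector_right_distrib matrix_vector_mult_diff_distrib cE[OF x, symmetric]
          br[OF F G x] br[OF F GA[OF G] x] br[OF FA[OF F] G x] br[OF FA[OF F] GA[OF G] x] app)
    also have "\<dots> = derivative_blinfun A x (A x *v \<xi> x) *v \<eta> x - A x *v (derivative_blinfun A x (\<xi> x) *v \<eta> x)"
      by (simp add: D matrix_vector_right_distrib)
    also have "\<dots> = L_left (A x) (Z x) (\<xi> x) (\<eta> x)"
      unfolding L_left_def Z_def
      by (simp add: cQ[OF x, symmetric] Q\<xi> E\<eta> ED bounded_bilinear.minus_right[OF bounded_bilinear_matrix_vector_mult])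
    finally show ?thesis .
  qed
  define k where "k = m - 1"
  have mk: "m = k + 1" using m by (simp add: k_def)
  \<comment> \<open>Of the \<open>m\<close> factors \<open>L_right\<close> one was spent on forming
    \<open>Z\<close>. Each of the other \<open>m - 1\<close> acts on the matrix inside as
    \<open>ad (A x)\<close>.\<close>
  define U where "U = (L_right (A x) ^^ k) (Z x)"
  have U: "U v w = - (E *v ((ad (A x) ^^ k) (derivative_blinfun A x (Q *v v)) *v (E *v w)))" for v w
    unfolding U_def
  proof (induction k arbitrary: v w)
    case (Suc k)
    define W where "W = (L_right (A x) ^^ k) (Z x)"
    define N where "N u = (ad (A x) ^^ k) (derivative_blinfun A x u)" for u
    have W: "W v w = - (E *v (N (Q *v v) *v (E *v w)))" for v w
      unfolding W_def N_def by (rule Suc)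
    have eq: "(L_right (A x) ^^ Suc k) (Z x) = L_right (A x) W"
      "(ad (A x) ^^ Suc k) (derivative_blinfun A x u) = ad (A x) (N u)" for u
      by (simp_all add: W_def N_def)
    show ?case
      unfolding eq
      by (simp add: L_right_def W ad_def[of _ "N _"] cE[OF x, symmetric] matrix_vector_mult_diff_rdistrib
          matrix_vector_mult_diff_distrib bounded_bilinear.minus_right[OF bounded_bilinear_matrix_vector_mult]
          flip: matrix_vector_mul_assoc)
  qed (simp add: Z_def)
  \<comment> \<open>All \<open>m\<close> factors \<open>L_left\<close> are collected in front of
    \<open>U\<close>, where injectivity can strip them off.\<close>
  have pow: "((L_left (A x) \<circ> L_right (A x)) ^^ k) (L_left (A x) (Z x)) = (L_left (A x) ^^ m) U"
  proof -
    have "(L_right (A x) ^^ k) (L_left (A x) s) = L_left (A x) ((L_right (A x) ^^ k) s)" for k s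
      by (induction k) (simp_all add: L_left_right_commute)
    then show ?thesis unfolding L_left_right_power mk U_def by (simp only: funpow_Suc_right o_apply add_Suc_right add_0_right One_nat_def)
  qed
  have zero: "(L_left (A x) ^^ m) U (Q *v v) (E *v w) = 0" for v w
  proof -
    have FG: "F (\<lambda>y. Q *v v)" "G (\<lambda>y. E *v w)"
      by (auto simp: F_def G_def EQ EEv intro: smooth_on_const V)
    then have "torsion m A (\<lambda>y. Q *v v) (\<lambda>y. E *v w) x = 0"
      using tf V x unfolding torsion_free_wrt_def F_def G_def by blast
    moreover have "E *v torsion (k + 1) A (\<lambda>y. Q *v v) (\<lambda>y. E *v w) x =
        ((L_left (A x) \<circ> L_right (A x)) ^^ k) (L_left (A x) (Z x)) (Q *v v) (E *v w)"
      by (rule torsion_tensor[of V A "\<lambda>_. E" F G 1 "\<lambda>x. L_left (A x) (Z x)", OF AE FA GA base FG x])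
    ultimately show ?thesis unfolding pow mk[symmetric] by simp
  qed
  have inv: "(L_left (A x) ^^ j) U v w = (L_left (A x) ^^ j) U (Q *v v) (E *v w)" for j v w
  proof (induction j arbitrary: v w)
    case 0
    then show ?case by (simp add: U QQ EEv)
  next
    case (Suc j)
    from L_left_invariant[where Q = Q and R = E and t = "(L_left (A x) ^^ j) U", OF cQ[OF x] Suc] show ?case by simp
  qed
  have "off_left E (Z x)"
    unfolding off_left_def Z_def
    by (auto simp: EEv QE blinfun.zero_right bounded_bilinear.minus_right[OF bounded_bilinear_matrix_vector_mult]
        algebra_simps blinfun.add_right blinfun.scaleR_right scaleR_matrix_vector_assoc[symmetric] intro!: linearI)
  then have "off_left E U"
    unfolding U_def by (induction k) (simp_all add: off_left_L_right[OF AE[OF x]])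
  then have "U = (\<lambda>_ _. 0)"
    by (rule L_left_power_eq_0[OF sep[OF x] AE[OF x], of _ m]) (intro ext, subst inv, rule zero)
  moreover have "Q *v h = h" using h by (simp add: Q_def algebra_simps)
  ultimately have "E *v ((ad (A x) ^^ k) (derivative_blinfun A x h) *v (E *v w)) = 0" for w
    using U[of h w] by simp
  then show ?thesis
    unfolding matrix_eq k_def[symmetric] by (simp add: matrix_vector_mul_assoc[symmetric])
qed

section \<open>Primary decomposition of a real matrix\<close>

lemma matrix_mult_add_left: "(A + B) ** C = A ** C + B ** C"
  for A B :: "'a::semiring_1 ^ 'm ^ 'n" and C :: "'a ^ 'k ^ 'm"
  by (simp add: matrix_matrix_mult_def vec_eq_iff sum.distrib algebra_simps)

lemma mat_mult_left: "mat c ** A = (\<chi> i j. c * A $ i $ j)" for A :: "'a::comm_ring_1 ^ 'm ^ 'n"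
  by (simp add: matrix_matrix_mult_def mat_def vec_eq_iff if_distrib[of "\<lambda>x. x * _"] cong: if_cong)

lemma mat_mult_commute: "A ** mat c = mat c ** A" for A :: "'a::comm_ring_1 ^ 'n ^ 'n"
  by (simp add: matrix_matrix_mult_def mat_def vec_eq_iff if_distrib[of "\<lambda>x. x * _"]
      if_distrib[of "\<lambda>x. _ * x"] mult.commute cong: if_cong)

lemma mat_mult_vec: "mat c *v v = c *s v" for v :: "'a::comm_ring_1 ^ 'n"
  by (simp add: matrix_vector_mult_def mat_def vec_eq_iff if_distrib[of "\<lambda>x. x * _"] cong: if_cong)

definition pev :: "'a::comm_ring_1 ^ 'n ^ 'n \<Rightarrow> 'a poly \<Rightarrow> 'a ^ 'n ^ 'n" where
  "pev A p = fold_coeffs (\<lambda>a M. mat a + A ** M) p 0"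

lemma mat_0 [simp]: "mat 0 = (0 :: 'a::comm_ring_1 ^ 'n ^ 'n)"
  by (simp add: mat_def vec_eq_iff)

lemma mat_add: "mat (a + b) = mat a + (mat b :: 'a::comm_ring_1 ^ 'n ^ 'n)"
  by (simp add: mat_def vec_eq_iff)

lemma mat_mult: "mat (a * b) = mat a ** (mat b :: 'a::comm_ring_1 ^ 'n ^ 'n)"
  by (simp add: mat_mult_left) (simp add: mat_def vec_eq_iff)

lemma pev_0 [simp]: "pev A 0 = 0"
  by (simp add: pev_def)

lemma pev_pCons [simp]: "pev A (pCons a p) = mat a + A ** pev A p"
  by (cases "p = 0 \<and> a = 0") (auto simp: pev_def)

lemma pev_1 [simp]: "pev A 1 = mat 1"
  by (simp add: one_pCons)

lemma pev_add: "pev A (p + q) = pev A p + pev A q"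
proof (induction p arbitrary: q)
  case (pCons a p)
  then show ?case by (cases q) (simp_all add: mat_add matrix_add_ldistrib)
qed simp

lemma pev_sum: "pev A (\<Sum>i\<in>I. f i) = (\<Sum>i\<in>I. pev A (f i))"
  by (induction I rule: infinite_finite_induct) (auto simp: pev_add)

lemma pev_smult: "pev A (smult c p) = mat c ** pev A p"
proof (induction p)
  case (pCons a p)
  have "A ** (mat c ** pev A p) = mat c ** (A ** pev A p)"
    by (simp add: matrix_mul_assoc mat_mult_commute[of A])
  then show ?case by (simp add: pCons mat_mult matrix_add_ldistrib)
qed simp

lemma pev_mult: "pev A (p * q) = pev A p ** pev A q"
proof (induction p)
  case (pCons a p)
  then show ?case
    by (simp add: pev_add pev_smult matrix_mult_add_left matrix_mul_assoc)
qed simp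

lemma pev_commute:
  assumes "A ** Y = Y ** A"
  shows "pev A p ** Y = Y ** pev A p"
proof (induction p)
  case (pCons a p)
  have "A ** pev A p ** Y = Y ** (A ** pev A p)"
    by (metis assms matrix_mul_assoc pCons.IH)
  then show ?case by (simp add: matrix_mult_add_left matrix_add_ldistrib mat_mult_commute)
qed simp

lemma pev_conj:
  fixes A C D :: "'a::comm_ring_1 ^ 'n ^ 'n"
  assumes "C ** D = mat 1" "D ** C = mat 1"
  shows "pev (D ** A ** C) p = D ** pev A p ** C"
proof (induction p)
  case (pCons a p)
  have "D ** A ** C ** (D ** pev A p ** C) = D ** A ** (C ** D) ** pev A p ** C"
    by (simp add: matrix_mul_assoc)
  then have "D ** A ** C ** (D ** pev A p ** C) = D ** (A ** pev A p) ** C"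
    by (simp add: assms matrix_mul_assoc)
  moreover have "D ** mat a ** C = mat a"
    by (simp only: mat_mult_commute[of D] matrix_mul_assoc[symmetric] assms matrix_mul_rid)
  ultimately show ?case
    by (simp add: pCons matrix_mult_add_left matrix_add_ldistrib)
qed simp

lemma pev_eigenvector: "A *v v = \<mu> *s v \<Longrightarrow> pev A p *v v = poly p \<mu> *s v"
proof (induction p)
  case (pCons a p)
  have "A *v (pev A p *v v) = (\<mu> * poly p \<mu>) *s v"
  proof -
    have "A *v (k *s v) = k *s (A *v v)" for k
      by (simp add: matrix_vector_mult_def vec_eq_iff sum_distrib_left mult_ac)
    then show ?thesis
      using pCons.IH[OF pCons.prems] pCons.prems by (simp add: vector_smult_assoc mult.commute)
  qed
  then show ?case
    by (simp add: matrix_vector_mult_add_rdistrib mat_mult_vec matrix_vector_mul_assoc[symmetric] vector_sadd_rdistrib)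
qed simp

definition complexify :: "real ^ 'm ^ 'n \<Rightarrow> complex ^ 'm ^ 'n" where
  "complexify A = (\<chi> i j. complex_of_real (A $ i $ j))"

lemma complexify_mult: "complexify (A ** B) = complexify A ** complexify B"
  by (simp add: complexify_def matrix_matrix_mult_def vec_eq_iff)

lemma complexify_pev: "complexify (pev A p) = pev (complexify A) (map_poly complex_of_real p)"
proof (induction p)
  case 0
  then show ?case by (simp add: complexify_def vec_eq_iff)
next
  case (pCons a p)
  have "complexify (mat a + M) = mat (complex_of_real a) + complexify M" for M :: "real ^ 'a ^ 'a"
    by (simp add: complexify_def mat_def vec_eq_iff)
  then show ?case by (simp add: pCons map_poly_pCons complexify_mult)
qed

lemma annihilating_polynomial:
  fixes A :: "real ^ 'n ^ 'n"
  obtains p where "p \<noteq> 0" "pev A p = 0"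
proof -
  define f where "f i = pev A (monom 1 i)" for i
  define N where "N = DIM(real ^ 'n ^ 'n)"
  show ?thesis
  \<comment> \<open>\<open>dependent\<close> is a property of sets, so a coincidence of two powers
    is treated apart; otherwise the \<open>N + 1\<close> powers outnumber the dimension
    \<open>N\<close>.\<close>
  proof (cases "inj_on f {..N}")
    case False
    then obtain i j where ij: "i \<noteq> j" "f i = f j" by (auto simp: inj_on_def)
    have "pev A (monom 1 i + smult (-1) (monom 1 j)) = 0"
      unfolding pev_add pev_smult using ij(2) by (simp add: f_def mat_mult_left vec_eq_iff)
    moreover have "coeff (monom 1 i + smult (-1) (monom 1 j) :: real poly) i \<noteq> 0"
      using ij(1) by simp
    then have "monom 1 i + smult (-1) (monom 1 j) \<noteq> (0 :: real poly)" by (metis coeff_0)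
    ultimately show ?thesis using that by blast
  next
    case True
    have "dependent (f ` {..N})"
      using independent_bound[of "f ` {..N}"] True by (auto simp: card_image N_def)
    then obtain u where u: "\<exists>v\<in>f ` {..N}. u v \<noteq> 0" "(\<Sum>v\<in>f ` {..N}. u v *\<^sub>R v) = 0"
      using dependent_finite[of "f ` {..N}"] by auto
    then obtain k where k: "k \<le> N" "u (f k) \<noteq> 0" by auto
    define p where "p = (\<Sum>i\<le>N. smult (u (f i)) (monom 1 i))"
    have "coeff p k = u (f k)"
      using k(1) by (simp add: p_def coeff_sum if_distrib cong: if_cong)
    then have "p \<noteq> 0" using k(2) by auto
    moreover have "mat c ** M = c *\<^sub>R M" for c and M :: "real ^ 'n ^ 'n"
      by (simp add: mat_mult_left vec_eq_iff)
    then have "pev A p = (\<Sum>v\<in>f ` {..N}. u v *\<^sub>R v)"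
      by (simp add: p_def pev_sum pev_smult sum.reindex[OF True] f_def[symmetric] o_def)
    ultimately show ?thesis using that u(2) by simp
  qed
qed

section \<open>Real polynomials and their complex roots\<close>

abbreviation cpoly :: "real poly \<Rightarrow> complex \<Rightarrow> complex" where
  "cpoly p z \<equiv> poly (map_poly complex_of_real p) z"

lemma cpoly_add: "cpoly (p + q) z = cpoly p z + cpoly q z"
proof (induction p arbitrary: q)
  case (pCons a p)
  then show ?case by (cases q) (simp_all add: map_poly_pCons algebra_simps)
qed simp

lemma cpoly_smult: "cpoly (smult c p) z = of_real c * cpoly p z"
  by (induction p) (simp_all add: map_poly_pCons algebra_simps)

lemma cpoly_mult: "cpoly (p * q) z = cpoly p z * cpoly q z"
  by (induction p) (simp_all add: map_poly_pCons cpoly_add cpoly_smult algebra_simps)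

lemma cpoly_power: "cpoly (p ^ k) z = cpoly p z ^ k"
  by (induction k) (simp_all add: cpoly_mult)

lemma cpoly_cnj: "cpoly p (cnj z) = cnj (cpoly p z)"
  by (induction p) (simp_all add: map_poly_pCons)

lemma cpoly_of_real: "cpoly p (of_real x) = of_real (poly p x)"
  by (induction p) (simp_all add: map_poly_pCons)

lemma cpoly_root:
  assumes "degree p \<noteq> 0"
  obtains z where "cpoly p z = 0" "Im z \<ge> 0"
proof -
  have "degree (map_poly complex_of_real p) = degree p" by (rule degree_map_poly) simp
  then obtain z where "cpoly p z = 0"
    using fundamental_theorem_of_algebra[of "map_poly complex_of_real p"] assms by (auto simp: constant_degree)
  then show ?thesis
    using that[of z] that[of "cnj z"] by (cases "Im z \<ge> 0") (auto simp: cpoly_cnj)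
qed

definition min_real_poly :: "complex \<Rightarrow> real poly" where
  "min_real_poly \<mu> = (if Im \<mu> = 0 then [:- Re \<mu>, 1:] else [:(Re \<mu>)\<^sup>2 + (Im \<mu>)\<^sup>2, - 2 * Re \<mu>, 1:])"

lemma min_real_poly_neq_0: "min_real_poly \<mu> \<noteq> 0"
  by (simp add: min_real_poly_def)

lemma degree_min_real_poly: "degree (min_real_poly \<mu>) > 0"
  by (simp add: min_real_poly_def)

lemma cpoly_min_real_poly: "cpoly (min_real_poly \<mu>) z = 0 \<longleftrightarrow> z = \<mu> \<or> z = cnj \<mu>"
proof (cases "Im \<mu> = 0")
  case True
  then have "cpoly (min_real_poly \<mu>) z = z - \<mu>" "cnj \<mu> = \<mu>"
    by (auto simp: min_real_poly_def map_poly_pCons complex_eq_iff)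
  then show ?thesis by auto
next
  case False
  then have "cpoly (min_real_poly \<mu>) z = (z - \<mu>) * (z - cnj \<mu>)"
    by (simp add: min_real_poly_def map_poly_pCons complex_eq_iff algebra_simps power2_eq_square)
  then show ?thesis by auto
qed

text \<open>For nonreal \<open>\<mu>\<close> the remainder of the division is real of degree at most
  1, and a nonreal root forces both of its coefficients to vanish.\<close>

lemma min_real_poly_dvd:
  assumes "cpoly p \<mu> = 0"
  shows "min_real_poly \<mu> dvd p"
proof (cases "Im \<mu> = 0")
  case True
  then have "\<mu> = of_real (Re \<mu>)" by (simp add: complex_eq_iff)
  then have "poly p (Re \<mu>) = 0" using assms cpoly_of_real by (metis of_real_eq_0_iff)
  then show ?thesis using True by (simp add: min_real_poly_def poly_eq_0_iff_dvd)
next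
  case False
  define r where "r = p mod min_real_poly \<mu>"
  have "r = 0 \<or> degree r < 2"
    using degree_mod_less[OF min_real_poly_neq_0, of p \<mu>] False by (simp add: r_def min_real_poly_def numeral_2_eq_2)
  then have deg: "degree r \<le> 1" by auto
  obtain a s where s: "r = pCons a s" by (cases r)
  then have "degree s = 0" using deg by (cases "s = 0") auto
  then obtain b where "s = [:b:]" by (rule degree_eq_zeroE)
  then have r: "r = [:a, b:]" using s by simp
  have "cpoly (min_real_poly \<mu> * (p div min_real_poly \<mu>) + r) \<mu> = 0"
    using assms by (simp add: r_def)
  then have "cpoly r \<mu> = 0"
    using cpoly_min_real_poly[of \<mu> \<mu>] by (simp only: cpoly_add cpoly_mult) simp
  then have "b = 0" "a = 0" using False by (auto simp: r map_poly_pCons complex_eq_iff)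
  then show ?thesis using r by (simp add: r_def dvd_eq_mod_eq_0)
qed

text \<open>Roots are collected in the closed upper half plane, one from each conjugate pair, so
  that distinct factors are coprime. A common exponent replaces the multiplicities.\<close>

lemma dvd_prod_min_real_poly:
  fixes p :: "real poly"
  assumes "p \<noteq> 0"
  shows "\<exists>I N. finite I \<and> (\<forall>\<mu>\<in>I. Im \<mu> \<ge> 0) \<and> p dvd (\<Prod>\<mu>\<in>I. min_real_poly \<mu>) ^ N"
  using assms
proof (induction "degree p" arbitrary: p rule: less_induct)
  case less
  show ?case
  proof (cases "degree p = 0")
    case True
    then have "p dvd 1" using less.prems by (auto elim!: degree_eq_zeroE simp: is_unit_const_poly_iff dvd_field_iff)
    then show ?thesis by (intro exI[of _ "{}"] exI[of _ 0]) simp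
  next
    case False
    then obtain \<mu> where \<mu>: "cpoly p \<mu> = 0" "Im \<mu> \<ge> 0" by (rule cpoly_root)
    obtain d where d: "p = min_real_poly \<mu> * d" using min_real_poly_dvd[OF \<mu>(1)] by (auto simp: dvd_def)
    then have "d \<noteq> 0" using less.prems by auto
    then have "degree d < degree p"
      using degree_min_real_poly[of \<mu>] by (simp add: d degree_mult_eq min_real_poly_neq_0)
    then obtain I N where I: "finite I" "\<forall>\<mu>\<in>I. Im \<mu> \<ge> 0" "d dvd (\<Prod>\<mu>\<in>I. min_real_poly \<mu>) ^ N"
      using less.hyps \<open>d \<noteq> 0\<close> by blast
    let ?J = "insert \<mu> I"
    have "min_real_poly \<mu> dvd (\<Prod>\<mu>\<in>?J. min_real_poly \<mu>)" using I(1) by (intro dvd_prodI) auto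
    moreover have "(\<Prod>\<mu>\<in>I. min_real_poly \<mu>) dvd (\<Prod>\<mu>\<in>?J. min_real_poly \<mu>)"
      using I(1) by (intro prod_dvd_prod_subset) auto
    then have "d dvd (\<Prod>\<mu>\<in>?J. min_real_poly \<mu>) ^ N" using I(3) dvd_power_same dvd_trans by blast
    ultimately have "p dvd (\<Prod>\<mu>\<in>?J. min_real_poly \<mu>) ^ Suc N"
      unfolding d power_Suc by (rule mult_dvd_mono)
    then show ?thesis using I(1,2) \<mu>(2) by (intro exI[of _ ?J] exI[of _ "Suc N"]) auto
  qed
qed

lemma coprime_min_real_poly:
  assumes "Im \<mu> \<ge> 0" "Im \<nu> \<ge> 0" "\<mu> \<noteq> \<nu>"
  shows "coprime (min_real_poly \<mu>) (min_real_poly \<nu>)"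
proof (rule coprimeI)
  fix d assume d: "d dvd min_real_poly \<mu>" "d dvd min_real_poly \<nu>"
  have "d \<noteq> 0" using d(1) min_real_poly_neq_0 by auto
  have "degree d = 0"
  proof (rule ccontr)
    assume "degree d \<noteq> 0"
    then obtain z where z: "cpoly d z = 0" "Im z \<ge> 0" by (rule cpoly_root)
    then have "cpoly (min_real_poly \<mu>) z = 0" "cpoly (min_real_poly \<nu>) z = 0"
      using d by (auto simp: dvd_def cpoly_mult)
    then have "z = \<mu>" "z = \<nu>"
      using assms(1,2) z(2) unfolding cpoly_min_real_poly by (auto simp: complex_eq_iff)
    then show False using assms(3) by simp
  qed
  then show "is_unit d" using \<open>d \<noteq> 0\<close> by (auto elim!: degree_eq_zeroE simp: is_unit_const_poly_iff dvd_field_iff)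
qed

text \<open>Evaluated at a matrix, the summands of this decomposition of 1 become the projections of
  the primary decomposition.\<close>

lemma bezout_prod:
  fixes c :: "'i \<Rightarrow> 'a::euclidean_ring_gcd"
  assumes "finite I" "I \<noteq> {}" "\<And>i j. i \<in> I \<Longrightarrow> j \<in> I \<Longrightarrow> i \<noteq> j \<Longrightarrow> coprime (c i) (c j)"
  shows "\<exists>a. (\<Sum>i\<in>I. a i * (\<Prod>j\<in>I - {i}. c j)) = 1"
  using assms
proof (induction I rule: finite_ne_induct)
  case (singleton i)
  then show ?case by (intro exI[of _ "\<lambda>_. 1"]) simp
next
  case (insert k I)
  then obtain a where a: "(\<Sum>i\<in>I. a i * (\<Prod>j\<in>I - {i}. c j)) = 1" by auto
  have "coprime (c k) (\<Prod>j\<in>I. c j)"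
    using insert by (intro prod_coprime_right) auto
  then obtain s t where st: "s * c k + t * (\<Prod>j\<in>I. c j) = 1"
    using bezout_coefficients_fst_snd[of "c k" "\<Prod>j\<in>I. c j"] by (metis coprime_imp_gcd_eq_1)
  define b where "b i = (if i = k then t else s * a i)" for i
  have "(\<Prod>j\<in>insert k I - {i}. c j) = c k * (\<Prod>j\<in>I - {i}. c j)" if "i \<in> I" for i
  proof -
    have "insert k I - {i} = insert k (I - {i})" using that insert.hyps by auto
    then show ?thesis using insert.hyps by simp
  qed
  then have "(\<Sum>i\<in>I. b i * (\<Prod>j\<in>insert k I - {i}. c j)) = (\<Sum>i\<in>I. (s * c k) * (a i * (\<Prod>j\<in>I - {i}. c j)))"
    using insert.hyps by (intro sum.cong) (auto simp: b_def mult_ac)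
  also have "\<dots> = s * c k" by (simp add: sum_distrib_left[symmetric] a)
  finally have "(\<Sum>i\<in>insert k I. b i * (\<Prod>j\<in>insert k I - {i}. c j)) = 1"
    using insert.hyps st by (simp add: b_def add.commute)
  then show ?case by blast
qed

text \<open>After a root is split off from \<open>p\<close>, the cofactor either kills
  \<open>v\<close> already or maps it to an eigenvector. As \<open>A\<close> commutes with
  \<open>E\<close>, the vector obtained is still fixed by \<open>E\<close>.\<close>

lemma eigenvector_exists:
  fixes A E :: "complex ^ 'n ^ 'n"
  assumes "A ** E = E ** A" "p \<noteq> 0" "v \<noteq> 0" "E *v v = v" "pev A p *v v = 0"
  shows "\<exists>\<nu> w. w \<noteq> 0 \<and> E *v w = w \<and> A *v w = \<nu> *s w"
  using assms(2-5)
proof (induction "degree p" arbitrary: p v rule: less_induct)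
  case less
  show ?case
  proof (cases "degree p = 0")
    case True
    then obtain c where c: "p = [:c:]" by (rule degree_eq_zeroE)
    then have "c *s v = 0" "c \<noteq> 0" using less.prems by (auto simp: mat_mult_vec)
    then show ?thesis using less.prems(2) by (simp add: vec_eq_iff)
  next
    case False
    then obtain \<nu> where "poly p \<nu> = 0"
      using fundamental_theorem_of_algebra[of p] by (auto simp: constant_degree)
    then obtain d where d: "p = [:- \<nu>, 1:] * d" by (auto simp: poly_eq_0_iff_dvd dvd_def)
    then have "d \<noteq> 0" using less.prems by auto
    then have deg: "degree d < degree p" unfolding d by (subst degree_mult_eq) auto
    define w where "w = pev A d *v v"
    show ?thesis
    proof (cases "w = 0")
      case True
      then show ?thesis using less.hyps[OF deg \<open>d \<noteq> 0\<close> less.prems(2,3)] by (simp add: w_def)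
    next
      case False
      have "pev A [:- \<nu>, 1:] *v w = 0"
        using less.prems(4) by (simp only: d pev_mult w_def matrix_vector_mul_assoc)
      then have "A *v w = \<nu> *s w"
        by (simp add: matrix_vector_mult_add_rdistrib mat_mult_vec vec_eq_iff)
      moreover have "E *v w = w"
        using pev_commute[OF assms(1), of d] less.prems(3) by (metis matrix_vector_mul_assoc w_def)
      ultimately show ?thesis using False by blast
    qed
  qed
qed

subsection \<open>Coordinates adapted to the decomposition\<close>

definition coord_proj :: "'n set \<Rightarrow> real ^ 'n ^ 'n" where
  "coord_proj B = (\<chi> i j. if i = j \<and> i \<in> B then 1 else 0)"

lemma coord_proj_vec: "coord_proj B *v v = (\<chi> i. if i \<in> B then v $ i else 0)"
proof (rule vec_eq_iff[THEN iffD2], rule allI)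
  fix i
  have "(coord_proj B *v v) $ i = (\<Sum>j\<in>UNIV. if j = i then (if i \<in> B then v $ i else 0) else 0)"
    unfolding coord_proj_def matrix_vector_mult_def vec_lambda_beta by (rule sum.cong) auto
  then show "(coord_proj B *v v) $ i = (\<chi> i. if i \<in> B then v $ i else 0) $ i" by simp
qed

lemma complexify_coord_proj_vec: "complexify (coord_proj B) *v v = (\<chi> i. if i \<in> B then v $ i else 0)"
proof (rule vec_eq_iff[THEN iffD2], rule allI)
  fix i
  have "(complexify (coord_proj B) *v v) $ i = (\<Sum>j\<in>UNIV. if j = i then (if i \<in> B then v $ i else 0) else 0)"
    unfolding complexify_def coord_proj_def matrix_vector_mult_def vec_lambda_beta by (rule sum.cong) auto
  then show "(complexify (coord_proj B) *v v) $ i = (\<chi> i. if i \<in> B then v $ i else 0) $ i" by simp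
qed

lemma coord_proj_mult: "coord_proj B ** A = (\<chi> i j. if i \<in> B then A $ i $ j else 0)"
  by (rule matrix_eq[THEN iffD2]) (simp add: matrix_vector_mul_assoc[symmetric] coord_proj_vec,
    simp add: matrix_vector_mult_def vec_eq_iff)

lemma mult_coord_proj: "A ** coord_proj B = (\<chi> i j. if j \<in> B then A $ i $ j else 0)"
  by (rule matrix_eq[THEN iffD2]) (simp add: matrix_vector_mul_assoc[symmetric] coord_proj_vec,
    auto simp: matrix_vector_mult_def vec_eq_iff intro!: sum.cong)

lemma coord_proj_idem: "coord_proj B ** coord_proj B = coord_proj B"
  unfolding coord_proj_mult by (auto simp: coord_proj_def vec_eq_iff)

lemma block_eq_coord_proj: "block B A = coord_proj B ** A ** coord_proj B"
  unfolding mult_coord_proj by (auto simp: coord_proj_mult block_def vec_eq_iff)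

lemma block_eigenvalues_eq:
  "block_eigenvalues B A = {\<mu>. \<exists>v. v \<noteq> 0 \<and> complexify (coord_proj B) *v v = v \<and> complexify (block B A) *v v = \<mu> *s v}"
proof -
  have "(\<forall>a. a \<notin> B \<longrightarrow> v $ a = 0) \<longleftrightarrow> complexify (coord_proj B) *v v = v" for v
    by (auto simp: complexify_coord_proj_vec vec_eq_iff)
  then show ?thesis by (simp add: block_eigenvalues_def complexify_def)
qed

lemma complexify_cnj: "complexify A *v (\<chi> i. cnj (v $ i)) = (\<chi> i. cnj ((complexify A *v v) $ i))"
  by (simp add: complexify_def matrix_vector_mult_def vec_eq_iff)

text \<open>Annihilation confines the eigenvalues to the roots of
  \<open>min_real_poly \<mu>\<close>, a nonempty block has at least one, and conjugating
  eigenvectors of a real matrix produces the other.\<close>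

lemma block_eigenvalues_min_real_poly:
  fixes A :: "real ^ 'n ^ 'n"
  assumes A: "A ** coord_proj B = coord_proj B ** A" and B: "B \<noteq> {}"
    and zero: "pev A (min_real_poly \<mu> ^ N) ** coord_proj B = 0"
  shows "block_eigenvalues B A = {\<mu>, cnj \<mu>}"
proof -
  define E where "E = complexify (coord_proj B)"
  define A' where "A' = complexify A"
  define p where "p = map_poly complex_of_real (min_real_poly \<mu> ^ N)"
  have AE: "A' ** E = E ** A'" unfolding A'_def E_def by (simp add: A flip: complexify_mult)
  have EE: "E *v (E *v v) = E *v v" for v
    by (simp add: E_def matrix_vector_mul_assoc coord_proj_idem flip: complexify_mult)
  have blk: "complexify (block B A) *v v = A' *v v" if "E *v v = v" for v
  proof -
    have "complexify (block B A) *v v = E *v (A' *v (E *v v))"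
      by (simp add: block_eq_coord_proj complexify_mult E_def A'_def flip: matrix_vector_mul_assoc)
    also have "\<dots> = A' *v (E *v (E *v v))"
    proof -
      have "E *v (A' *v u) = A' *v (E *v u)" for u by (simp add: matrix_vector_mul_assoc AE)
      then show ?thesis by simp
    qed
    finally show ?thesis using that by simp
  qed
  have ev: "block_eigenvalues B A = {\<nu>. \<exists>v. v \<noteq> 0 \<and> E *v v = v \<and> A' *v v = \<nu> *s v}"
    unfolding block_eigenvalues_eq E_def[symmetric] using blk by metis
  have "complexify (0 :: real ^ 'n ^ 'n) = 0" by (simp add: complexify_def vec_eq_iff)
  then have "pev A' p ** E = 0"
    using arg_cong[OF zero, of complexify] by (simp add: complexify_mult complexify_pev A'_def E_def p_def)
  then have kill: "pev A' p *v v = 0" if "E *v v = v" for v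
    using that by (metis matrix_vector_mul_assoc matrix_vector_mult_0)
  have sub: "\<nu> = \<mu> \<or> \<nu> = cnj \<mu>" if v: "v \<noteq> 0" "E *v v = v" "A' *v v = \<nu> *s v" for \<nu> v
  proof -
    have "poly p \<nu> *s v = 0" using pev_eigenvector[OF v(3), of p] kill[OF v(2)] by simp
    then have "poly p \<nu> = 0" using v(1) by (simp add: vec_eq_iff) blast
    then have "cpoly (min_real_poly \<mu>) \<nu> = 0" by (simp add: p_def cpoly_power)
    then show ?thesis by (simp add: cpoly_min_real_poly)
  qed
  have cnj: "\<exists>w. w \<noteq> 0 \<and> E *v w = w \<and> A' *v w = cnj \<nu> *s w" if v: "v \<noteq> 0" "E *v v = v" "A' *v v = \<nu> *s v" for \<nu> v
  proof (intro exI conjI)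
    show "(\<chi> i. cnj (v $ i)) \<noteq> 0" using v(1) by (simp add: vec_eq_iff)
    show "E *v (\<chi> i. cnj (v $ i)) = (\<chi> i. cnj (v $ i))" using v(2) by (simp add: E_def complexify_cnj)
    show "A' *v (\<chi> i. cnj (v $ i)) = cnj \<nu> *s (\<chi> i. cnj (v $ i))"
      using v(3) by (simp add: A'_def complexify_cnj vec_eq_iff)
  qed
  obtain b where b: "b \<in> B" using B by auto
  have "E *v axis b 1 = axis b 1" using b by (auto simp: E_def complexify_coord_proj_vec vec_eq_iff axis_def)
  moreover have "p \<noteq> 0"
    using min_real_poly_neq_0[of \<mu>] by (simp add: p_def map_poly_eq_0_iff)
  moreover have "axis b 1 \<noteq> (0 :: complex ^ 'n)" by (simp add: axis_eq_0_iff)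
  ultimately obtain \<nu> w where w: "w \<noteq> 0" "E *v w = w" "A' *v w = \<nu> *s w"
    using eigenvector_exists[OF AE, of p "axis b 1"] kill by blast
  obtain w' where w': "w' \<noteq> 0" "E *v w' = w'" "A' *v w' = cnj \<nu> *s w'" using cnj[OF w] by blast
  have "{\<mu>, cnj \<mu>} = {\<nu>, cnj \<nu>}" using sub[OF w] by auto
  moreover have "\<nu> \<in> block_eigenvalues B A" unfolding ev by (rule CollectI, rule exI[of _ w]) (use w in simp)
  moreover have "cnj \<nu> \<in> block_eigenvalues B A" unfolding ev by (rule CollectI, rule exI[of _ w']) (use w' in simp)
  moreover have "\<nu>' \<in> {\<mu>, cnj \<mu>}" if "\<nu>' \<in> block_eigenvalues B A" for \<nu>'
    using that sub unfolding ev by (elim CollectE exE conjE) simp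
  ultimately show ?thesis by (intro equalityI subsetI) auto
qed

text \<open>A basis adapted to the primary components and indexed by \<open>'n\<close> turns them
  into coordinate subspaces. As the projections are polynomials in the matrix, its whole commutant
  commutes with them; this clause is how the disjointness of spectra enters the later
  arguments.\<close>

theorem real_primary_decomposition:
  fixes A :: "real ^ 'n ^ 'n"
  obtains P C D where "C ** D = mat 1" "D ** C = mat 1" "partition_on (UNIV :: 'n set) P"
    "\<And>B Y. B \<in> P \<Longrightarrow> (D ** A ** C) ** Y = Y ** (D ** A ** C) \<Longrightarrow> coord_proj B ** Y = Y ** coord_proj B"
    "\<And>B. B \<in> P \<Longrightarrow> \<exists>\<mu>. block_eigenvalues B (D ** A ** C) = {\<mu>, cnj \<mu>}"
proof -
  obtain p where p: "p \<noteq> 0" "pev A p = 0" by (rule annihilating_polynomial)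
  obtain I N where I: "finite I" "\<forall>\<mu>\<in>I. Im \<mu> \<ge> 0" and pd: "p dvd (\<Prod>\<mu>\<in>I. min_real_poly \<mu>) ^ N"
    using dvd_prod_min_real_poly[OF p(1)] by blast
  define c where "c \<mu> = min_real_poly \<mu> ^ N" for \<mu>
  have dvd0: "pev A q = 0" if "(\<Prod>\<mu>\<in>I. c \<mu>) dvd q" for q
  proof -
    have "p dvd q" using pd that by (auto simp: c_def prod_power_distrib intro: dvd_trans)
    then show ?thesis using p(2) by (auto simp: dvd_def pev_mult)
  qed
  have "I \<noteq> {}"
  proof
    assume "I = {}"
    then have "pev A 1 = 0" by (intro dvd0) simp
    then have "(mat 1 :: real ^ 'n ^ 'n) $ undefined $ undefined = 0" by simp
    then show False by (simp add: mat_def)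
  qed
  have "coprime (c \<mu>) (c \<nu>)" if "\<mu> \<in> I" "\<nu> \<in> I" "\<mu> \<noteq> \<nu>" for \<mu> \<nu>
    using coprime_min_real_poly[of \<mu> \<nu>] I(2) that by (auto simp: c_def coprime_power_left_iff coprime_power_right_iff)
  then obtain a where a: "(\<Sum>\<mu>\<in>I. a \<mu> * (\<Prod>\<nu>\<in>I - {\<mu>}. c \<nu>)) = 1"
    using bezout_prod[OF I(1) \<open>I \<noteq> {}\<close>, of c] by auto
  define f where "f \<mu> = a \<mu> * (\<Prod>\<nu>\<in>I - {\<mu>}. c \<nu>)" for \<mu>
  define R where "R \<mu> = pev A (f \<mu>)" for \<mu>
  have R1: "(\<Sum>\<mu>\<in>I. R \<mu>) = mat 1"
    using arg_cong[OF a, of "pev A"] by (simp add: R_def f_def pev_sum)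
  have RR: "R \<mu> ** R \<nu> = 0" if "\<mu> \<in> I" "\<nu> \<in> I" "\<mu> \<noteq> \<nu>" for \<mu> \<nu>
  proof -
    have "(\<Prod>\<mu>\<in>I. c \<mu>) = c \<mu> * (\<Prod>\<nu>\<in>I - {\<mu>}. c \<nu>)" by (rule prod.remove[OF I(1) that(1)])
    also have "\<dots> dvd f \<nu> * f \<mu>"
    proof (rule mult_dvd_mono)
      show "c \<mu> dvd f \<nu>" unfolding f_def using I(1) that by (intro dvd_mult dvd_prodI) auto
    qed (simp add: f_def)
    finally have "pev A (f \<mu> * f \<nu>) = 0" by (intro dvd0) (simp add: mult.commute)
    then show ?thesis by (simp add: R_def pev_mult)
  qed
  have cR: "pev A (c \<mu>) ** R \<mu> = 0" if "\<mu> \<in> I" for \<mu>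
  proof -
    have "(\<Prod>\<mu>\<in>I. c \<mu>) = c \<mu> * (\<Prod>\<nu>\<in>I - {\<mu>}. c \<nu>)" by (rule prod.remove[OF I(1) that])
    also have "\<dots> dvd c \<mu> * f \<mu>" by (simp add: f_def)
    finally show ?thesis using dvd0 by (simp add: R_def pev_mult[symmetric])
  qed
  have Rv: "(\<Sum>\<mu>\<in>I. R \<mu> *v v) = v" for v
  proof -
    have "(\<Sum>\<mu>\<in>I. R \<mu>) *v v = (\<Sum>\<mu>\<in>I. R \<mu> *v v)"
      by (rule bounded_bilinear.sum_left[OF bounded_bilinear_matrix_vector_mult])
    then show ?thesis by (simp add: R1)
  qed
  have id: "R \<mu> *v (R \<mu> *v v) = R \<mu> *v v" if "\<mu> \<in> I" for \<mu> v
  proof -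
    have "R \<mu> *v v = (\<Sum>\<nu>\<in>I. R \<nu> *v (R \<mu> *v v))" by (simp add: Rv)
    also have "\<dots> = (\<Sum>\<nu>\<in>I. if \<nu> = \<mu> then R \<mu> *v (R \<mu> *v v) else 0)"
      using RR that by (intro sum.cong) (auto simp: matrix_vector_mul_assoc)
    finally show ?thesis using I(1) that by simp
  qed
  \<comment> \<open>A maximal independent subset of the union of the images spans the space, and
    each of its vectors lies in a single component: an adapted basis.\<close>
  define S where "S = (\<Union>\<mu>\<in>I. range ((*v) (R \<mu>)))"
  obtain K where K: "K \<subseteq> S" "independent K" "S \<subseteq> span K" by (rule maximal_independent_subset)
  have span: "span K = UNIV"
  proof -
    have "v \<in> span K" for v
    proof -
      have "R \<mu> *v v \<in> span K" if "\<mu> \<in> I" for \<mu> using K(3) that by (auto simp: S_def)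
      then have "(\<Sum>\<mu>\<in>I. R \<mu> *v v) \<in> span K" by (rule span_sum)
      then show ?thesis by (simp add: Rv)
    qed
    then show ?thesis by auto
  qed
  have "card K = DIM(real ^ 'n)"
    using dim_eq_card[of K UNIV] K(2) span by (simp add: dim_UNIV)
  then have "card K = CARD('n)" "finite K" using independent_imp_finite[OF K(2)] by simp_all
  then obtain \<beta> where \<beta>: "bij_betw \<beta> (UNIV :: 'n set) K"
    using finite_same_card_bij[of "UNIV :: 'n set" K] by auto
  have "\<exists>\<mu>\<in>I. \<beta> i \<in> range ((*v) (R \<mu>))" for i
    using \<beta> K(1) unfolding S_def bij_betw_def by blast
  then obtain m where m: "\<And>i. m i \<in> I" "\<And>i. \<beta> i \<in> range ((*v) (R (m i)))" by metis
  have R\<beta>: "R \<mu> *v \<beta> i = (if m i = \<mu> then \<beta> i else 0)" if "\<mu> \<in> I" for \<mu> i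
  proof -
    obtain u where u: "\<beta> i = R (m i) *v u" using m(2)[of i] by auto
    show ?thesis
    proof (cases "m i = \<mu>")
      case True
      then show ?thesis using u id[OF that] by simp
    next
      case False
      then have "R \<mu> ** R (m i) = 0" using RR[OF that m(1)] by auto
      then show ?thesis using u False by (simp add: matrix_vector_mul_assoc)
    qed
  qed
  define C where "C = (\<chi> i j. \<beta> j $ i)"
  have C: "C *v axis i 1 = \<beta> i" for i
    by (simp add: matrix_vector_mult_basis column_def C_def vec_eq_iff)
  have "K \<subseteq> range ((*v) C)"
  proof
    fix k assume "k \<in> K"
    then obtain i where "k = \<beta> i" using \<beta> by (auto simp: bij_betw_def)
    then show "k \<in> range ((*v) C)" using C[of i] by (metis rangeI)
  qed
  then have "span K \<subseteq> range ((*v) C)"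
    by (intro span_minimal linear_subspace_image[OF matrix_vector_mul_linear]) auto
  then have "surj ((*v) C)" using span by auto
  then obtain D where CD: "C ** D = mat 1" using matrix_right_invertible_surjective[of C] by blast
  then have DC: "D ** C = mat 1" using matrix_left_right_inverse[of C D] by blast
  define blk where "blk \<mu> = {i. m i = \<mu>}" for \<mu>
  have RC: "R \<mu> ** C = C ** coord_proj (blk \<mu>)" if "\<mu> \<in> I" for \<mu>
  proof -
    have "(R \<mu> ** C) *v axis i 1 = (C ** coord_proj (blk \<mu>)) *v axis i 1" for i
    proof -
      have "coord_proj (blk \<mu>) *v axis i 1 = (if m i = \<mu> then axis i 1 else 0)"
        by (auto simp: coord_proj_vec blk_def vec_eq_iff axis_def)
      then show ?thesis by (simp add: matrix_vector_mul_assoc[symmetric] C R\<beta>[OF that])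
    qed
    then show ?thesis by (simp add: matrix_vector_mult_basis column_def vec_eq_iff)
  qed
  have proj: "coord_proj (blk \<mu>) = D ** R \<mu> ** C" if "\<mu> \<in> I" for \<mu>
    by (simp add: RC[OF that] DC flip: matrix_mul_assoc) (simp add: matrix_mul_assoc DC)
  define M where "M = D ** A ** C"
  have pevM: "pev M q = D ** pev A q ** C" for q
    unfolding M_def by (rule pev_conj[OF CD DC])
  \<comment> \<open>Only labels that occur are used: the polynomial merely annihilates
    \<open>A\<close>, so some roots in \<open>I\<close> may have a zero component, whereas the
    classes of a partition are nonempty.\<close>
  define P where "P = blk ` range m"
  have part: "partition_on UNIV P"
    by (rule partition_onI) (auto simp: P_def blk_def disjnt_def)
  show ?thesis
  proof (rule that[OF CD DC part])
    fix B assume "B \<in> P"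
    then obtain i where B: "B = blk (m i)" by (auto simp: P_def)
    have p: "coord_proj B = pev M (f (m i))"
      unfolding B pevM by (simp add: proj[OF m(1)] R_def)
    show "coord_proj B ** Y = Y ** coord_proj B" if "(D ** A ** C) ** Y = Y ** (D ** A ** C)" for Y
      unfolding p by (rule pev_commute) (use that in \<open>simp add: M_def\<close>)
    have "block_eigenvalues B M = {m i, cnj (m i)}"
    proof (rule block_eigenvalues_min_real_poly)
      show "M ** coord_proj B = coord_proj B ** M" unfolding p by (rule pev_commute[symmetric]) simp
      show "B \<noteq> {}" by (auto simp: B blk_def)
      have "D ** pev A (c (m i)) ** C ** (D ** R (m i) ** C) = D ** (pev A (c (m i)) ** (C ** D) ** R (m i)) ** C"
        by (simp add: matrix_mul_assoc)
      then show "pev M (min_real_poly (m i) ^ N) ** coord_proj B = 0"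
        unfolding B by (simp add: proj[OF m(1)] pevM CD cR[OF m(1)] flip: c_def)
    qed
    then show "\<exists>\<mu>. block_eigenvalues B (D ** A ** C) = {\<mu>, cnj \<mu>}" by (auto simp: M_def)
  qed
qed

section \<open>Spectral projections near a point\<close>

lemma separates_conj:
  fixes A T P Q S S' :: "real ^ 'n ^ 'n"
  assumes "separates A P" and S: "S ** S' = mat 1" "S' ** S = mat 1"
    and T: "T ** S = S ** A" and Q: "Q ** S = S ** P"
  shows "separates T Q"
  unfolding separates_def
proof (intro allI impI)
  fix Y assume Y: "Q ** Y = Y" "Y ** Q = 0" "T ** Y = Y ** T"
  define Z where "Z = S' ** Y ** S"
  have inj: "M = N" if "S ** M = S ** N" for M N :: "real ^ 'n ^ 'n"
    using that S(2) by (metis matrix_mul_assoc matrix_mul_lid)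
  have SZ: "S ** Z = Y ** S" by (simp add: Z_def matrix_mul_assoc S)
  have "P ** Z = Z" by (rule inj) (metis Q SZ Y(1) matrix_mul_assoc)
  moreover have "Z ** P = 0"
  proof (rule inj)
    have "S ** (Z ** P) = Y ** Q ** S" by (metis SZ Q matrix_mul_assoc)
    then show "S ** (Z ** P) = S ** 0" by (simp add: Y)
  qed
  moreover have "A ** Z = Z ** A" by (rule inj) (metis T SZ Y(3) matrix_mul_assoc)
  ultimately have "Z = 0" using assms(1) by (auto simp: separates_def)
  then have "Y ** S ** S' = 0" using SZ by simp
  then show "Y = 0" by (simp add: matrix_mul_assoc[symmetric] S)
qed

text \<open>The condition is injectivity of the linear map \<open>\<Lambda>\<close>, which is
  therefore bounded below by some \<open>c\<close>. Passing from \<open>A\<close> to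
  \<open>D\<close> costs at most \<open>2 * K * norm (D - A)\<close> with \<open>K\<close> a bound
  for the matrix product; hence the radius.\<close>

lemma separates_open:
  fixes A E :: "real ^ 'n ^ 'n"
  assumes "separates A E"
  obtains e where "e > 0" "\<And>D. norm (D - A) < e \<Longrightarrow> separates D E"
proof -
  define \<Lambda> where "\<Lambda> Y = (A ** Y - Y ** A, E ** Y - Y, Y ** E)" for Y :: "real ^ 'n ^ 'n"
  note bl = bounded_bilinear.bounded_linear_right[OF bounded_bilinear_matrix_mult]
    bounded_bilinear.bounded_linear_left[OF bounded_bilinear_matrix_mult]
  have lin: "linear \<Lambda>"
    unfolding \<Lambda>_def
    by (intro bounded_linear.linear bounded_linear_Pair bounded_linear_sub bl bounded_linear_ident)
  have "inj \<Lambda>"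
    unfolding linear_injective_0[OF lin] using assms by (auto simp: \<Lambda>_def separates_def zero_prod_def)
  then obtain c where c: "c > 0" "\<And>Y. c * norm Y \<le> norm (\<Lambda> Y)"
    using linear_inj_bounded_below_pos[OF lin] by blast
  obtain K where K: "K > 0" "\<And>(M :: real ^ 'n ^ 'n) (N :: real ^ 'n ^ 'n). norm (M ** N) \<le> norm M * norm N * K"
    using bounded_bilinear.pos_bounded[OF bounded_bilinear_matrix_mult] by blast
  show ?thesis
  proof (rule that[of "c / (2 * K)"])
    fix D assume D: "norm (D - A) < c / (2 * K)"
    show "separates D E"
      unfolding separates_def
    proof (intro allI impI)
      fix Y assume Y: "E ** Y = Y" "Y ** E = 0" "D ** Y = Y ** D"
      have "A ** Y - Y ** A = Y ** (D - A) - (D - A) ** Y"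
        by (simp add: matrix_mult_diff_left matrix_mult_diff_right Y(3))
      then have "norm (\<Lambda> Y) = norm (Y ** (D - A) - (D - A) ** Y)"
        by (simp add: \<Lambda>_def Y norm_Pair)
      also have "\<dots> \<le> norm (Y ** (D - A)) + norm ((D - A) ** Y)" by (rule norm_triangle_ineq4)
      also have "\<dots> \<le> 2 * K * norm (D - A) * norm Y"
        using K(2)[of Y "D - A"] K(2)[of "D - A" Y] by (simp add: mult_ac)
      finally have "(c - 2 * K * norm (D - A)) * norm Y \<le> 0"
        using c(2)[of Y] by (simp add: algebra_simps)
      moreover have "c - 2 * K * norm (D - A) > 0" using D K(1) by (simp add: field_simps)
      ultimately show "Y = 0" by (simp add: mult_le_0_iff)
    qed
  qed (use c K in auto)
qed

lemma sum_matrix_mult_right: "(\<Sum>i\<in>I. f i) ** M = (\<Sum>i\<in>I. f i ** M)" for M :: "real ^ 'n ^ 'n"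
  by (rule bounded_bilinear.sum_left[OF bounded_bilinear_matrix_mult])

lemma sum_matrix_mult_left: "M ** (\<Sum>i\<in>I. f i) = (\<Sum>i\<in>I. M ** f i)" for M :: "real ^ 'n ^ 'n"
  by (rule bounded_bilinear.sum_right[OF bounded_bilinear_matrix_mult])

lemma sum_matrix_vector_mult: "(\<Sum>i\<in>I. f i) *v v = (\<Sum>i\<in>I. f i *v v)" for v :: "real ^ 'n"
  by (rule bounded_bilinear.sum_left[OF bounded_bilinear_matrix_vector_mult])

lemma coord_proj_disjoint: "B \<inter> B' = {} \<Longrightarrow> coord_proj B ** coord_proj B' = 0"
  by (auto simp: coord_proj_mult vec_eq_iff) (auto simp: coord_proj_def)

lemma sum_coord_proj:
  assumes "partition_on (UNIV :: 'n::finite set) P"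
  shows "(\<Sum>B\<in>P. coord_proj B) = mat 1"
proof -
  have "(\<Sum>B\<in>P. coord_proj B $ i $ j) = (mat 1 :: real ^ 'n ^ 'n) $ i $ j" for i j
  proof -
    obtain C where C: "C \<in> P" "i \<in> C" using partition_onD1[OF assms] by blast
    have "i \<in> B \<longleftrightarrow> B = C" if "B \<in> P" for B
      using assms C that by (auto simp: partition_on_def disjoint_def)
    then have "(\<Sum>B\<in>P. coord_proj B $ i $ j) = (\<Sum>B\<in>P. if B = C then mat 1 $ i $ j else (0 :: real))"
      by (intro sum.cong) (auto simp: coord_proj_def mat_def)
    then show ?thesis using C(1) by simp
  qed
  then show ?thesis by (simp add: vec_eq_iff)
qed

text \<open>Writing matrices as \<open>M = dg M + off M\<close> with block diagonal part \<open>dg M\<close>, the equation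
  \<open>(1 + off M) dg M = A x (1 + off M)\<close> is solved for \<open>M\<close> near \<open>A x0\<close> by the inverse function
  theorem. Conjugation with \<open>1 + off M\<close> then makes \<open>A x\<close> block diagonal.\<close>

lemma block_diagonalisation:
  fixes A :: "real ^ 'n \<Rightarrow> real ^ 'n ^ 'n"
  assumes V: "open V" "x0 \<in> V" and A: "smooth_on V A" and P: "partition_on (UNIV :: 'n set) P"
    and comm: "\<And>B Y. B \<in> P \<Longrightarrow> A x0 ** Y = Y ** A x0 \<Longrightarrow> coord_proj B ** Y = Y ** coord_proj B"
  obtains V' S D where "open V'" "x0 \<in> V'" "V' \<subseteq> V" "smooth_on V' S" "smooth_on V' D" "S x0 = mat 1" "D x0 = A x0"
    "\<And>x. x \<in> V' \<Longrightarrow> A x ** S x = S x ** D x"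
    "\<And>x B. x \<in> V' \<Longrightarrow> B \<in> P \<Longrightarrow> coord_proj B ** D x = D x ** coord_proj B"
proof -
  have finP: "finite P" using P by (intro finite_elements) auto
  have disj: "coord_proj B ** coord_proj B' = 0" if "B \<in> P" "B' \<in> P" "B \<noteq> B'" for B B'
    using P that by (intro coord_proj_disjoint) (auto simp: partition_on_def disjoint_def)
  define dg where "dg M = (\<Sum>B\<in>P. coord_proj B ** M ** coord_proj B)" for M :: "real ^ 'n ^ 'n"
  define off where "off M = M - dg M" for M
  have bl: "bounded_linear dg"
    unfolding dg_def
    by (intro bounded_linear_sum bounded_linear_compose[OF
          bounded_bilinear.bounded_linear_left[OF bounded_bilinear_matrix_mult]
          bounded_bilinear.bounded_linear_right[OF bounded_bilinear_matrix_mult]])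
  have blo: "bounded_linear off"
    unfolding off_def by (intro bounded_linear_sub bl bounded_linear_ident)
  have dgE: "coord_proj B ** dg M = dg M ** coord_proj B" if "B \<in> P" for B M
  proof -
    have "coord_proj B ** dg M = (\<Sum>B'\<in>P. if B' = B then coord_proj B ** M ** coord_proj B else 0)"
      unfolding dg_def sum_matrix_mult_left using disj[OF that]
      by (intro sum.cong) (auto simp: matrix_mul_assoc coord_proj_idem)
    moreover have "dg M ** coord_proj B = (\<Sum>B'\<in>P. if B' = B then coord_proj B ** M ** coord_proj B else 0)"
      unfolding dg_def sum_matrix_mult_right using disj[OF _ that]
      by (intro sum.cong) (auto simp: matrix_mul_assoc[symmetric] coord_proj_idem)
    ultimately show ?thesis by simp
  qed
  have dg_mult: "dg (M ** N) = dg M ** N" "dg (N ** M) = N ** dg M"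
    if "\<And>B. B \<in> P \<Longrightarrow> coord_proj B ** N = N ** coord_proj B" for M N
  proof -
    show "dg (M ** N) = dg M ** N"
      unfolding dg_def sum_matrix_mult_right
      by (intro sum.cong refl) (metis that matrix_mul_assoc)
    show "dg (N ** M) = N ** dg M"
      unfolding dg_def sum_matrix_mult_left
      by (intro sum.cong refl) (metis that matrix_mul_assoc)
  qed
  have dg1: "dg (mat 1) = mat 1"
    by (simp add: dg_def coord_proj_idem sum_coord_proj[OF P])
  have dg_id: "dg N = N" if "\<And>B. B \<in> P \<Longrightarrow> coord_proj B ** N = N ** coord_proj B" for N
    using dg_mult(2)[OF that, of "mat 1"] by (simp add: dg1)
  have dgdg: "dg (dg M) = dg M" for M by (rule dg_id[OF dgE])
  have dgoff: "dg (off M) = 0" for M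
    by (simp add: off_def linear_diff[OF bounded_linear.linear[OF bl]] dgdg)
  define A0 where "A0 = A x0"
  have A0: "coord_proj B ** A0 = A0 ** coord_proj B" if "B \<in> P" for B
    using comm[OF that] by (simp add: A0_def)
  have off0: "off A0 = 0" and dg0: "dg A0 = A0" by (simp_all add: off_def dg_id[OF A0])
  \<comment> \<open>The second component records the matrix to be block diagonalised, so an equation
    with a parameter becomes a local inversion problem at \<open>(A0, A0)\<close>.\<close>
  define F where "F p = ((mat 1 + off (fst p)) ** dg (fst p) - snd p ** (mat 1 + off (fst p)), snd p)"
    for p :: "(real ^ 'n ^ 'n) \<times> (real ^ 'n ^ 'n)"
  have sF: "smooth_on UNIV F"
  proof -
    note bll = smooth_on_linear[OF open_UNIV bounded_linear_compose[OF _ bounded_linear_fst]]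
    have so: "smooth_on UNIV (\<lambda>p. mat 1 + off (fst p))" for p :: "(real ^ 'n ^ 'n) \<times> (real ^ 'n ^ 'n)"
      by (intro smooth_on_add smooth_on_const bll blo open_UNIV)
    have 1: "smooth_on UNIV (\<lambda>p. (mat 1 + off (fst p)) ** dg (fst p) - snd p ** (mat 1 + off (fst p)))"
      by (intro smooth_on_diff smooth_on_matrix_mult so bll bl smooth_on_linear[OF _ bounded_linear_snd] open_UNIV)
    have "bounded_linear (\<lambda>u. (u, 0))" "bounded_linear (\<lambda>u. (0, u))"
      by (intro bounded_linear_Pair bounded_linear_ident bounded_linear_zero)+
    from smooth_on_add[OF open_UNIV smooth_on_bounded_linear[OF open_UNIV this(1) 1]
        smooth_on_bounded_linear[OF open_UNIV this(2) smooth_on_linear[OF open_UNIV bounded_linear_snd]]]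
    show ?thesis by (simp add: F_def[abs_def])
  qed
  have dF: "(F has_derivative (\<lambda>h. (off (fst h) ** A0 + dg (fst h) - snd h - A0 ** off (fst h), snd h))) (at (A0, A0))"
  proof -
    have d1: "((\<lambda>p. mat 1 + off (fst p)) has_derivative (\<lambda>h. off (fst h))) (at (A0, A0))"
      by (auto intro!: derivative_eq_intros bounded_linear_imp_has_derivative bounded_linear_compose[OF blo bounded_linear_fst])
    have d2: "((\<lambda>p. dg (fst p)) has_derivative (\<lambda>h. dg (fst h))) (at (A0, A0))"
      by (intro bounded_linear_imp_has_derivative bounded_linear_compose[OF bl bounded_linear_fst])
    have d3: "(snd has_derivative snd) (at (A0, A0))"
      by (intro bounded_linear_imp_has_derivative bounded_linear_snd)
    from has_derivative_Pair[OF has_derivative_diff[OF bounded_bilinear.FDERIV[OF bounded_bilinear_matrix_mult d1 d2]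
          bounded_bilinear.FDERIV[OF bounded_bilinear_matrix_mult d3 d1]] d3]
    show ?thesis unfolding F_def by (rule has_derivative_eq_rhs) (simp add: off0 dg0 fun_eq_iff)
  qed
  \<comment> \<open>Applying \<open>dg\<close> shows that a kernel vector has no block diagonal
    part. Its remaining part commutes with \<open>A0\<close>, hence is block diagonal by
    \<open>comm\<close>, and being off-diagonal it vanishes.\<close>
  have injF: "inj (frechet_derivative F (at (A0, A0)))"
    unfolding frechet_derivative_at[OF dF, symmetric] linear_injective_0[OF has_derivative_linear[OF dF]]
  proof (intro allI impI)
    fix h assume "(off (fst h) ** A0 + dg (fst h) - snd h - A0 ** off (fst h), snd h) = 0"
    then have h2: "snd h = 0" and eq: "off (fst h) ** A0 + dg (fst h) - A0 ** off (fst h) = 0"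
      by (auto simp: zero_prod_def)
    note lin = bounded_linear.linear[OF bl]
    have "dg (off (fst h) ** A0 + dg (fst h) - A0 ** off (fst h)) = dg (fst h)"
      by (simp add: linear_diff[OF lin] linear_add[OF lin] dg_mult[OF A0] dgoff dgdg)
    then have d: "dg (fst h) = 0" using eq by (simp add: linear_0[OF lin])
    then have "A0 ** off (fst h) = off (fst h) ** A0" using eq by simp
    then have "dg (off (fst h)) = off (fst h)" by (intro dg_id comm) (simp_all add: A0_def)
    then have "fst h = 0" using d by (simp add: dgoff off_def)
    then show "h = 0" using h2 by (simp add: prod_eq_iff)
  qed
  obtain U' W g where U': "(A0, A0) \<in> U'" and W: "open W"
    and hom: "homeomorphism U' W F g" and sg: "smooth_on W g"
    using smooth_inverse_function_theorem[OF open_UNIV UNIV_I sF injF] by metis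
  have F0: "F (A0, A0) = (0, A0)" by (simp add: F_def off0 dg0)
  have gF: "g (F q) = q" if "q \<in> U'" for q using hom that by (auto simp: homeomorphism_def)
  have Fg: "F (g q) = q" if "q \<in> W" for q using hom that by (auto simp: homeomorphism_def)
  have W0: "(0, A0) \<in> W" using homeomorphism_image1[OF hom] U' F0 by (metis image_eqI)
  define V' where "V' = V \<inter> (\<lambda>x. (0, A x)) -` W"
  have sp: "smooth_on V (\<lambda>x. (0 :: real ^ 'n ^ 'n, A x))"
    using smooth_on_bounded_linear[OF V(1) bounded_linear_Pair[OF bounded_linear_zero bounded_linear_ident] A] by simp
  have V': "open V'" "x0 \<in> V'" "V' \<subseteq> V"
    unfolding V'_def using continuous_open_preimage[OF smooth_on_imp_continuous_on[OF sp] V(1) W] W0 V(2)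
    by (auto simp: A0_def)
  define M where "M x = fst (g (0, A x))" for x
  have sM: "smooth_on V' M"
    unfolding M_def
    by (intro smooth_on_bounded_linear[OF V'(1) bounded_linear_fst]
        smooth_on_compose[OF V'(1) smooth_on_subset[OF sp V'(3)] sg]) (auto simp: V'_def)
  have M0: "M x0 = A0" using gF[OF U'] by (simp add: M_def F0 A0_def[symmetric])
  show ?thesis
  proof (rule that[OF V', of "\<lambda>x. mat 1 + off (M x)" "\<lambda>x. dg (M x)"])
    show "smooth_on V' (\<lambda>x. mat 1 + off (M x))"
      by (intro smooth_on_add smooth_on_const smooth_on_bounded_linear[OF _ blo] sM V'(1))
    show "smooth_on V' (\<lambda>x. dg (M x))"
      by (intro smooth_on_bounded_linear[OF _ bl] sM V'(1))
    show "mat 1 + off (M x0) = mat 1" by (simp add: M0 off0)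
    show "dg (M x0) = A x0" by (simp add: M0 dg0) (simp add: A0_def)
    show "A x ** (mat 1 + off (M x)) = (mat 1 + off (M x)) ** dg (M x)" if "x \<in> V'" for x
    proof -
      have "F (g (0, A x)) = (0, A x)" using that by (intro Fg) (auto simp: V'_def)
      then show ?thesis by (auto simp: F_def M_def)
    qed
    show "coord_proj B ** dg (M x) = dg (M x) ** coord_proj B" if "B \<in> P" for x B by (rule dgE[OF that])
  qed
qed

text \<open>Coordinate projections conjugated back by the block diagonalising matrices vary smoothly
  and commute with \<open>A\<close>. Separation holds at \<open>x0\<close>, persists for nearby
  block diagonal forms because it is open, and is invariant under conjugation.\<close>

lemma spectral_projections:
  fixes A :: "real ^ 'n \<Rightarrow> real ^ 'n ^ 'n"
  assumes V: "open V" "x0 \<in> V" and A: "smooth_on V A" and P: "partition_on (UNIV :: 'n set) P"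
    and comm: "\<And>B Y. B \<in> P \<Longrightarrow> A x0 ** Y = Y ** A x0 \<Longrightarrow> coord_proj B ** Y = Y ** coord_proj B"
  obtains V' R where "open V'" "x0 \<in> V'" "V' \<subseteq> V"
    "\<And>B. smooth_on V' (R B)" "\<And>B. R B x0 = coord_proj B"
    "\<And>B x. x \<in> V' \<Longrightarrow> R B x ** R B x = R B x"
    "\<And>B B' x. x \<in> V' \<Longrightarrow> B \<in> P \<Longrightarrow> B' \<in> P \<Longrightarrow> B \<noteq> B' \<Longrightarrow> R B x ** R B' x = 0"
    "\<And>B x. x \<in> V' \<Longrightarrow> B \<in> P \<Longrightarrow> A x ** R B x = R B x ** A x"
    "\<And>B x. x \<in> V' \<Longrightarrow> B \<in> P \<Longrightarrow> separates (A x) (R B x)"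
proof -
  obtain V1 S D where V1: "open V1" "x0 \<in> V1" "V1 \<subseteq> V" and S: "smooth_on V1 S" and D: "smooth_on V1 D"
    and S0: "S x0 = mat 1" and D0: "D x0 = A x0"
    and AS: "\<And>x. x \<in> V1 \<Longrightarrow> A x ** S x = S x ** D x"
    and DE: "\<And>x B. x \<in> V1 \<Longrightarrow> B \<in> P \<Longrightarrow> coord_proj B ** D x = D x ** coord_proj B"
    by (rule block_diagonalisation[OF V A P comm], assumption+, rule that)
  have finP: "finite P" using P by (intro finite_elements) auto
  \<comment> \<open>A matrix \<open>Y\<close> satisfying the equations of \<open>separates\<close>
    commutes with the projection \<open>E\<close> by \<open>comm\<close>, whence
    \<open>Y = E ** Y = Y ** E = 0\<close>.\<close>
  have sep0: "separates (A x0) (coord_proj B)" if "B \<in> P" for B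
    unfolding separates_def using comm[OF that] by (metis coord_proj_idem matrix_mul_assoc)
  then have "\<exists>e>0. \<forall>D. norm (D - A x0) < e \<longrightarrow> separates D (coord_proj B)" if "B \<in> P" for B
    using separates_open[OF sep0[OF that]] by metis
  then obtain e where e: "\<And>B. B \<in> P \<Longrightarrow> e B > 0"
    "\<And>B D. B \<in> P \<Longrightarrow> norm (D - A x0) < e B \<Longrightarrow> separates D (coord_proj B)" by metis
  define U where "U = {x \<in> V1. invertible (S x)}"
  define V' where "V' = U \<inter> (\<Inter>B\<in>P. V1 \<inter> D -` ball (A x0) (e B))"
  have "open U" unfolding U_def by (rule open_invertible[OF V1(1) smooth_on_imp_continuous_on[OF S]])
  moreover have "open (V1 \<inter> D -` ball (A x0) (e B))" for B
    by (rule continuous_open_preimage[OF smooth_on_imp_continuous_on[OF D] V1(1) open_ball])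
  ultimately have V': "open V'" unfolding V'_def using finP by (intro open_Int open_INT) auto
  have x0: "x0 \<in> V'" using V1(2) S0 D0 e(1) by (auto simp: V'_def U_def invertible_def)
  have V'1: "V' \<subseteq> V1" by (auto simp: V'_def U_def)
  have inv: "invertible (S x)" if "x \<in> V'" for x using that by (auto simp: V'_def U_def)
  define R where "R B x = S x ** coord_proj B ** matrix_inv (S x)" for B x
  have SS: "S x ** matrix_inv (S x) = mat 1" "matrix_inv (S x) ** S x = mat 1" if "x \<in> V'" for x
    using matrix_inv_left[OF inv[OF that]] matrix_inv_right[OF inv[OF that]] by auto
  have RS: "R B x ** S x = S x ** coord_proj B" if "x \<in> V'" for B x
    by (simp add: R_def matrix_mul_assoc[symmetric] SS[OF that])
  have cancel: "M = N" if "x \<in> V'" "M ** S x = N ** S x" for x and M N :: "real ^ 'n ^ 'n"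
    using that SS(1)[OF that(1)] by (metis matrix_mul_assoc matrix_mul_rid)
  have ASx: "A x ** S x = S x ** D x" if "x \<in> V'" for x using AS V'1 that by auto
  show ?thesis
  proof (rule that[OF V' x0, of R])
    show "V' \<subseteq> V" using V'1 V1(3) by auto
    show "smooth_on V' (R B)" for B
      unfolding R_def[abs_def] using inv
      by (intro smooth_on_matrix_mult smooth_on_matrix_inv smooth_on_const smooth_on_subset[OF S V'1] V') auto
    show "R B x0 = coord_proj B" for B using RS[OF x0] by (simp add: S0)
    show "R B x ** R B x = R B x" if x: "x \<in> V'" for B x
    proof (rule cancel[OF x])
      show "R B x ** R B x ** S x = R B x ** S x"
        by (metis RS[OF x] coord_proj_idem matrix_mul_assoc)
    qed
    show "R B x ** R B' x = 0" if x: "x \<in> V'" and B: "B \<in> P" "B' \<in> P" "B \<noteq> B'" for B B' x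
    proof (rule cancel[OF x])
      have "coord_proj B ** coord_proj B' = 0"
        using P B by (intro coord_proj_disjoint) (auto simp: partition_on_def disjoint_def)
      moreover have "R B x ** R B' x ** S x = S x ** (coord_proj B ** coord_proj B')"
        by (metis RS[OF x] matrix_mul_assoc)
      ultimately show "R B x ** R B' x ** S x = 0 ** S x" by simp
    qed
    show "A x ** R B x = R B x ** A x" if x: "x \<in> V'" and B: "B \<in> P" for B x
    proof (rule cancel[OF x])
      have "coord_proj B ** D x = D x ** coord_proj B" using DE x V'1 B by auto
      then show "A x ** R B x ** S x = R B x ** A x ** S x"
        by (metis RS[OF x] ASx[OF x] matrix_mul_assoc)
    qed
    show "separates (A x) (R B x)" if x: "x \<in> V'" and B: "B \<in> P" for B x
    proof (rule separates_conj[OF _ SS[OF x] ASx[OF x] RS[OF x]])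
      have "D x \<in> ball (A x0) (e B)" using x B unfolding V'_def by blast
      then show "separates (D x) (coord_proj B)"
        by (intro e(2)[OF B]) (simp add: dist_norm norm_minus_commute)
    qed
  qed
qed

section \<open>Block-diagonalising coordinates\<close>

lemma torsion_free_wrt_subset: "torsion_free_wrt B m V A \<Longrightarrow> W \<subseteq> V \<Longrightarrow> torsion_free_wrt B m W A"
  unfolding torsion_free_wrt_def by blast

text \<open>The first integrals belonging to all the spectral projections are added up to one chart,
  whose differential carries spectral projections to coordinate projections. In the last clause
  \<open>T\<close> is the operator in the new chart, known only through its transformation
  law.\<close>

theorem block_diagonal_coordinates:
  fixes A :: "real ^ 'n \<Rightarrow> real ^ 'n ^ 'n"
  assumes V: "open V" "x0 \<in> V" and A: "smooth_on V A" and tf: "torsion_free_wrt UNIV m V A"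
    and P: "partition_on (UNIV :: 'n set) P"
    and comm: "\<And>B Y. B \<in> P \<Longrightarrow> A x0 ** Y = Y ** A x0 \<Longrightarrow> coord_proj B ** Y = Y ** coord_proj B"
  obtains W W' \<psi> g where "open W" "x0 \<in> W" "W \<subseteq> V" "open W'" "homeomorphism W W' \<psi> g"
    "smooth_on W \<psi>" "smooth_on W' g" "frechet_derivative \<psi> (at x0) = (\<lambda>v. v)"
    "\<And>x B T. x \<in> W \<Longrightarrow> B \<in> P \<Longrightarrow>
      T ** matrix (frechet_derivative \<psi> (at x)) = matrix (frechet_derivative \<psi> (at x)) ** A x \<Longrightarrow>
      T ** coord_proj B = coord_proj B ** T \<and> separates T (coord_proj B)"
proof -
  have finP: "finite P" using P by (intro finite_elements) auto
  obtain V1 R where V1: "open V1" "x0 \<in> V1" "V1 \<subseteq> V"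
    and sR: "\<And>B. smooth_on V1 (R B)" and R0: "\<And>B. R B x0 = coord_proj B"
    and RR: "\<And>B x. x \<in> V1 \<Longrightarrow> R B x ** R B x = R B x"
    and RR': "\<And>B B' x. x \<in> V1 \<Longrightarrow> B \<in> P \<Longrightarrow> B' \<in> P \<Longrightarrow> B \<noteq> B' \<Longrightarrow> R B x ** R B' x = 0"
    and AR: "\<And>B x. x \<in> V1 \<Longrightarrow> B \<in> P \<Longrightarrow> A x ** R B x = R B x ** A x"
    and sep: "\<And>B x. x \<in> V1 \<Longrightarrow> B \<in> P \<Longrightarrow> separates (A x) (R B x)"
    by (rule spectral_projections[OF V A P comm], assumption+, rule that)
  define first_integral where "first_integral B U f \<longleftrightarrow> open U \<and> x0 \<in> U \<and> U \<subseteq> V1 \<and> smooth_on U f \<and>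
      (\<forall>x\<in>U. coord_proj B *v f x = f x) \<and>
      (\<forall>x\<in>U. \<forall>v. R B x *v v = 0 \<longrightarrow> frechet_derivative f (at x) v = 0) \<and>
      frechet_derivative f (at x0) = (*v) (coord_proj B)" for B U f
  have "\<exists>U f. first_integral B U f" if B: "B \<in> P" for B
  proof -
    have inv: "R B x *v (derivative_blinfun (R B) x v *v w) = R B x *v (derivative_blinfun (R B) x w *v v)"
      if "x \<in> V1" "R B x *v v = 0" "R B x *v w = 0" for x v w
      by (rule torsion_free_imp_involutive[OF V1(1) smooth_on_subset[OF A V1(3)] sR RR AR[OF _ B] sep[OF _ B]
            torsion_free_wrt_subset[OF tf V1(3)] that])
    show ?thesis
    proof (rule frobenius_first_integral[OF V1(1,2) sR[of B] RR[of _ B] inv], assumption+)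
      fix U f
      assume "open U" "x0 \<in> U" "U \<subseteq> V1" "smooth_on U f" "\<And>x. x \<in> U \<Longrightarrow> R B x0 *v f x = f x"
        "\<And>x v. x \<in> U \<Longrightarrow> R B x *v v = 0 \<Longrightarrow> frechet_derivative f (at x) v = 0"
        "frechet_derivative f (at x0) = (*v) (R B x0)"
      then show ?thesis unfolding R0 first_integral_def by (intro exI[of _ U] exI[of _ f]) blast
    qed
  qed
  then obtain U f where "\<And>B. B \<in> P \<Longrightarrow> first_integral B (U B) (f B)" by metis
  then have U: "\<And>B. B \<in> P \<Longrightarrow> open (U B)" "\<And>B. B \<in> P \<Longrightarrow> x0 \<in> U B" "\<And>B. B \<in> P \<Longrightarrow> U B \<subseteq> V1"
    and sf: "\<And>B. B \<in> P \<Longrightarrow> smooth_on (U B) (f B)"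
    and Ef: "\<And>B x. B \<in> P \<Longrightarrow> x \<in> U B \<Longrightarrow> coord_proj B *v f B x = f B x"
    and Df0: "\<And>B x v. B \<in> P \<Longrightarrow> x \<in> U B \<Longrightarrow> R B x *v v = 0 \<Longrightarrow> frechet_derivative (f B) (at x) v = 0"
    and Dfx0: "\<And>B. B \<in> P \<Longrightarrow> frechet_derivative (f B) (at x0) = (*v) (coord_proj B)"
    unfolding first_integral_def by blast+
  define W0 where "W0 = V1 \<inter> (\<Inter>B\<in>P. U B)"
  have W0: "open W0" "x0 \<in> W0" using U V1 finP by (auto simp: W0_def intro!: open_Int open_INT)
  have W0U: "W0 \<subseteq> U B" if "B \<in> P" for B using that by (auto simp: W0_def)
  \<comment> \<open>Each \<open>f B\<close> takes values in the coordinate subspace of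
    \<open>B\<close>, so the sum merely juxtaposes them; at \<open>x0\<close> the differentials add
    up to the identity.\<close>
  define \<psi> where "\<psi> x = (\<Sum>B\<in>P. f B x)" for x
  have s\<psi>: "smooth_on W0 \<psi>"
    unfolding \<psi>_def[abs_def] using sf W0U by (intro smooth_on_sum W0) (auto intro: smooth_on_subset)
  have D\<psi>: "frechet_derivative \<psi> (at x) = (\<lambda>v. \<Sum>B\<in>P. frechet_derivative (f B) (at x) v)" if "x \<in> W0" for x
  proof -
    have "(\<psi> has_derivative (\<lambda>v. \<Sum>B\<in>P. frechet_derivative (f B) (at x) v)) (at x)"
      unfolding \<psi>_def[abs_def] using that W0U by (intro has_derivative_sum smooth_on_has_derivative[OF sf]) auto
    then show ?thesis by (rule frechet_derivative_at[symmetric])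
  qed
  have D\<psi>0: "frechet_derivative \<psi> (at x0) = (\<lambda>v. v)"
    by (simp add: D\<psi>[OF W0(2)] Dfx0 flip: sum_matrix_vector_mult) (simp add: sum_coord_proj[OF P])
  have "inj (frechet_derivative \<psi> (at x0))" by (simp add: D\<psi>0 inj_def)
  from smooth_inverse_function_theorem[OF W0 s\<psi> this]
  obtain W W' g where W: "open W" "W \<subseteq> W0" "x0 \<in> W" and W': "open W'"
    and hom: "homeomorphism W W' \<psi> g" and sg: "smooth_on W' g" by metis
  have lin: "linear (frechet_derivative (f B) (at x))" if "B \<in> P" "x \<in> W" for B x
    using that W(2) W0U by (intro has_derivative_linear[OF smooth_on_has_derivative[OF sf]]) auto
  \<comment> \<open>The vector \<open>R B x *v v\<close> lies in the kernels of the other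
    projections, so only \<open>f B\<close> sees it; in turn \<open>f B\<close> does not see the
    difference \<open>v - R B x *v v\<close>.\<close>
  have JR: "frechet_derivative \<psi> (at x) (R B x *v v) = coord_proj B *v frechet_derivative \<psi> (at x) v"
    if x: "x \<in> W" and B: "B \<in> P" for x B v
  proof -
    have xW0: "x \<in> W0" and xV1: "x \<in> V1" using x W(2) by (auto simp: W0_def)
    have xU: "x \<in> U C" if "C \<in> P" for C using W0U[OF that] xW0 by auto
    have "frechet_derivative \<psi> (at x) (R B x *v v) = (\<Sum>C\<in>P. if C = B then frechet_derivative (f B) (at x) (R B x *v v) else 0)"
      unfolding D\<psi>[OF xW0]
    proof (rule sum.cong)
      fix C assume C: "C \<in> P"
      have "R C x *v (R B x *v v) = 0" if "C \<noteq> B"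
        by (simp add: matrix_vector_mul_assoc RR'[OF xV1 C B that])
      then show "frechet_derivative (f C) (at x) (R B x *v v) =
          (if C = B then frechet_derivative (f B) (at x) (R B x *v v) else 0)"
        using Df0[OF C xU[OF C]] by auto
    qed simp
    also have "\<dots> = frechet_derivative (f B) (at x) (R B x *v v)" using B finP by simp
    also have "\<dots> = frechet_derivative (f B) (at x) v"
    proof -
      have "frechet_derivative (f B) (at x) (v - R B x *v v) = 0"
        by (intro Df0 B xU) (simp add: matrix_vector_mult_diff_distrib matrix_vector_mul_assoc RR[OF xV1])
      then show ?thesis by (simp add: linear_diff[OF lin[OF B x]])
    qed
    also have "\<dots> = (\<Sum>C\<in>P. if C = B then frechet_derivative (f B) (at x) v else 0)" using B finP by simp
    also have "\<dots> = (\<Sum>C\<in>P. coord_proj B *v frechet_derivative (f C) (at x) v)"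
    proof (rule sum.cong)
      fix C assume C: "C \<in> P"
      have "((\<lambda>y. coord_proj C *v f C y) has_derivative (\<lambda>h. coord_proj C *v frechet_derivative (f C) (at x) h)) (at x)"
        by (rule bounded_linear.has_derivative[OF bounded_bilinear.bounded_linear_right[OF bounded_bilinear_matrix_vector_mult]
              smooth_on_has_derivative[OF sf[OF C] xU[OF C]]])
      then have "(f C has_derivative (\<lambda>h. coord_proj C *v frechet_derivative (f C) (at x) h)) (at x)"
        by (rule has_derivative_transform_within_open[OF _ U(1)[OF C] xU[OF C] Ef[OF C]])
      from frechet_derivative_at[OF this]
      have E: "coord_proj C *v frechet_derivative (f C) (at x) v = frechet_derivative (f C) (at x) v"
        by (metis (no_types))
      show "(if C = B then frechet_derivative (f B) (at x) v else 0) = coord_proj B *v frechet_derivative (f C) (at x) v"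
      proof (cases "C = B")
        case True
        then show ?thesis using E by simp
      next
        case False
        then have "coord_proj B ** coord_proj C = 0"
          using P B C by (intro coord_proj_disjoint) (auto simp: partition_on_def disjoint_def)
        then show ?thesis using False by (subst E[symmetric]) (simp add: matrix_vector_mul_assoc)
      qed
    qed simp
    also have "\<dots> = coord_proj B *v frechet_derivative \<psi> (at x) v"
      unfolding D\<psi>[OF xW0]
      by (rule bounded_bilinear.sum_right[OF bounded_bilinear_matrix_vector_mult, symmetric])
    finally show ?thesis .
  qed
  show ?thesis
  proof (rule that[OF W(1,3) _ W' hom _ sg D\<psi>0])
    show "W \<subseteq> V" using W(2) V1(3) by (auto simp: W0_def)
    show "smooth_on W \<psi>" by (rule smooth_on_subset[OF s\<psi> W(2)])
    fix x B T assume x: "x \<in> W" and B: "B \<in> P"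
      and T: "T ** matrix (frechet_derivative \<psi> (at x)) = matrix (frechet_derivative \<psi> (at x)) ** A x"
    define J where "J = matrix (frechet_derivative \<psi> (at x))"
    have xV1: "x \<in> V1" using x W(2) by (auto simp: W0_def)
    have d\<psi>: "(\<psi> has_derivative frechet_derivative \<psi> (at x)) (at x)"
      using x W(2) by (intro smooth_on_has_derivative[OF s\<psi>]) auto
    have Jv: "J *v v = frechet_derivative \<psi> (at x) v" for v
      unfolding J_def using fun_cong[OF matrix_vector_mul(2)[OF has_derivative_linear[OF d\<psi>]]] by simp
    have \<psi>x: "\<psi> x \<in> W'" "g (\<psi> x) = x" using hom x by (auto simp: homeomorphism_def)
    have dg: "(g has_derivative frechet_derivative g (at (\<psi> x))) (at (\<psi> x))"
      by (rule smooth_on_has_derivative[OF sg \<psi>x(1)])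
    define J' where "J' = matrix (frechet_derivative g (at (\<psi> x)))"
    have J'v: "J' *v v = frechet_derivative g (at (\<psi> x)) v" for v
      unfolding J'_def using fun_cong[OF matrix_vector_mul(2)[OF has_derivative_linear[OF dg]]] by simp
    have "((\<lambda>z. g (\<psi> z)) has_derivative (\<lambda>h. h)) (at x)"
      by (rule has_derivative_transform_within_open[OF has_derivative_ident W(1) x])
         (use hom in \<open>auto simp: homeomorphism_def\<close>)
    from has_derivative_unique[OF has_derivative_compose[OF d\<psi> dg] this]
    have J'J: "J' ** J = mat 1"
      by (simp add: matrix_eq matrix_vector_mul_assoc[symmetric] Jv J'v fun_eq_iff)
    then have JJ': "J ** J' = mat 1" using matrix_left_right_inverse by blast
    have EJ: "coord_proj B ** J = J ** R B x"
      by (simp add: matrix_eq matrix_vector_mul_assoc[symmetric] Jv JR[OF x B])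
    have TJ: "T ** J = J ** A x" using T by (simp add: J_def)
    have "T ** coord_proj B ** J = coord_proj B ** T ** J"
      by (metis EJ TJ AR[OF xV1 B] matrix_mul_assoc)
    then have "T ** coord_proj B = coord_proj B ** T"
      using JJ' by (metis matrix_mul_assoc matrix_mul_rid)
    moreover have "separates T (coord_proj B)"
      by (rule separates_conj[OF sep[OF xV1 B] JJ' J'J TJ EJ])
    ultimately show "T ** coord_proj B = coord_proj B ** T \<and> separates T (coord_proj B)" ..
  qed
qed

section \<open>Changing charts\<close>

lemma is_chartD:
  assumes "is_chart X (U, \<phi>)"
  shows "openin X U" "open (\<phi> ` U)" "homeomorphic_map (subtopology X U) (top_of_set (\<phi> ` U)) \<phi>"
    "topspace (subtopology X U) = U" "inj_on \<phi> U"
proof -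
  show *: "openin X U" "open (\<phi> ` U)" "homeomorphic_map (subtopology X U) (top_of_set (\<phi> ` U)) \<phi>"
    using assms by (auto simp: is_chart_def)
  show top: "topspace (subtopology X U) = U" using openin_subset[OF *(1)] by auto
  show "inj_on \<phi> U" using homeomorphic_imp_injective_map[OF *(3)] unfolding top .
qed

lemma is_chart_open_image:
  assumes "is_chart X (U, \<phi>)" "openin X V"
  shows "open (\<phi> ` (U \<inter> V))"
proof -
  note c = is_chartD[OF assms(1)]
  have "openin (subtopology X U) (U \<inter> V)" using assms(2) by (rule openin_subtopology_Int2)
  then have "openin (top_of_set (\<phi> ` U)) (\<phi> ` (U \<inter> V))"
    using homeomorphic_map_openness[OF c(3), of "U \<inter> V"] c(4) by auto
  then show ?thesis using openin_open_trans c(2) by blast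
qed

lemma is_chart_open_preimage:
  assumes "is_chart X (U, \<phi>)" "open W"
  shows "openin X {q \<in> U. \<phi> q \<in> W}"
proof -
  note c = is_chartD[OF assms(1)]
  have "continuous_map (subtopology X U) euclidean \<phi>"
    using homeomorphic_imp_continuous_map[OF c(3)] continuous_map_into_fulltopology by blast
  then have "openin (subtopology X U) {q \<in> topspace (subtopology X U). \<phi> q \<in> W}"
    using assms(2) by (intro openin_continuous_map_preimage) auto
  then show ?thesis unfolding c(4) using openin_trans_full[OF _ c(1)] by blast
qed

lemma homeomorphism_imp_homeomorphic_map:
  assumes "homeomorphism S T f g"
  shows "homeomorphic_map (top_of_set S) (top_of_set T) f"
  unfolding homeomorphic_map_maps homeomorphic_maps_def
  using assms by (intro exI[of _ g]) (auto simp: homeomorphism_def)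

context
  fixes X :: "'a topology" and \<A> :: "('a, 'n::finite) chart set"
    and U0 :: "'a set" and \<phi>0 :: "'a \<Rightarrow> real ^ 'n"
    and W W' :: "(real ^ 'n) set" and \<psi> g :: "real ^ 'n \<Rightarrow> real ^ 'n"
  assumes M: "smooth_manifold X \<A>" and c0: "(U0, \<phi>0) \<in> \<A>"
    and W: "open W" "W \<subseteq> \<phi>0 ` U0" and W': "open W'"
    and hom: "homeomorphism W W' \<psi> g" and s\<psi>: "smooth_on W \<psi>" and sg: "smooth_on W' g"
begin

abbreviation (input) "chart_change_dom \<equiv> {q \<in> U0. \<phi>0 q \<in> W}"

lemma chart_change_image: "(\<psi> \<circ> \<phi>0) ` chart_change_dom = W'"
proof -
  have "\<phi>0 ` chart_change_dom = W" using W(2) by auto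
  then show ?thesis using homeomorphism_image1[OF hom] by (simp only: image_comp[symmetric])
qed

lemma chart_change_is_chart: "is_chart X (chart_change_dom, \<psi> \<circ> \<phi>0)"
proof -
  have ch: "is_chart X (U0, \<phi>0)" using M c0 unfolding smooth_manifold_def by blast
  note c = is_chartD[OF ch]
  have "homeomorphic_map (subtopology (subtopology X U0) chart_change_dom) (subtopology (top_of_set (\<phi>0 ` U0)) W) \<phi>0"
    by (rule homeomorphic_map_subtopologies[OF c(3)]) (use c(4) W(2) in auto)
  moreover have "subtopology (subtopology X U0) chart_change_dom = subtopology X chart_change_dom"
    by (simp add: subtopology_subtopology) (rule arg_cong[of _ _ "subtopology X"], auto)
  moreover have "subtopology (top_of_set (\<phi>0 ` U0)) W = top_of_set W"
    using W(2) by (simp add: subtopology_subtopology inf_absorb2)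
  ultimately have "homeomorphic_map (subtopology X chart_change_dom) (top_of_set W) \<phi>0" by simp
  from homeomorphic_map_compose[OF this homeomorphism_imp_homeomorphic_map[OF hom]]
  show ?thesis
    unfolding is_chart_def prod.case chart_change_image using is_chart_open_preimage[OF ch W(1)] W' by blast
qed

lemma chart_change_compatible:
  assumes d: "d \<in> \<A>"
  shows "compatible (chart_change_dom, \<psi> \<circ> \<phi>0) d"
proof -
  obtain V \<eta> where d': "d = (V, \<eta>)" by (cases d)
  have ch: "is_chart X (U0, \<phi>0)" "is_chart X (V, \<eta>)"
    using M c0 d unfolding smooth_manifold_def d' by blast+
  note inj = is_chartD(5)[OF ch(1)] is_chartD(5)[OF ch(2)] is_chartD(5)[OF chart_change_is_chart]
  note opn = is_chartD(1)[OF ch(2)] is_chartD(1)[OF chart_change_is_chart]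
  have comp: "smooth_on (\<phi>0 ` (U0 \<inter> V)) (transition (U0, \<phi>0) d)"
    "smooth_on (\<eta> ` (U0 \<inter> V)) (transition d (U0, \<phi>0))"
  proof -
    have "compatible (U0, \<phi>0) d" using M c0 d unfolding smooth_manifold_def by blast
    then show "smooth_on (\<phi>0 ` (U0 \<inter> V)) (transition (U0, \<phi>0) d)"
      "smooth_on (\<eta> ` (U0 \<inter> V)) (transition d (U0, \<phi>0))"
      unfolding compatible_def d' by simp_all
  qed
  have gx: "g (\<psi> y) = y" if "y \<in> W" for y using hom that by (auto simp: homeomorphism_def)
  have "smooth_on ((\<psi> \<circ> \<phi>0) ` (chart_change_dom \<inter> V)) (\<lambda>y. transition (U0, \<phi>0) d (g y))"
  proof (rule smooth_on_compose[OF is_chart_open_image[OF chart_change_is_chart opn(1)] _ comp(1)])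
    show "smooth_on ((\<psi> \<circ> \<phi>0) ` (chart_change_dom \<inter> V)) g"
      using chart_change_image by (intro smooth_on_subset[OF sg]) auto
    show "g ` (\<psi> \<circ> \<phi>0) ` (chart_change_dom \<inter> V) \<subseteq> \<phi>0 ` (U0 \<inter> V)" by (auto simp: gx)
  qed
  moreover have "transition (U0, \<phi>0) d (g y) = transition (chart_change_dom, \<psi> \<circ> \<phi>0) d y" if y: "y \<in> (\<psi> \<circ> \<phi>0) ` (chart_change_dom \<inter> V)" for y
  proof -
    obtain q where q: "q \<in> chart_change_dom" "q \<in> V" "y = \<psi> (\<phi>0 q)" using y by auto
    have "inv_into chart_change_dom (\<psi> \<circ> \<phi>0) y = q" using inv_into_f_f[OF inj(3) q(1)] q(3) by simp
    moreover have "inv_into U0 \<phi>0 (g y) = q" using q inv_into_f_f[OF inj(1)] by (simp add: gx)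
    ultimately show ?thesis by (simp add: transition_def)
  qed
  ultimately have 1: "smooth_on ((\<psi> \<circ> \<phi>0) ` (chart_change_dom \<inter> V)) (transition (chart_change_dom, \<psi> \<circ> \<phi>0) d)"
    by (rule smooth_on_cong[OF is_chart_open_image[OF chart_change_is_chart opn(1)], THEN iffD1, rotated])
  have opV: "open (\<eta> ` (chart_change_dom \<inter> V))"
    using is_chart_open_image[OF ch(2) opn(2)] by (simp add: Int_commute)
  have tr: "transition d (U0, \<phi>0) (\<eta> q) = \<phi>0 q" if "q \<in> V" for q
    using inv_into_f_f[OF inj(2) that] by (simp add: transition_def d')
  have "smooth_on (\<eta> ` (chart_change_dom \<inter> V)) (\<lambda>y. \<psi> (transition d (U0, \<phi>0) y))"
  proof (rule smooth_on_compose[OF opV _ s\<psi>])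
    show "smooth_on (\<eta> ` (chart_change_dom \<inter> V)) (transition d (U0, \<phi>0))"
      by (rule smooth_on_subset[OF comp(2)]) auto
    show "transition d (U0, \<phi>0) ` \<eta> ` (chart_change_dom \<inter> V) \<subseteq> W" by (auto simp: tr)
  qed
  moreover have "\<psi> (transition d (U0, \<phi>0) y) = transition d (chart_change_dom, \<psi> \<circ> \<phi>0) y" for y
    by (simp add: transition_def)
  ultimately have 2: "smooth_on (\<eta> ` (chart_change_dom \<inter> V)) (transition d (chart_change_dom, \<psi> \<circ> \<phi>0))" by simp
  show ?thesis using 1 2 by (simp add: compatible_def d')
qed

text \<open>Maximality of the atlas is what admits the new coordinates as a chart.\<close>

lemma chart_change_in_atlas: "(chart_change_dom, \<psi> \<circ> \<phi>0) \<in> \<A>"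
  using M chart_change_is_chart chart_change_compatible unfolding smooth_manifold_def by blast

lemma chart_change_operator:
  assumes L: "operator_field \<A> L" and x: "x \<in> W"
  shows "L (chart_change_dom, \<psi> \<circ> \<phi>0) (\<psi> x) ** matrix (frechet_derivative \<psi> (at x)) =
    matrix (frechet_derivative \<psi> (at x)) ** L (U0, \<phi>0) x"
proof -
  have ch: "is_chart X (U0, \<phi>0)" using M c0 unfolding smooth_manifold_def by blast
  note inj = is_chartD(5)[OF ch]
  have tr: "transition (U0, \<phi>0) (chart_change_dom, \<psi> \<circ> \<phi>0) y = \<psi> y" if "y \<in> W" for y
  proof -
    have "y \<in> \<phi>0 ` U0" using W(2) that by auto
    then show ?thesis by (simp add: transition_def f_inv_into_f)
  qed
  have eq: "frechet_derivative (transition (U0, \<phi>0) (chart_change_dom, \<psi> \<circ> \<phi>0)) (at x) = frechet_derivative \<psi> (at x)"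
    by (rule frechet_derivative_transform_within_open[OF smooth_on_differentiable[OF s\<psi> x] W(1) x, symmetric])
      (rule tr[symmetric])
  obtain q where q: "q \<in> U0" "\<phi>0 q = x" using W(2) x by auto
  then have "q \<in> fst (U0, \<phi>0) \<inter> fst (chart_change_dom, \<psi> \<circ> \<phi>0)" using x by auto
  then have "L (chart_change_dom, \<psi> \<circ> \<phi>0) (snd (chart_change_dom, \<psi> \<circ> \<phi>0) q) ** jacobian (transition (U0, \<phi>0) (chart_change_dom, \<psi> \<circ> \<phi>0)) (at (snd (U0, \<phi>0) q))
     = jacobian (transition (U0, \<phi>0) (chart_change_dom, \<psi> \<circ> \<phi>0)) (at (snd (U0, \<phi>0) q)) ** L (U0, \<phi>0) (snd (U0, \<phi>0) q)"
    using L c0 chart_change_in_atlas unfolding operator_field_def Let_def by blast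
  then show ?thesis using q by (simp add: jacobian_def eq)
qed

end

text \<open>Conjugation by a constant matrix is realised by linear coordinates. It is used to make
  the primary components at \<open>p\<close> coordinate subspaces.\<close>

lemma linear_chart_change:
  fixes C D :: "real ^ 'n ^ 'n" and \<A> :: "('a, 'n::finite) chart set"
  assumes M: "smooth_manifold X \<A>" and L: "operator_field \<A> L" and c0: "(U0, \<phi>0) \<in> \<A>"
    and CD: "C ** D = mat 1" "D ** C = mat 1" and p: "p \<in> U0"
  obtains \<phi> where "(U0, \<phi>) \<in> \<A>" "L (U0, \<phi>) (\<phi> p) = D ** L (U0, \<phi>0) (\<phi>0 p) ** C"
proof -
  have ch: "is_chart X (U0, \<phi>0)" using M c0 unfolding smooth_manifold_def by blast
  note W = is_chartD(2)[OF ch]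
  have CDv: "C *v (D *v v) = v" "D *v (C *v v) = v" for v by (simp_all add: matrix_vector_mul_assoc CD)
  have lin: "bounded_linear ((*v) C)" "bounded_linear ((*v) D)"
    by (rule bounded_bilinear.bounded_linear_right[OF bounded_bilinear_matrix_vector_mult])+
  have "(*v) D ` (\<phi>0 ` U0) = (*v) C -` (\<phi>0 ` U0)" by (auto simp: CDv) (metis CDv(2) imageI)
  then have W': "open ((*v) D ` (\<phi>0 ` U0))"
    using W linear_continuous_on[OF lin(1)] by (simp add: open_vimage)
  have hom: "homeomorphism (\<phi>0 ` U0) ((*v) D ` (\<phi>0 ` U0)) ((*v) D) ((*v) C)"
    using lin by (intro homeomorphismI linear_continuous_on) (auto simp: CDv)
  have sm: "smooth_on (\<phi>0 ` U0) ((*v) D)" "smooth_on ((*v) D ` (\<phi>0 ` U0)) ((*v) C)"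
    using W W' lin by (auto intro: smooth_on_linear)
  have U: "{q \<in> U0. \<phi>0 q \<in> \<phi>0 ` U0} = U0" by auto
  note chart = chart_change_in_atlas[OF M c0 W subset_refl W' hom sm, unfolded U]
    and op = chart_change_operator[OF M c0 W subset_refl W' hom sm L, unfolded U, of "\<phi>0 p"]
  have "matrix (frechet_derivative ((*v) D) (at x)) = D" for x
    using frechet_derivative_at[OF bounded_linear_imp_has_derivative[OF lin(2)]] by (metis matrix_of_matrix_vector_mul)
  then have "L (U0, (*v) D \<circ> \<phi>0) (D *v \<phi>0 p) ** D ** C = D ** L (U0, \<phi>0) (\<phi>0 p) ** C"
    using op p by simp
  then have "L (U0, (*v) D \<circ> \<phi>0) (((*v) D \<circ> \<phi>0) p) = D ** L (U0, \<phi>0) (\<phi>0 p) ** C"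
    by (simp add: CD flip: matrix_mul_assoc)
  then show ?thesis using that chart by blast
qed

section \<open>Block-diagonal operators\<close>

lemma block_diagonalI:
  assumes "partition_on UNIV P" "\<And>B. B \<in> P \<Longrightarrow> T ** coord_proj B = coord_proj B ** T"
  shows "block_diagonal P T"
  unfolding block_diagonal_def
proof (intro allI impI)
  fix a b assume ab: "T $ a $ b \<noteq> 0"
  obtain B where B: "B \<in> P" "a \<in> B" using partition_onD1[OF assms(1)] by blast
  have "(T ** coord_proj B) $ a $ b = (coord_proj B ** T) $ a $ b" using assms(2)[OF B(1)] by simp
  then have "b \<in> B" using ab B(2) by (simp add: coord_proj_mult mult_coord_proj split: if_splits)
  then show "\<exists>B\<in>P. a \<in> B \<and> b \<in> B" using B by blast
qed

text \<open>Compression by a projection is multiplicative as soon as one factor commutes with it, so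
  forming commutators with \<open>T\<close> passes through the compression.\<close>

lemma ad_block:
  assumes "T ** coord_proj B = coord_proj B ** T"
  shows "(ad (block B T) ^^ k) (block B M) = block B ((ad T ^^ k) M)"
proof (induction k)
  case (Suc k)
  define E where "E = coord_proj B"
  define K where "K = (ad T ^^ k) M"
  have TE: "T ** E = E ** T" and EE: "E ** E = E" using assms coord_proj_idem by (auto simp: E_def)
  have "E ** T ** E ** (E ** K ** E) = E ** (T ** K) ** E" "E ** K ** E ** (E ** T ** E) = E ** (K ** T) ** E"
    by (metis TE EE matrix_mul_assoc)+
  then have "ad (block B T) (block B K) = block B (ad T K)"
    by (simp add: ad_def block_eq_coord_proj E_def[symmetric] matrix_mult_diff_left matrix_mult_diff_right)
  moreover have "(ad (block B T) ^^ Suc k) (block B M) = ad (block B T) (block B K)"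
    "(ad T ^^ Suc k) M = ad T K"
    by (simp_all add: Suc K_def)
  ultimately show ?case by simp
qed simp

text \<open>Comparing the predicates \<open>has_derivative\<close>, rather than given derivatives,
  also covers points where no derivative exists, so \<open>torsion_cong\<close> holds for arbitrary
  fields.\<close>

lemma frechet_derivative_cong:
  assumes "open W" "x \<in> W" "\<And>y. y \<in> W \<Longrightarrow> f y = g y"
  shows "frechet_derivative f (at x) = frechet_derivative g (at x)"
proof -
  have "(f has_derivative f') (at x) \<longleftrightarrow> (g has_derivative f') (at x)" for f'
    using has_derivative_transform_within_open[OF _ assms(1,2)] assms(3) by metis
  then show ?thesis by (simp add: frechet_derivative_def)
qed

lemma torsion_cong:
  assumes "open W" "\<And>x. x \<in> W \<Longrightarrow> \<xi> x = \<xi>' x" "\<And>x. x \<in> W \<Longrightarrow> \<eta> x = \<eta>' x" "x \<in> W"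
  shows "torsion k A \<xi> \<eta> x = torsion k A \<xi>' \<eta>' x"
  using assms(2,3)
proof (induction k arbitrary: \<xi> \<xi>' \<eta> \<eta>')
  case 0
  then show ?case
    using frechet_derivative_cong[OF assms(1,4), of \<xi> \<xi>'] frechet_derivative_cong[OF assms(1,4), of \<eta> \<eta>'] assms(4)
    by (simp add: lie_bracket_def)
next
  case (Suc k)
  have "app_op A \<xi> y = app_op A \<xi>' y" "app_op A \<eta> y = app_op A \<eta>' y" if "y \<in> W" for y
    using Suc.prems that by (simp_all add: app_op_def)
  then have "torsion k A \<xi> \<eta> x = torsion k A \<xi>' \<eta>' x"
    "torsion k A (app_op A \<xi>) (app_op A \<eta>) x = torsion k A (app_op A \<xi>') (app_op A \<eta>') x"
    "torsion k A (app_op A \<xi>) \<eta> x = torsion k A (app_op A \<xi>') \<eta>' x"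
    "torsion k A \<xi> (app_op A \<eta>) x = torsion k A \<xi>' (app_op A \<eta>') x"
    using Suc.prems by (intro Suc.IH; simp)+
  then show ?case by (simp add: app_op_def[of A "torsion _ _ _ _"]) (simp add: app_op_def)
qed

text \<open>On fields supported in \<open>B\<close> the block and the full operator agree. The
  second conjunct strengthens the induction: to replace the outer factors \<open>A\<close> by the
  block, the torsion of lower level must itself be supported in \<open>B\<close>.\<close>

lemma torsion_block:
  fixes A :: "real ^ 'n \<Rightarrow> real ^ 'n ^ 'n"
  assumes W: "open W" and A: "smooth_on W A"
    and AE: "\<And>x. x \<in> W \<Longrightarrow> A x ** coord_proj B = coord_proj B ** A x"
    and "smooth_on W \<xi>" "\<And>x. x \<in> W \<Longrightarrow> coord_proj B *v \<xi> x = \<xi> x"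
    and "smooth_on W \<eta>" "\<And>x. x \<in> W \<Longrightarrow> coord_proj B *v \<eta> x = \<eta> x" and x: "x \<in> W"
  shows "torsion k (\<lambda>x. block B (A x)) \<xi> \<eta> x = torsion k A \<xi> \<eta> x \<and>
    coord_proj B *v torsion k A \<xi> \<eta> x = torsion k A \<xi> \<eta> x"
  using assms(4-7)
proof (induction k arbitrary: \<xi> \<eta>)
  case 0
  have "coord_proj B *v frechet_derivative \<zeta> (at x) v = frechet_derivative \<zeta> (at x) v"
    if \<zeta>: "smooth_on W \<zeta>" "\<And>x. x \<in> W \<Longrightarrow> coord_proj B *v \<zeta> x = \<zeta> x" for \<zeta> :: "real ^ 'n \<Rightarrow> real ^ 'n" and v
  proof -
    have "((\<lambda>y. coord_proj B *v \<zeta> y) has_derivative (\<lambda>h. coord_proj B *v frechet_derivative \<zeta> (at x) h)) (at x)"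
      by (rule bounded_linear.has_derivative[OF bounded_bilinear.bounded_linear_right[OF bounded_bilinear_matrix_vector_mult]
            smooth_on_has_derivative[OF \<zeta>(1) x]])
    then have "(\<zeta> has_derivative (\<lambda>h. coord_proj B *v frechet_derivative \<zeta> (at x) h)) (at x)"
      by (rule has_derivative_transform_within_open[OF _ W x \<zeta>(2)])
    from frechet_derivative_at[OF this] show ?thesis by (metis (no_types))
  qed
  then show ?case using 0 by (simp add: lie_bracket_def matrix_vector_mult_diff_distrib)
next
  case (Suc k)
  let ?E = "coord_proj B" and ?b = "\<lambda>x. block B (A x)"
  have cE: "?E *v (A y *v v) = A y *v (?E *v v)" if "y \<in> W" for y v
    using AE[OF that] by (simp add: matrix_vector_mul_assoc)
  have b: "?b y *v v = A y *v v" if "y \<in> W" "?E *v v = v" for y v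
  proof -
    have "?b y *v v = ?E *v (A y *v (?E *v v))"
      by (simp only: block_eq_coord_proj matrix_vector_mul_assoc[symmetric])
    then show ?thesis using that by (simp add: cE)
  qed
  have app: "app_op ?b \<zeta> y = app_op A \<zeta> y" if "y \<in> W" "\<And>x. x \<in> W \<Longrightarrow> ?E *v \<zeta> x = \<zeta> x" for \<zeta> y
    using b that by (simp add: app_op_def)
  have E: "?E *v app_op A \<zeta> y = app_op A \<zeta> y" if "y \<in> W" "\<And>x. x \<in> W \<Longrightarrow> ?E *v \<zeta> x = \<zeta> x" for \<zeta> y
    using that by (simp add: app_op_def cE)
  have s: "smooth_on W (app_op A \<zeta>)" if "smooth_on W \<zeta>" for \<zeta>
    unfolding app_op_def by (rule smooth_on_matrix_vector_mult[OF W A that])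
  note \<xi> = Suc.prems(1,2) and \<eta> = Suc.prems(3,4)
  have ih: "torsion k ?b \<xi> \<eta> x = torsion k A \<xi> \<eta> x" "?E *v torsion k A \<xi> \<eta> x = torsion k A \<xi> \<eta> x"
    using Suc.IH[OF \<xi> \<eta>] by auto
  have c: "torsion k ?b (app_op ?b \<xi>) (app_op ?b \<eta>) x = torsion k ?b (app_op A \<xi>) (app_op A \<eta>) x"
    "torsion k ?b (app_op ?b \<xi>) \<eta> x = torsion k ?b (app_op A \<xi>) \<eta> x"
    "torsion k ?b \<xi> (app_op ?b \<eta>) x = torsion k ?b \<xi> (app_op A \<eta>) x"
    using app[OF _ \<xi>(2)] app[OF _ \<eta>(2)] by (intro torsion_cong[OF W _ _ x]; simp)+
  have ihc: "torsion k ?b (app_op A \<xi>) (app_op A \<eta>) x = torsion k A (app_op A \<xi>) (app_op A \<eta>) x"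
    "?E *v torsion k A (app_op A \<xi>) (app_op A \<eta>) x = torsion k A (app_op A \<xi>) (app_op A \<eta>) x"
    "torsion k ?b (app_op A \<xi>) \<eta> x = torsion k A (app_op A \<xi>) \<eta> x"
    "?E *v torsion k A (app_op A \<xi>) \<eta> x = torsion k A (app_op A \<xi>) \<eta> x"
    "torsion k ?b \<xi> (app_op A \<eta>) x = torsion k A \<xi> (app_op A \<eta>) x"
    "?E *v torsion k A \<xi> (app_op A \<eta>) x = torsion k A \<xi> (app_op A \<eta>) x"
    using Suc.IH[OF s[OF \<xi>(1)] E[OF _ \<xi>(2)] s[OF \<eta>(1)] E[OF _ \<eta>(2)]]
      Suc.IH[OF s[OF \<xi>(1)] E[OF _ \<xi>(2)] \<eta>] Suc.IH[OF \<xi> s[OF \<eta>(1)] E[OF _ \<eta>(2)]] by auto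
  have T: "torsion (Suc k) N \<xi> \<eta> x = N x *v (N x *v torsion k N \<xi> \<eta> x)
      + torsion k N (app_op N \<xi>) (app_op N \<eta>) x
      - N x *v torsion k N (app_op N \<xi>) \<eta> x - N x *v torsion k N \<xi> (app_op N \<eta>) x" for N
    by (simp add: app_op_def)
  have e1: "?E *v (A x *v torsion k A \<xi> \<eta> x) = A x *v torsion k A \<xi> \<eta> x"
    by (simp only: cE[OF x] ih(2))
  show ?case
    unfolding T c ihc(1,3,5) ih(1)
    by (simp only: b[OF x ih(2)] b[OF x ihc(4)] b[OF x ihc(6)] b[OF x e1]
        matrix_vector_right_distrib matrix_vector_mult_diff_distrib cE[OF x] ih(2) ihc(2,4,6))
qed

theorem corollary1p1:
  fixes X :: "'a topology"
    and \<A> :: "('a, 'n::finite) chart set"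
    and L :: "('a, 'n) chart \<Rightarrow> real ^ 'n \<Rightarrow> real ^ 'n ^ 'n"
    and m :: nat and p :: 'a
  assumes "m \<ge> 2"
    and "smooth_manifold X \<A>"
    and "operator_field \<A> L"
    and "torsion_free \<A> m L"
    and "p \<in> topspace X"
  shows "\<exists>U \<phi> P. (U, \<phi>) \<in> \<A> \<and> p \<in> U \<and> partition_on (UNIV :: 'n set) P \<and>
     (\<forall>x \<in> \<phi> ` U. block_diagonal P (L (U, \<phi>) x)) \<and>
     (\<forall>B\<in>P.
        ((\<exists>r :: real. block_eigenvalues B (L (U, \<phi>) (\<phi> p)) = {complex_of_real r}) \<or>
         (\<exists>\<mu>. Im \<mu> \<noteq> 0 \<and> block_eigenvalues B (L (U, \<phi>) (\<phi> p)) = {\<mu>, cnj \<mu>})) \<and>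
        torsion_free_wrt B m (\<phi> ` U) (\<lambda>x. block B (L (U, \<phi>) x)) \<and>
        (\<forall>a. a \<notin> B \<longrightarrow>
           (\<forall>x \<in> \<phi> ` U.
              (ad (block B (L (U, \<phi>) x)) ^^ (m - 1))
                (partial_deriv a (\<lambda>y. block B (L (U, \<phi>) y)) x) = 0)))"
proof -
  note M = assms(2) and L = assms(3)
  obtain U0 \<phi>0 where c0: "(U0, \<phi>0) \<in> \<A>" "p \<in> U0"
    using M assms(5) unfolding smooth_manifold_def by (metis UN_E prod.collapse)
  obtain P C D where CD: "C ** D = mat 1" "D ** C = mat 1" and P: "partition_on (UNIV :: 'n set) P"
    and comm: "\<And>B Y. B \<in> P \<Longrightarrow> (D ** L (U0, \<phi>0) (\<phi>0 p) ** C) ** Y = Y ** (D ** L (U0, \<phi>0) (\<phi>0 p) ** C) \<Longrightarrow>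
      coord_proj B ** Y = Y ** coord_proj B"
    and ev: "\<And>B. B \<in> P \<Longrightarrow> \<exists>\<mu>. block_eigenvalues B (D ** L (U0, \<phi>0) (\<phi>0 p) ** C) = {\<mu>, cnj \<mu>}"
    by (rule real_primary_decomposition[of "L (U0, \<phi>0) (\<phi>0 p)"], rule that)
  \<comment> \<open>The linear change gives \<open>L\<close> its block form at \<open>p\<close>. As
    the later \<open>\<psi>\<close> has identity derivative there, the matrix at \<open>p\<close>
    and its block eigenvalues stay as they are now.\<close>
  obtain \<phi>1 where c1: "(U0, \<phi>1) \<in> \<A>" and L1: "L (U0, \<phi>1) (\<phi>1 p) = D ** L (U0, \<phi>0) (\<phi>0 p) ** C"
    by (rule linear_chart_change[OF M L c0(1) CD c0(2)])
  have "is_chart X (U0, \<phi>1)" using M c1 unfolding smooth_manifold_def by blast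
  then have V: "open (\<phi>1 ` U0)" by (rule is_chartD(2))
  have sL: "smooth_on (snd c ` fst c) (L c)" if "c \<in> \<A>" for c
    using L that by (auto simp: operator_field_def)
  have tf: "torsion_free_wrt UNIV m (snd c ` fst c) (L c)" if "c \<in> \<A>" for c
    using assms(4) that by (auto simp: torsion_free_def)
  obtain W W' \<psi> g where W: "open W" "\<phi>1 p \<in> W" "W \<subseteq> \<phi>1 ` U0" and W': "open W'" and hom: "homeomorphism W W' \<psi> g"
    and sm: "smooth_on W \<psi>" "smooth_on W' g" and D\<psi>: "frechet_derivative \<psi> (at (\<phi>1 p)) = (\<lambda>v. v)"
    and blk: "\<And>x B T. x \<in> W \<Longrightarrow> B \<in> P \<Longrightarrow>
      T ** matrix (frechet_derivative \<psi> (at x)) = matrix (frechet_derivative \<psi> (at x)) ** L (U0, \<phi>1) x \<Longrightarrow>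
      T ** coord_proj B = coord_proj B ** T \<and> separates T (coord_proj B)"
  proof (rule block_diagonal_coordinates[OF V imageI[OF c0(2)] sL[OF c1, simplified] tf[OF c1, simplified] P])
    show "coord_proj B ** Y = Y ** coord_proj B" if "B \<in> P" "L (U0, \<phi>1) (\<phi>1 p) ** Y = Y ** L (U0, \<phi>1) (\<phi>1 p)" for B Y
      using comm that by (simp add: L1)
  qed (rule that)
  define U where "U = {q \<in> U0. \<phi>1 q \<in> W}"
  define \<phi> where "\<phi> = \<psi> \<circ> \<phi>1"
  define A where "A = L (U, \<phi>)"
  note cc = M c1 W(1,3) W' hom sm
  have c: "(U, \<phi>) \<in> \<A>" unfolding U_def \<phi>_def by (rule chart_change_in_atlas[OF cc])
  have im: "\<phi> ` U = W'" unfolding U_def \<phi>_def by (rule chart_change_image[OF cc])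
  have pU: "p \<in> U" using c0(2) W(2) by (simp add: U_def)
  have op: "A (\<psi> x) ** matrix (frechet_derivative \<psi> (at x)) = matrix (frechet_derivative \<psi> (at x)) ** L (U0, \<phi>1) x"
    if "x \<in> W" for x
    unfolding A_def U_def \<phi>_def by (rule chart_change_operator[OF cc L that])
  have A: "A y ** coord_proj B = coord_proj B ** A y \<and> separates (A y) (coord_proj B)" if "y \<in> W'" "B \<in> P" for y B
  proof -
    obtain x where "x \<in> W" "y = \<psi> x" using \<open>y \<in> W'\<close> homeomorphism_image1[OF hom] by blast
    then show ?thesis using blk[OF _ that(2) op] by blast
  qed
  have sA: "smooth_on W' A" and tA: "torsion_free_wrt UNIV m W' A"
    using sL[OF c] tf[OF c] by (simp_all add: im A_def)
  have "matrix (\<lambda>v. v) = (mat 1 :: real ^ 'n ^ 'n)"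
    by (simp add: matrix_def mat_def axis_def vec_eq_iff)
  then have Ap: "A (\<phi> p) = D ** L (U0, \<phi>0) (\<phi>0 p) ** C"
    using op[OF W(2)] by (simp add: D\<psi> L1 \<phi>_def)
  have "block_diagonal P (A y)" if "y \<in> W'" for y
    using A[OF that] by (intro block_diagonalI[OF P]) auto
  moreover have "(\<exists>r :: real. block_eigenvalues B (A (\<phi> p)) = {complex_of_real r}) \<or>
         (\<exists>\<mu>. Im \<mu> \<noteq> 0 \<and> block_eigenvalues B (A (\<phi> p)) = {\<mu>, cnj \<mu>})" if B: "B \<in> P" for B
  proof -
    obtain \<mu> where \<mu>: "block_eigenvalues B (A (\<phi> p)) = {\<mu>, cnj \<mu>}" using ev[OF B] by (auto simp: Ap)
    show ?thesis
    proof (cases "Im \<mu> = 0")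
      case True
      then have "\<mu> = complex_of_real (Re \<mu>)" "cnj \<mu> = complex_of_real (Re \<mu>)" by (simp_all add: complex_eq_iff)
      then show ?thesis using \<mu> by (metis insert_absorb2)
    qed (use \<mu> in blast)
  qed
  moreover have "torsion_free_wrt B m W' (\<lambda>x. block B (A x))" if B: "B \<in> P" for B
    unfolding torsion_free_wrt_def
  proof (intro allI impI ballI)
    fix Z and \<xi> \<eta> :: "real ^ 'n \<Rightarrow> real ^ 'n" and x
    assume Z: "open Z \<and> Z \<subseteq> W' \<and> smooth_on Z \<xi> \<and> smooth_on Z \<eta> \<and> (\<forall>x\<in>Z. \<forall>a. a \<notin> B \<longrightarrow> \<xi> x $ a = 0 \<and> \<eta> x $ a = 0)"
      and x: "x \<in> Z"
    have "coord_proj B *v \<xi> y = \<xi> y" "coord_proj B *v \<eta> y = \<eta> y" if "y \<in> Z" for y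
      using Z that by (auto simp: coord_proj_vec vec_eq_iff)
    moreover have "A y ** coord_proj B = coord_proj B ** A y" if "y \<in> Z" for y using A[OF _ B] Z that by auto
    ultimately have "torsion m (\<lambda>x. block B (A x)) \<xi> \<eta> x = torsion m A \<xi> \<eta> x"
      using torsion_block[of Z A B \<xi> \<eta> x m] Z x smooth_on_subset[OF sA] by blast
    also have "\<dots> = 0" using tA Z x unfolding torsion_free_wrt_def by blast
    finally show "torsion m (\<lambda>x. block B (A x)) \<xi> \<eta> x = 0" .
  qed
  moreover have "(ad (block B (A x)) ^^ (m - 1)) (partial_deriv a (\<lambda>y. block B (A y)) x) = 0"
    if B: "B \<in> P" and a: "a \<notin> B" and x: "x \<in> W'" for B a x
  proof -
    have lin: "bounded_linear (block B)"
      unfolding block_eq_coord_proj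
      by (intro bounded_linear_compose[OF bounded_bilinear.bounded_linear_left[OF bounded_bilinear_matrix_mult]
            bounded_bilinear.bounded_linear_right[OF bounded_bilinear_matrix_mult]])
    have "partial_deriv a (\<lambda>y. block B (A y)) x = block B (derivative_blinfun A x (axis a 1))"
      using frechet_derivative_at[OF bounded_linear.has_derivative[OF lin smooth_on_has_derivative_blinfun[OF sA x]]]
      by (metis partial_deriv_def)
    then have "(ad (block B (A x)) ^^ (m - 1)) (partial_deriv a (\<lambda>y. block B (A y)) x)
        = block B ((ad (A x) ^^ (m - 1)) (derivative_blinfun A x (axis a 1)))"
      using A[OF x B] by (simp add: ad_block)
    also have "\<dots> = 0"
      unfolding block_eq_coord_proj
    proof (rule torsion_free_imp_ad_eq_0[OF W' sA coord_proj_idem _ _ tA _ x])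
      show "coord_proj B *v axis a 1 = 0" using a by (auto simp: coord_proj_vec vec_eq_iff axis_def)
    qed (use A B assms(1) in auto)
    finally show ?thesis .
  qed
  ultimately show ?thesis
    using c pU P by (intro exI[of _ U] exI[of _ \<phi>] exI[of _ P]) (simp add: im A_def)
qed

end
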